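(* Let $\Gamma$ be a commutative group and let $T,S$ be commutative ternary $\Gamma$-semirings. Then there is a natural bijection $$\mathrm{Hom}_{\Gamma\text{-TSR}}(T,S)\ \cong\ \mathrm{Hom}_{\Gamma\text{-Sch}}\big(\mathrm{Spec}_\Gamma(S),\mathrm{Spec}_\Gamma(T)\big),$$ contravariantly functorial in both variables, between homomorphisms of ternary $\Gamma$-semirings $T\to S$ and morphisms of $\Gamma$-schemes $(\mathrm{Spec}_\Gamma(S),\mathcal{O}_S)\to(\mathrm{Spec}_\Gamma(T),\mathcal{O}_T)$. Moreover, for each $T$ the unit of this equivalence is the canonical isomorphism $\eta_T:T\to\Gamma(\mathrm{Spec}_\Gamma(T),\mathcal{O}_T)$ sending $a\in T$ to the global section given by $\frac a1\in T_f$ on each principal open $D_\Gamma(f)$.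
   Context: A commutative semiring is a tuple $(T,+,\cdot,0,1)$ with $(T,+,0)$ and $(T,\cdot,1)$ commutative monoids, multiplication distributing over addition, and $0\cdot x=x\cdot 0=0$. A commutative ternary $\Gamma$-semiring $(T,u)$ is a commutative semiring $T$ with a group homomorphism $u:\Gamma\to T^\times$, $\gamma\mapsto u_\gamma$, together with the operations $\{a\,b\,c\}_\gamma:=a b c u_\gamma$. A homomorphism $(T,u)\to(S,v)$ is a semiring homomorphism $\varphi$ with $\varphi(u_\gamma)=v_\gamma$ for all $\gamma\in\Gamma$; these form $\mathrm{Hom}_{\Gamma\text{-TSR}}(T,S)$. A $\Gamma$-ideal of $T$ is a subset $I$ which is a submonoid of $(T,+,0)$ and satisfies $\{a\,b\,c\}_\gamma\in I$ for all $a\in I$, $b,c\in T$, $\gamma\in\Gamma$. A proper $\Gamma$-ideal $P$ is prime if $\{a\,b\,c\}_\gamma\in P$ implies $a\in P$ or $b\in P$ or $c\in P$, for all $a,b,c\in T$, $\gamma\in\Gamma$. $\mathrm{Spec}_\Gamma(T)$ is the set of prime $\Gamma$-ideals with the $\Gamma$-Zariski topology: closed sets are $V(I)=\{P\mid I\subseteq P\}$ for $\Gamma$-ideals $I$, and the principal opens $D_\Gamma(f)=\{P\mid f\notin P\}$ form a basis. For $f\in T$, $T_f$ is the localization of the semiring $T$ at $S_f=\{1,f,f^2,\dots\}$: fractions $\frac as$ ($a\in T$, $s\in S_f$) with $\frac as=\frac bt$ iff $wat=wbs$ for some $w\in S_f$, and the usual operations. The structure sheaf $\mathcal{O}_T$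 is the unique sheaf of semirings on $\mathrm{Spec}_\Gamma(T)$ extending $\mathcal{O}_T(D_\Gamma(f))=T_f$, with restriction $T_f\to T_g$ for $D_\Gamma(g)\subseteq D_\Gamma(f)$ the unique semiring homomorphism compatible with the canonical maps from $T$. Sections over an open $U$ carry the ternary operations $\{s_1\,s_2\,s_3\}_\gamma=s_1s_2s_3u_\gamma$, where $u_\gamma$ is viewed as a global section. An affine $\Gamma$-scheme is a ringed space (with sheaf of semirings) of the form $(\mathrm{Spec}_\Gamma(T),\mathcal{O}_T)$; a $\Gamma$-scheme is a ringed space locally isomorphic to affine $\Gamma$-schemes. A morphism of $\Gamma$-schemes $f:(X,\mathcal{O}_X)\to(Y,\mathcal{O}_Y)$ is a morphism of ringed spaces such that on every affine open $V\simeq\mathrm{Spec}_\Gamma(R)\subseteq Y$ the induced map on sections respects the ternary $\Gamma$-operations: for all $U\subseteq f^{-1}(V)$, all $a,b,c\in\mathcal{O}_Y(V)$ and $\gamma\in\Gamma$, $f^\#_V(\{a\,b\,c\}_\gamma)=\{f^\#_V(a)\,f^\#_V(b)\,f^\#_V(c)\}_\gamma$. $\Gamma(X,\mathcal{O}_X)$ denotes global sections.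
   Formalization: Morphisms of Γ-schemes are also required to be local on stalks. Without this the claim fails: for trivial Γ, T = Z_(p), S = Q, sending the point of Spec S to the closed point of Spec T gives an extra morphism of ringed spaces not induced by any T → S. *)

theory Defs
  imports "HOL-Algebra.Ring" "HOL-Analysis.Abstract_Topology"
begin

section \<open>Commutative semirings and ternary \<open>\<Gamma>\<close>-semirings\<close>

locale csemiring = semiring R + comm_monoid R for R (structure)

text \<open>The library's \<open>ring_hom\<close> does not mention \<open>\<zero>\<close>; over semirings, preservation of \<open>\<zero>\<close> is
  not automatic. Homomorphisms are extensional, so that equality of functions is equality of
  homomorphisms.\<close>

definition semiring_hom :: "('a, 'm) ring_scheme \<Rightarrow> ('b, 'n) ring_scheme \<Rightarrow> ('a \<Rightarrow> 'b) set" where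
  "semiring_hom R S = {h \<in> ring_hom R S. h \<in> extensional (carrier R) \<and> h \<zero>\<^bsub>R\<^esub> = \<zero>\<^bsub>S\<^esub>}"

definition gamma_semiring ::
  "('g, 'k) monoid_scheme \<Rightarrow> ('a, 'm) ring_scheme \<Rightarrow> ('g \<Rightarrow> 'a) \<Rightarrow> bool" where
  "gamma_semiring G T u \<longleftrightarrow> csemiring T \<and> u \<in> hom G (units_of T)"

definition tern :: "('a, 'm) ring_scheme \<Rightarrow> ('g \<Rightarrow> 'a) \<Rightarrow> 'g \<Rightarrow> 'a \<Rightarrow> 'a \<Rightarrow> 'a \<Rightarrow> 'a" where
  "tern T u \<gamma> a b c = a \<otimes>\<^bsub>T\<^esub> b \<otimes>\<^bsub>T\<^esub> c \<otimes>\<^bsub>T\<^esub> u \<gamma>"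

definition tsr_hom ::
  "('g, 'k) monoid_scheme \<Rightarrow> ('a, 'm) ring_scheme \<Rightarrow> ('g \<Rightarrow> 'a) \<Rightarrow>
   ('b, 'n) ring_scheme \<Rightarrow> ('g \<Rightarrow> 'b) \<Rightarrow> ('a \<Rightarrow> 'b) set" where
  "tsr_hom G T u S v = {\<phi> \<in> semiring_hom T S. \<forall>\<gamma>\<in>carrier G. \<phi> (u \<gamma>) = v \<gamma>}"

definition tsr_iso ::
  "('g, 'k) monoid_scheme \<Rightarrow> ('a, 'm) ring_scheme \<Rightarrow> ('g \<Rightarrow> 'a) \<Rightarrow>
   ('b, 'n) ring_scheme \<Rightarrow> ('g \<Rightarrow> 'b) \<Rightarrow> ('a \<Rightarrow> 'b) set" where
  "tsr_iso G T u S v = {\<phi> \<in> tsr_hom G T u S v.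
     \<exists>\<psi>\<in>tsr_hom G S v T u. (\<forall>a\<in>carrier T. \<psi> (\<phi> a) = a) \<and> (\<forall>b\<in>carrier S. \<phi> (\<psi> b) = b)}"


section \<open>Prime \<open>\<Gamma>\<close>-ideals and the \<open>\<Gamma>\<close>-Zariski topology\<close>

definition gamma_ideal ::
  "('g, 'k) monoid_scheme \<Rightarrow> ('a, 'm) ring_scheme \<Rightarrow> ('g \<Rightarrow> 'a) \<Rightarrow> 'a set \<Rightarrow> bool" where
  "gamma_ideal G T u I \<longleftrightarrow>
     I \<subseteq> carrier T \<and> \<zero>\<^bsub>T\<^esub> \<in> I \<and> (\<forall>a\<in>I. \<forall>b\<in>I. a \<oplus>\<^bsub>T\<^esub> b \<in> I) \<and>
     (\<forall>a\<in>I. \<forall>b\<in>carrier T. \<forall>c\<in>carrier T. \<forall>\<gamma>\<in>carrier G. tern T u \<gamma> a b c \<in> I)"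

definition prime_gamma_ideal ::
  "('g, 'k) monoid_scheme \<Rightarrow> ('a, 'm) ring_scheme \<Rightarrow> ('g \<Rightarrow> 'a) \<Rightarrow> 'a set \<Rightarrow> bool" where
  "prime_gamma_ideal G T u P \<longleftrightarrow>
     gamma_ideal G T u P \<and> P \<noteq> carrier T \<and>
     (\<forall>a\<in>carrier T. \<forall>b\<in>carrier T. \<forall>c\<in>carrier T. \<forall>\<gamma>\<in>carrier G.
        tern T u \<gamma> a b c \<in> P \<longrightarrow> a \<in> P \<or> b \<in> P \<or> c \<in> P)"

definition spec_set ::
  "('g, 'k) monoid_scheme \<Rightarrow> ('a, 'm) ring_scheme \<Rightarrow> ('g \<Rightarrow> 'a) \<Rightarrow> 'a set set" where
  "spec_set G T u = {P. prime_gamma_ideal G T u P}"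

definition vanishing ::
  "('g, 'k) monoid_scheme \<Rightarrow> ('a, 'm) ring_scheme \<Rightarrow> ('g \<Rightarrow> 'a) \<Rightarrow> 'a set \<Rightarrow> 'a set set" where
  "vanishing G T u I = {P \<in> spec_set G T u. I \<subseteq> P}"

definition basic_open ::
  "('g, 'k) monoid_scheme \<Rightarrow> ('a, 'm) ring_scheme \<Rightarrow> ('g \<Rightarrow> 'a) \<Rightarrow> 'a \<Rightarrow> 'a set set" where
  "basic_open G T u f = {P \<in> spec_set G T u. f \<notin> P}"

definition zariski ::
  "('g, 'k) monoid_scheme \<Rightarrow> ('a, 'm) ring_scheme \<Rightarrow> ('g \<Rightarrow> 'a) \<Rightarrow> 'a set topology" where
  "zariski G T u =
     topology (\<lambda>U. \<exists>I. gamma_ideal G T u I \<and> U = spec_set G T u - vanishing G T u I)"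


section \<open>Localization at the powers of an element\<close>

definition powers :: "('a, 'm) ring_scheme \<Rightarrow> 'a \<Rightarrow> 'a set" where
  "powers T f = {f [^]\<^bsub>T\<^esub> n | n :: nat. True}"

definition frac_rel :: "('a, 'm) ring_scheme \<Rightarrow> 'a \<Rightarrow> (('a \<times> 'a) \<times> ('a \<times> 'a)) set" where
  "frac_rel T f = {((a, s), (b, t)) | a s b t.
     a \<in> carrier T \<and> b \<in> carrier T \<and> s \<in> powers T f \<and> t \<in> powers T f \<and>
     (\<exists>w\<in>powers T f. w \<otimes>\<^bsub>T\<^esub> a \<otimes>\<^bsub>T\<^esub> t = w \<otimes>\<^bsub>T\<^esub> b \<otimes>\<^bsub>T\<^esub> s)}"

definition fraction :: "('a, 'm) ring_scheme \<Rightarrow> 'a \<Rightarrow> 'a \<Rightarrow> 'a \<Rightarrow> ('a \<times> 'a) set" where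
  "fraction T f a s = frac_rel T f `` {(a, s)}"

definition localization :: "('a, 'm) ring_scheme \<Rightarrow> 'a \<Rightarrow> ('a \<times> 'a) set ring" where
  "localization T f =
    \<lparr>carrier = (carrier T \<times> powers T f) // frac_rel T f,
     mult = (\<lambda>X Y. \<Union>(a, s)\<in>X. \<Union>(b, t)\<in>Y. fraction T f (a \<otimes>\<^bsub>T\<^esub> b) (s \<otimes>\<^bsub>T\<^esub> t)),
     one = fraction T f \<one>\<^bsub>T\<^esub> \<one>\<^bsub>T\<^esub>,
     zero = fraction T f \<zero>\<^bsub>T\<^esub> \<one>\<^bsub>T\<^esub>,
     add = (\<lambda>X Y. \<Union>(a, s)\<in>X. \<Union>(b, t)\<in>Y.
              fraction T f (a \<otimes>\<^bsub>T\<^esub> t \<oplus>\<^bsub>T\<^esub> b \<otimes>\<^bsub>T\<^esub> s) (s \<otimes>\<^bsub>T\<^esub> t))\<rparr>"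

text \<open>The unique homomorphism \<open>T\<^sub>f \<rightarrow> S\<^sub>g\<close> with \<open>a/1 \<mapsto> \<phi>(a)/1\<close>; it exists whenever \<open>\<phi>(f)\<close>
  becomes invertible in \<open>S\<^sub>g\<close>. The restriction \<open>T\<^sub>f \<rightarrow> T\<^sub>g\<close> is the case \<open>\<phi> = id\<close>.\<close>

definition loc_map ::
  "('a, 'm) ring_scheme \<Rightarrow> 'a \<Rightarrow> ('b, 'n) ring_scheme \<Rightarrow> 'b \<Rightarrow> ('a \<Rightarrow> 'b) \<Rightarrow>
   ('a \<times> 'a) set \<Rightarrow> ('b \<times> 'b) set" where
  "loc_map T f S g \<phi> = (THE h. h \<in> semiring_hom (localization T f) (localization S g) \<and>
     (\<forall>a\<in>carrier T. h (fraction T f a \<one>\<^bsub>T\<^esub>) = fraction S g (\<phi> a) \<one>\<^bsub>S\<^esub>))"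

definition loc_restr ::
  "('a, 'm) ring_scheme \<Rightarrow> 'a \<Rightarrow> 'a \<Rightarrow> ('a \<times> 'a) set \<Rightarrow> ('a \<times> 'a) set" where
  "loc_restr T f g = loc_map T f T g (\<lambda>a. a)"


section \<open>Semiringed spaces over \<open>\<Gamma>\<close>\<close>

text \<open>A space with a sheaf of semirings and distinguished global sections \<open>u\<^sub>\<gamma>\<close>, which induce
  the ternary operations on the sections over every open set. The fields are meaningful only on
  open sets; for \<open>restr X U V\<close> one needs \<open>V \<subseteq> U\<close>.\<close>

record ('p, 's, 'g) gspace =
  space_top :: "'p topology"
  sections :: "'p set \<Rightarrow> 's ring"
  restr :: "'p set \<Rightarrow> 'p set \<Rightarrow> 's \<Rightarrow> 's"
  gunit :: "'g \<Rightarrow> 's"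

definition tern_on ::
  "('p, 's, 'g) gspace \<Rightarrow> 'p set \<Rightarrow> 'g \<Rightarrow> 's \<Rightarrow> 's \<Rightarrow> 's \<Rightarrow> 's" where
  "tern_on X U = tern (sections X U) (\<lambda>\<gamma>. restr X (topspace (space_top X)) U (gunit X \<gamma>))"

definition sheaf_of_semirings :: "('p, 's, 'g) gspace \<Rightarrow> bool" where
  "sheaf_of_semirings X \<longleftrightarrow>
    (\<forall>U. openin (space_top X) U \<longrightarrow> csemiring (sections X U)) \<and>
    (\<forall>U V. openin (space_top X) U \<and> openin (space_top X) V \<and> V \<subseteq> U \<longrightarrow>
       restrict (restr X U V) (carrier (sections X U)) \<in> semiring_hom (sections X U) (sections X V)) \<and>
    (\<forall>U. openin (space_top X) U \<longrightarrow> (\<forall>s\<in>carrier (sections X U). restr X U U s = s)) \<and>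
    (\<forall>U V W. openin (space_top X) U \<and> openin (space_top X) V \<and> openin (space_top X) W \<and>
       W \<subseteq> V \<and> V \<subseteq> U \<longrightarrow>
       (\<forall>s\<in>carrier (sections X U). restr X V W (restr X U V s) = restr X U W s)) \<and>
    (\<forall>\<U> s. (\<forall>V\<in>\<U>. openin (space_top X) V \<and> s V \<in> carrier (sections X V)) \<and>
       (\<forall>V\<in>\<U>. \<forall>W\<in>\<U>. restr X V (V \<inter> W) (s V) = restr X W (V \<inter> W) (s W)) \<longrightarrow>
       (\<exists>!t. t \<in> carrier (sections X (\<Union>\<U>)) \<and> (\<forall>V\<in>\<U>. restr X (\<Union>\<U>) V t = s V)))"

definition gamma_space :: "('g, 'k) monoid_scheme \<Rightarrow> ('p, 's, 'g) gspace \<Rightarrow> bool" where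
  "gamma_space G X \<longleftrightarrow> sheaf_of_semirings X \<and>
     gunit X \<in> hom G (units_of (sections X (topspace (space_top X))))"

definition open_subspace :: "('p, 's, 'g) gspace \<Rightarrow> 'p set \<Rightarrow> ('p, 's, 'g) gspace" where
  "open_subspace X V =
    \<lparr>space_top = subtopology (space_top X) V,
     sections = sections X,
     restr = restr X,
     gunit = (\<lambda>\<gamma>. restr X (topspace (space_top X)) V (gunit X \<gamma>))\<rparr>"

text \<open>A morphism \<open>X \<rightarrow> Y\<close> is a pair of a map \<open>f\<close> on points and a family of maps
  \<open>f\<^sup>#\<^sub>V : \<O>\<^sub>Y(V) \<rightarrow> \<O>\<^sub>X(f\<inverse>(V))\<close> indexed by the open sets of \<open>Y\<close>, all of them extensional.\<close>

type_synonym ('p, 's, 'q, 't) spacemap = "('p \<Rightarrow> 'q) \<times> ('q set \<Rightarrow> 't \<Rightarrow> 's)"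

definition preim :: "('p, 's, 'g) gspace \<Rightarrow> ('p, 's, 'q, 't) spacemap \<Rightarrow> 'q set \<Rightarrow> 'p set" where
  "preim X m V = {x \<in> topspace (space_top X). fst m x \<in> V}"

definition ringed_morphism ::
  "('p, 's, 'g) gspace \<Rightarrow> ('q, 't, 'g) gspace \<Rightarrow> ('p, 's, 'q, 't) spacemap \<Rightarrow> bool" where
  "ringed_morphism X Y m \<longleftrightarrow>
     fst m \<in> extensional (topspace (space_top X)) \<and>
     continuous_map (space_top X) (space_top Y) (fst m) \<and>
     snd m \<in> extensional {V. openin (space_top Y) V} \<and>
     (\<forall>V. openin (space_top Y) V \<longrightarrow>
        snd m V \<in> semiring_hom (sections Y V) (sections X (preim X m V))) \<and>
     (\<forall>V W. openin (space_top Y) V \<and> openin (space_top Y) W \<and> W \<subseteq> V \<longrightarrow>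
        (\<forall>s\<in>carrier (sections Y V).
           snd m W (restr Y V W s) = restr X (preim X m V) (preim X m W) (snd m V s)))"

definition id_map :: "('p, 's, 'g) gspace \<Rightarrow> ('p, 's, 'p, 's) spacemap" where
  "id_map X = (\<lambda>x\<in>topspace (space_top X). x,
     \<lambda>V\<in>{V. openin (space_top X) V}. \<lambda>s\<in>carrier (sections X V). s)"

definition comp_map ::
  "('p, 's, 'g) gspace \<Rightarrow> ('q, 't, 'g) gspace \<Rightarrow> ('r, 'w, 'g) gspace \<Rightarrow>
   ('q, 't, 'r, 'w) spacemap \<Rightarrow> ('p, 's, 'q, 't) spacemap \<Rightarrow> ('p, 's, 'r, 'w) spacemap" where
  "comp_map X Y Z n m = (\<lambda>x\<in>topspace (space_top X). fst n (fst m x),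
     \<lambda>W\<in>{W. openin (space_top Z) W}. \<lambda>s\<in>carrier (sections Z W).
       snd m (preim Y n W) (snd n W s))"

definition gamma_isomorphic ::
  "('g, 'k) monoid_scheme \<Rightarrow> ('p, 's, 'g) gspace \<Rightarrow> ('q, 't, 'g) gspace \<Rightarrow> bool" where
  "gamma_isomorphic G X Y \<longleftrightarrow>
     (\<exists>m n. ringed_morphism X Y m \<and> ringed_morphism Y X n \<and>
        comp_map X Y X n m = id_map X \<and> comp_map Y X Y m n = id_map Y \<and>
        (\<forall>\<gamma>\<in>carrier G. snd m (topspace (space_top Y)) (gunit Y \<gamma>) = gunit X \<gamma>))"


section \<open>The affine \<open>\<Gamma>\<close>-scheme of a ternary \<open>\<Gamma>\<close>-semiring\<close>

definition opens_within ::
  "('g, 'k) monoid_scheme \<Rightarrow> ('a, 'm) ring_scheme \<Rightarrow> ('g \<Rightarrow> 'a) \<Rightarrow> 'a set set \<Rightarrow> 'a set" where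
  "opens_within G T u U = {f \<in> carrier T. basic_open G T u f \<subseteq> U}"

text \<open>The extension to all open sets of the sheaf \<open>D(f) \<mapsto> T\<^sub>f\<close> on the basis of principal opens:
  \<open>\<O>\<^sub>T(U)\<close> is the limit of the \<open>T\<^sub>f\<close> over all \<open>f\<close> with \<open>D(f) \<subseteq> U\<close>, i.e. the semiring of families
  \<open>s\<close> with \<open>s f \<in> T\<^sub>f\<close> that are compatible with restriction. For \<open>U = D(f)\<close> the family is
  determined by \<open>s f\<close>, and \<open>s \<mapsto> s f\<close> is the identification \<open>\<O>\<^sub>T(D(f)) = T\<^sub>f\<close>.\<close>

definition structure_sections ::
  "('g, 'k) monoid_scheme \<Rightarrow> ('a, 'm) ring_scheme \<Rightarrow> ('g \<Rightarrow> 'a) \<Rightarrow> 'a set set \<Rightarrow>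
   ('a \<Rightarrow> ('a \<times> 'a) set) ring" where
  "structure_sections G T u U =
    \<lparr>carrier = {s \<in> (\<Pi>\<^sub>E f\<in>opens_within G T u U. carrier (localization T f)).
       \<forall>f\<in>opens_within G T u U. \<forall>g\<in>carrier T.
         basic_open G T u g \<subseteq> basic_open G T u f \<longrightarrow> loc_restr T f g (s f) = s g},
     mult = (\<lambda>s t. \<lambda>f\<in>opens_within G T u U. s f \<otimes>\<^bsub>localization T f\<^esub> t f),
     one = (\<lambda>f\<in>opens_within G T u U. \<one>\<^bsub>localization T f\<^esub>),
     zero = (\<lambda>f\<in>opens_within G T u U. \<zero>\<^bsub>localization T f\<^esub>),
     add = (\<lambda>s t. \<lambda>f\<in>opens_within G T u U. s f \<oplus>\<^bsub>localization T f\<^esub> t f)\<rparr>"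

definition eta ::
  "('g, 'k) monoid_scheme \<Rightarrow> ('a, 'm) ring_scheme \<Rightarrow> ('g \<Rightarrow> 'a) \<Rightarrow> 'a \<Rightarrow> 'a \<Rightarrow> ('a \<times> 'a) set" where
  "eta G T u = (\<lambda>a\<in>carrier T.
     \<lambda>f\<in>opens_within G T u (spec_set G T u). fraction T f a \<one>\<^bsub>T\<^esub>)"

definition Spec ::
  "('g, 'k) monoid_scheme \<Rightarrow> ('a, 'm) ring_scheme \<Rightarrow> ('g \<Rightarrow> 'a) \<Rightarrow>
   ('a set, 'a \<Rightarrow> ('a \<times> 'a) set, 'g) gspace" where
  "Spec G T u =
    \<lparr>space_top = zariski G T u,
     sections = structure_sections G T u,
     restr = (\<lambda>U V s. restrict s (opens_within G T u V)),
     gunit = (\<lambda>\<gamma>. eta G T u (u \<gamma>))\<rparr>"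

abbreviation global_sections :: "('p, 's, 'g) gspace \<Rightarrow> 's ring" where
  "global_sections X \<equiv> sections X (topspace (space_top X))"


section \<open>\<open>\<Gamma>\<close>-schemes and their morphisms\<close>

text \<open>Necessarily \<open>R \<cong> \<O>\<^sub>X(V)\<close>, so it is no restriction that \<open>R\<close> is taken on the type of
  sections of \<open>X\<close>.\<close>

definition affine_open :: "('g, 'k) monoid_scheme \<Rightarrow> ('p, 's, 'g) gspace \<Rightarrow> 'p set \<Rightarrow> bool" where
  "affine_open G X V \<longleftrightarrow> openin (space_top X) V \<and>
     (\<exists>(R :: 's ring) w. gamma_semiring G R w \<and>
        gamma_isomorphic G (open_subspace X V) (Spec G R w))"

definition gamma_scheme :: "('g, 'k) monoid_scheme \<Rightarrow> ('p, 's, 'g) gspace \<Rightarrow> bool" where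
  "gamma_scheme G X \<longleftrightarrow> gamma_space G X \<and>
     (\<forall>x\<in>topspace (space_top X). \<exists>V. x \<in> V \<and> affine_open G X V)"

definition respects_tern ::
  "('g, 'k) monoid_scheme \<Rightarrow> ('p, 's, 'g) gspace \<Rightarrow> ('q, 't, 'g) gspace \<Rightarrow>
   ('p, 's, 'q, 't) spacemap \<Rightarrow> bool" where
  "respects_tern G X Y m \<longleftrightarrow>
     (\<forall>V. affine_open G Y V \<longrightarrow>
       (\<forall>U. openin (space_top X) U \<and> U \<subseteq> preim X m V \<longrightarrow>
         (\<forall>a\<in>carrier (sections Y V). \<forall>b\<in>carrier (sections Y V). \<forall>c\<in>carrier (sections Y V).
          \<forall>\<gamma>\<in>carrier G.
            restr X (preim X m V) U (snd m V (tern_on Y V \<gamma> a b c)) =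
            tern_on X U \<gamma> (restr X (preim X m V) U (snd m V a))
              (restr X (preim X m V) U (snd m V b)) (restr X (preim X m V) U (snd m V c)))))"

text \<open>\<open>unit_germ X U s x\<close>: the germ at \<open>x\<close> of the section \<open>s\<close> over \<open>U\<close> is a unit of the stalk
  \<open>\<O>\<^sub>X\<^sub>,\<^sub>x\<close>, that is, \<open>s\<close> is invertible on a neighbourhood of \<open>x\<close>.\<close>

definition unit_germ :: "('p, 's, 'g) gspace \<Rightarrow> 'p set \<Rightarrow> 's \<Rightarrow> 'p \<Rightarrow> bool" where
  "unit_germ X U s x \<longleftrightarrow>
     (\<exists>W. openin (space_top X) W \<and> x \<in> W \<and> W \<subseteq> U \<and> restr X U W s \<in> Units (sections X W))"

text \<open>The stalk maps \<open>\<O>\<^sub>Y\<^sub>,\<^sub>f\<^sub>(\<^sub>x\<^sub>) \<rightarrow> \<O>\<^sub>X\<^sub>,\<^sub>x\<close> are local.\<close>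

definition local_on_stalks ::
  "('p, 's, 'g) gspace \<Rightarrow> ('q, 't, 'g) gspace \<Rightarrow> ('p, 's, 'q, 't) spacemap \<Rightarrow> bool" where
  "local_on_stalks X Y m \<longleftrightarrow>
     (\<forall>x\<in>topspace (space_top X). \<forall>V. openin (space_top Y) V \<and> fst m x \<in> V \<longrightarrow>
        (\<forall>s\<in>carrier (sections Y V).
           unit_germ X (preim X m V) (snd m V s) x \<longrightarrow> unit_germ Y V s (fst m x)))"

text \<open>As in ordinary scheme theory, morphisms must be local on stalks: if \<open>\<Gamma>\<close> is trivial and
  \<open>R\<close> is a discrete valuation ring with fraction field \<open>K\<close>, then mapping the point of \<open>Spec K\<close>
  to the closed point of \<open>Spec R\<close> gives a morphism of ringed spaces that is not induced by a
  homomorphism \<open>R \<rightarrow> K\<close>.\<close>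

definition gsch_hom ::
  "('g, 'k) monoid_scheme \<Rightarrow> ('p, 's, 'g) gspace \<Rightarrow> ('q, 't, 'g) gspace \<Rightarrow>
   ('p, 's, 'q, 't) spacemap set" where
  "gsch_hom G X Y = {m. gamma_scheme G X \<and> gamma_scheme G Y \<and>
     ringed_morphism X Y m \<and> respects_tern G X Y m \<and> local_on_stalks X Y m}"

definition global_map ::
  "('q, 't, 'g) gspace \<Rightarrow> ('p, 's, 'q, 't) spacemap \<Rightarrow> 't \<Rightarrow> 's" where
  "global_map Y m = snd m (topspace (space_top Y))"


section \<open>The functor \<open>Spec\<close> on homomorphisms\<close>

text \<open>On points, \<open>P \<mapsto> \<phi>\<inverse>(P)\<close>. The image of a section \<open>s\<close> over \<open>U\<close> is the section over the
  preimage of \<open>U\<close> whose value on each \<open>D(\<phi> f)\<close> with \<open>D(f) \<subseteq> U\<close> is the image of \<open>s f\<close> under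
  \<open>T\<^sub>f \<rightarrow> S\<^sub>\<phi>\<^sub>(\<^sub>f\<^sub>)\<close>; these \<open>D(\<phi> f)\<close> cover the preimage but do not exhaust its principal opens.\<close>

definition Spec_point ::
  "('g, 'k) monoid_scheme \<Rightarrow> ('a, 'm) ring_scheme \<Rightarrow> ('b, 'n) ring_scheme \<Rightarrow> ('g \<Rightarrow> 'b) \<Rightarrow>
   ('a \<Rightarrow> 'b) \<Rightarrow> 'b set \<Rightarrow> 'a set" where
  "Spec_point G T S v \<phi> = (\<lambda>P\<in>spec_set G S v. {a \<in> carrier T. \<phi> a \<in> P})"

definition Spec_map ::
  "('g, 'k) monoid_scheme \<Rightarrow> ('a, 'm) ring_scheme \<Rightarrow> ('g \<Rightarrow> 'a) \<Rightarrow>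
   ('b, 'n) ring_scheme \<Rightarrow> ('g \<Rightarrow> 'b) \<Rightarrow> ('a \<Rightarrow> 'b) \<Rightarrow>
   ('b set, 'b \<Rightarrow> ('b \<times> 'b) set, 'a set, 'a \<Rightarrow> ('a \<times> 'a) set) spacemap" where
  "Spec_map G T u S v \<phi> = (Spec_point G T S v \<phi>,
     \<lambda>U\<in>{U. openin (zariski G T u) U}. \<lambda>s\<in>carrier (structure_sections G T u U).
       THE t. t \<in> carrier (structure_sections G S v
                    {P \<in> spec_set G S v. Spec_point G T S v \<phi> P \<in> U}) \<and>
         (\<forall>f\<in>opens_within G T u U. t (\<phi> f) = loc_map T f S (\<phi> f) \<phi> (s f)))"

end

theory Submission
  imports Defs
begin

text \<open>
  The proof follows the classical one for rings: a homomorphism is recovered from a morphism by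
  taking global sections, and a morphism that is local on stalks is determined by its effect on
  global sections. Two points are special to ternary \<open>\<Gamma>\<close>-semirings.

  First, since the \<open>u\<^sub>\<gamma>\<close> are units, \<open>\<Gamma>\<close>-ideals and prime \<open>\<Gamma>\<close>-ideals are the ordinary ideals and
  primes of the semiring (\<open>gamma_ideal_iff\<close>, \<open>prime_gamma_ideal_iff\<close>). Apart from these two lemmas
  the group enters only through the global sections \<open>u\<^sub>\<gamma>\<close>, which a morphism respects because it
  respects \<open>{1 1 1}\<^sub>\<gamma>\<close> (\<open>m_global_unit\<close>).

  Second, there is no subtraction, so that neither kernels nor differences of sections are available. The
  sheaf property of \<open>D(f) \<mapsto> T\<^sub>f\<close> is proved with a single principle (\<open>power_mem_ideal\<close>, from Zorn's
  lemma): if an ideal is contained only in primes containing \<open>h\<close>, it contains a power of \<open>h\<close>. It is applied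
  to the ideal of elements equalizing two candidates (\<open>localization_eqI_cover\<close>), of elements whose
  principal open has a finite subcover (\<open>quasi_compact_D\<close>), and of common denominators of a
  compatible family (\<open>localization_glue\<close>).

  Given \<open>\<phi> : T \<rightarrow> S\<close>, sections are pulled back by gluing the images of their values under
  \<open>T\<^sub>f \<rightarrow> S\<^sub>\<phi>\<^sub>(\<^sub>f\<^sub>)\<close> (\<open>pull_ex1\<close>), and functoriality is checked value by value. The key to the converse is
  that the germ of \<open>a/f\<^sup>n\<close> at \<open>P\<close> is a unit iff \<open>a \<notin> P\<close> (\<open>unit_germ_iff\<close>). Hence a local morphism \<open>m\<close>
  satisfies \<open>m(P) = \<phi>\<inverse>(P)\<close> for the homomorphism \<open>\<phi>\<close> it induces on global sections
  (\<open>m_point_eq\<close>). Its action on a section \<open>s = a/f\<^sup>n\<close> over \<open>D(f)\<close> is then forced by the equation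
  \<open>s \<cdot> f\<^sup>n = a\<close> between restrictions of global sections (\<open>m_section_eq\<close>). Finally,
  \<open>\<eta>\<close> is bijective because the whole space is \<open>D(1)\<close> and \<open>T\<^sub>1 = T\<close>.
\<close>

section \<open>Ideals and primes of commutative semirings\<close>

context csemiring begin

lemmas semiring_ac = m_assoc m_comm m_lcomm a_assoc a_comm a_lcomm l_distr r_distr

text \<open>These are the \<open>\<Gamma>\<close>-ideals of every ternary \<open>\<Gamma>\<close>-semiring on \<open>R\<close> (\<open>gamma_ideal_iff\<close> below), because the
  extra factor \<open>u\<^sub>\<gamma>\<close> of the ternary product is a unit. Stating the commutative algebra with them keeps
  \<open>\<Gamma>\<close> out of it.\<close>

definition ideal_set :: "'a set \<Rightarrow> bool" where
  "ideal_set I \<longleftrightarrow> I \<subseteq> carrier R \<and> \<zero> \<in> I \<and> (\<forall>a\<in>I. \<forall>b\<in>I. a \<oplus> b \<in> I) \<and>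
     (\<forall>a\<in>I. \<forall>b\<in>carrier R. a \<otimes> b \<in> I)"

definition prime_set :: "'a set \<Rightarrow> bool" where
  "prime_set P \<longleftrightarrow> ideal_set P \<and> \<one> \<notin> P \<and>
     (\<forall>a\<in>carrier R. \<forall>b\<in>carrier R. a \<otimes> b \<in> P \<longrightarrow> a \<in> P \<or> b \<in> P)"

lemma ideal_setD:
  assumes "ideal_set I"
  shows "I \<subseteq> carrier R" "\<zero> \<in> I" "\<And>a b. a \<in> I \<Longrightarrow> b \<in> I \<Longrightarrow> a \<oplus> b \<in> I"
    "\<And>a b. a \<in> I \<Longrightarrow> b \<in> carrier R \<Longrightarrow> a \<otimes> b \<in> I"
    "\<And>a b. a \<in> I \<Longrightarrow> b \<in> carrier R \<Longrightarrow> b \<otimes> a \<in> I"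
proof -
  show *: "I \<subseteq> carrier R" "\<zero> \<in> I" "\<And>a b. a \<in> I \<Longrightarrow> b \<in> I \<Longrightarrow> a \<oplus> b \<in> I"
    "\<And>a b. a \<in> I \<Longrightarrow> b \<in> carrier R \<Longrightarrow> a \<otimes> b \<in> I"
    using assms unfolding ideal_set_def by blast+
  show "b \<otimes> a \<in> I" if "a \<in> I" "b \<in> carrier R" for a b
    using *(4)[OF that] m_comm[of a b] that *(1) by auto
qed

lemma prime_setD:
  assumes "prime_set P"
  shows "ideal_set P" "\<one> \<notin> P" "P \<subseteq> carrier R" "\<zero> \<in> P"
    "\<And>a b. a \<in> carrier R \<Longrightarrow> b \<in> carrier R \<Longrightarrow> a \<otimes> b \<in> P \<longleftrightarrow> a \<in> P \<or> b \<in> P"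
proof -
  show P: "ideal_set P" "\<one> \<notin> P" using assms unfolding prime_set_def by blast+
  show "P \<subseteq> carrier R" "\<zero> \<in> P" by (rule ideal_setD[OF P(1)])+
  show "a \<otimes> b \<in> P \<longleftrightarrow> a \<in> P \<or> b \<in> P" if "a \<in> carrier R" "b \<in> carrier R" for a b
    using that assms ideal_setD(4,5)[OF P(1)] unfolding prime_set_def by blast
qed

lemma prime_set_pow:
  assumes P: "prime_set P" and a: "a \<in> carrier R" and "a [^] (n::nat) \<in> P"
  shows "a \<in> P"
  using assms(3)
proof (induction n)
  case 0
  then show ?case using prime_setD(2)[OF P] by simp
next
  case (Suc n)
  then show ?case using prime_setD(5)[OF P, of "a [^] n" a] a by auto
qed

lemma ideal_setI:
  assumes "I \<subseteq> carrier R" "\<zero> \<in> I" "\<And>a b. a \<in> I \<Longrightarrow> b \<in> I \<Longrightarrow> a \<oplus> b \<in> I"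
    "\<And>a b. a \<in> I \<Longrightarrow> b \<in> carrier R \<Longrightarrow> a \<otimes> b \<in> I"
  shows "ideal_set I"
  using assms unfolding ideal_set_def by simp

lemma ideal_set_principal:
  assumes f: "f \<in> carrier R"
  shows "ideal_set ((\<lambda>c. f \<otimes> c) ` carrier R)"
proof (rule ideal_setI)
  show "\<zero> \<in> (\<lambda>c. f \<otimes> c) ` carrier R" using f by (intro image_eqI[of _ _ \<zero>]) auto
next
  fix a b assume "a \<in> (\<lambda>c. f \<otimes> c) ` carrier R" "b \<in> (\<lambda>c. f \<otimes> c) ` carrier R"
  then obtain c d where "a = f \<otimes> c" "c \<in> carrier R" "b = f \<otimes> d" "d \<in> carrier R" by auto
  then show "a \<oplus> b \<in> (\<lambda>c. f \<otimes> c) ` carrier R"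
    using f by (intro image_eqI[of _ _ "c \<oplus> d"]) (auto simp: r_distr)
next
  fix a b assume "a \<in> (\<lambda>c. f \<otimes> c) ` carrier R" and b: "b \<in> carrier R"
  then obtain c where "a = f \<otimes> c" "c \<in> carrier R" by auto
  then show "a \<otimes> b \<in> (\<lambda>c. f \<otimes> c) ` carrier R"
    using f b by (intro image_eqI[of _ _ "c \<otimes> b"]) (auto simp: m_assoc)
qed (use f in auto)

lemma ideal_set_adjoin:
  assumes I: "ideal_set I" and x: "x \<in> carrier R"
  defines "J \<equiv> {i \<oplus> x \<otimes> c | i c. i \<in> I \<and> c \<in> carrier R}"
  shows "ideal_set J" and "I \<subseteq> J" and "x \<in> J"
proof -
  have mem: "i \<oplus> x \<otimes> c \<in> J" if "i \<in> I" "c \<in> carrier R" for i c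
    using that unfolding J_def by blast
  note Iin = subsetD[OF ideal_setD(1)[OF I]]
  have 0: "\<zero> \<in> J" using mem[of \<zero> \<zero>] ideal_setD(2)[OF I] x by simp
  have 1: "p \<oplus> q \<in> J" if "p \<in> J" "q \<in> J" for p q
  proof -
    obtain i c j d where *: "p = i \<oplus> x \<otimes> c" "i \<in> I" "c \<in> carrier R"
      "q = j \<oplus> x \<otimes> d" "j \<in> I" "d \<in> carrier R"
      using \<open>p \<in> J\<close> \<open>q \<in> J\<close> unfolding J_def by blast
    have "p \<oplus> q = (i \<oplus> j) \<oplus> x \<otimes> (c \<oplus> d)"
      using * Iin x by (simp add: semiring_ac)
    then show ?thesis using * ideal_setD(3)[OF I] mem by auto
  qed
  have 2: "p \<otimes> b \<in> J" if "p \<in> J" "b \<in> carrier R" for p b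
  proof -
    obtain i c where *: "p = i \<oplus> x \<otimes> c" "i \<in> I" "c \<in> carrier R"
      using \<open>p \<in> J\<close> unfolding J_def by blast
    have "p \<otimes> b = (i \<otimes> b) \<oplus> x \<otimes> (c \<otimes> b)"
      using * Iin x \<open>b \<in> carrier R\<close> by (simp add: semiring_ac)
    then show ?thesis using * ideal_setD(4)[OF I] \<open>b \<in> carrier R\<close> mem by auto
  qed
  have 3: "J \<subseteq> carrier R" using Iin x unfolding J_def by auto
  show "ideal_set J" by (rule ideal_setI) (fact 3 0 1 2)+
  show "I \<subseteq> J"
  proof
    fix i assume "i \<in> I"
    then show "i \<in> J" using mem[of i \<zero>] x Iin by simp
  qed
  show "x \<in> J" using mem[of \<zero> \<one>] ideal_setD(2)[OF I] x by simp
qed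

lemma ideal_set_chain_Union:
  assumes "\<C> \<noteq> {}" "subset.chain \<A> \<C>" "\<And>I. I \<in> \<C> \<Longrightarrow> ideal_set I"
  shows "ideal_set (\<Union>\<C>)"
proof (rule ideal_setI)
  show "\<Union>\<C> \<subseteq> carrier R" using ideal_setD(1)[OF assms(3)] by blast
  obtain I where "I \<in> \<C>" using assms(1) by blast
  then show "\<zero> \<in> \<Union>\<C>" using ideal_setD(2)[OF assms(3)] by blast
next
  fix a b assume "a \<in> \<Union>\<C>" "b \<in> \<Union>\<C>"
  then obtain I J where IJ: "a \<in> I" "I \<in> \<C>" "b \<in> J" "J \<in> \<C>" by blast
  then have "I \<subseteq> J \<or> J \<subseteq> I" using assms(2) unfolding subset.chain_def by auto
  then obtain K where "K \<in> \<C>" "a \<in> K" "b \<in> K" using IJ by blast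
  then show "a \<oplus> b \<in> \<Union>\<C>" using ideal_setD(3)[OF assms(3)] by blast
next
  fix a b assume "a \<in> \<Union>\<C>" "b \<in> carrier R"
  then show "a \<otimes> b \<in> \<Union>\<C>" using ideal_setD(4)[OF assms(3)] by blast
qed

text \<open>Krull's argument needs no subtraction. By Zorn's lemma there is a maximal ideal \<open>P\<close> among those
  that contain \<open>I\<close> and no power of \<open>h\<close>. If \<open>a\<close> and \<open>b\<close> are not in \<open>P\<close>, then \<open>P + aR\<close> and \<open>P + bR\<close>
  each contain a power of \<open>h\<close>; the product of these two powers lies in \<open>P + abR\<close>, so \<open>ab\<close> cannot
  be in \<open>P\<close>.\<close>

lemma prime_avoiding_powers:
  assumes I: "ideal_set I" and h: "h \<in> carrier R" and no: "\<And>n::nat. h [^] n \<notin> I"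
  obtains P where "prime_set P" "I \<subseteq> P" "h \<notin> P"
proof -
  define \<A> where "\<A> = {J. ideal_set J \<and> I \<subseteq> J \<and> (\<forall>n::nat. h [^] n \<notin> J)}"
  have ne: "\<A> \<noteq> {}" using I no by (auto simp: \<A>_def)
  have ch: "\<Union>\<C> \<in> \<A>" if "\<C> \<noteq> {}" "subset.chain \<A> \<C>" for \<C>
  proof -
    have sub: "\<C> \<subseteq> \<A>" using that(2) by (simp add: subset.chain_def)
    have "ideal_set (\<Union>\<C>)"
      by (rule ideal_set_chain_Union[OF that]) (use sub in \<open>auto simp: \<A>_def\<close>)
    moreover have "I \<subseteq> \<Union>\<C>" using that(1) sub by (auto simp: \<A>_def)
    moreover have "h [^] n \<notin> \<Union>\<C>" for n :: nat using sub by (auto simp: \<A>_def)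
    ultimately show ?thesis by (simp add: \<A>_def)
  qed
  obtain P where P: "P \<in> \<A>" and max: "\<And>X. X \<in> \<A> \<Longrightarrow> P \<subseteq> X \<Longrightarrow> X = P"
    using subset_Zorn_nonempty[OF ne ch] by blast
  have Pid: "ideal_set P" and PI: "I \<subseteq> P" and Ph: "\<And>n::nat. h [^] n \<notin> P"
    using P unfolding \<A>_def by auto
  note Pin = subsetD[OF ideal_setD(1)[OF Pid]]
  have meets: "\<exists>i c (n::nat). i \<in> P \<and> c \<in> carrier R \<and> h [^] n = i \<oplus> x \<otimes> c"
    if x: "x \<in> carrier R" "x \<notin> P" for x
  proof (rule ccontr)
    assume "\<not> ?thesis"
    then have "h [^] n \<notin> {i \<oplus> x \<otimes> c | i c. i \<in> P \<and> c \<in> carrier R}" for n :: nat by blast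
    then have "{i \<oplus> x \<otimes> c | i c. i \<in> P \<and> c \<in> carrier R} \<in> \<A>"
      using ideal_set_adjoin(1)[OF Pid x(1)] subset_trans[OF PI ideal_set_adjoin(2)[OF Pid x(1)]]
      by (simp add: \<A>_def)
    from max[OF this ideal_set_adjoin(2)[OF Pid x(1)]] ideal_set_adjoin(3)[OF Pid x(1)] x(2)
    show False by blast
  qed
  have "a \<in> P \<or> b \<in> P" if ab: "a \<in> carrier R" "b \<in> carrier R" "a \<otimes> b \<in> P" for a b
  proof (rule ccontr)
    assume "\<not> ?thesis"
    then obtain i c n j d m where *: "i \<in> P" "c \<in> carrier R" "h [^] (n::nat) = i \<oplus> a \<otimes> c"
        "j \<in> P" "d \<in> carrier R" "h [^] (m::nat) = j \<oplus> b \<otimes> d"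
      using meets[OF ab(1)] meets[OF ab(2)] by blast
    have "h [^] (n + m) = (i \<oplus> a \<otimes> c) \<otimes> (j \<oplus> b \<otimes> d)"
      using * nat_pow_mult[OF h, of n m] by simp
    also have "\<dots> = i \<otimes> (j \<oplus> b \<otimes> d) \<oplus> (j \<otimes> (a \<otimes> c) \<oplus> (a \<otimes> b) \<otimes> (c \<otimes> d))"
      using * Pin ab by (simp add: semiring_ac)
    also have "\<dots> \<in> P"
    proof -
      have "i \<otimes> (j \<oplus> b \<otimes> d) \<in> P" "j \<otimes> (a \<otimes> c) \<in> P" "(a \<otimes> b) \<otimes> (c \<otimes> d) \<in> P"
        by (rule ideal_setD(4)[OF Pid]; use * ab Pin in simp)+
      then show ?thesis by (intro ideal_setD(3)[OF Pid])
    qed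
    finally show False using Ph by blast
  qed
  moreover have "\<one> \<notin> P" using Ph[of 0] by simp
  ultimately have "prime_set P" using Pid unfolding prime_set_def by simp
  moreover have "h \<notin> P" using Ph[of 1] h by simp
  ultimately show ?thesis using that PI by blast
qed

text \<open>The form in which primes are used from here on: to find a power of \<open>h\<close> satisfying a condition
  it suffices that the elements satisfying it form an ideal, and that every prime above this ideal
  contains \<open>h\<close>. This replaces all finite sums \<open>h\<^sup>n = \<Sum> b\<^sub>i f\<^sub>i\<close> of the usual proofs.\<close>

lemma power_mem_ideal:
  assumes "ideal_set I" "h \<in> carrier R" "\<And>P. prime_set P \<Longrightarrow> I \<subseteq> P \<Longrightarrow> h \<in> P"
  obtains n :: nat where "h [^] n \<in> I"
  using prime_avoiding_powers[OF assms(1,2)] assms(3) by blast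

end

section \<open>Localization at an element\<close>

lemma csemiringI:
  fixes R (structure)
  assumes "\<And>x y. x \<in> carrier R \<Longrightarrow> y \<in> carrier R \<Longrightarrow> x \<oplus> y \<in> carrier R"
    and "\<zero> \<in> carrier R"
    and "\<And>x y z. x \<in> carrier R \<Longrightarrow> y \<in> carrier R \<Longrightarrow> z \<in> carrier R \<Longrightarrow>
      (x \<oplus> y) \<oplus> z = x \<oplus> (y \<oplus> z)"
    and "\<And>x. x \<in> carrier R \<Longrightarrow> \<zero> \<oplus> x = x"
    and "\<And>x y. x \<in> carrier R \<Longrightarrow> y \<in> carrier R \<Longrightarrow> x \<oplus> y = y \<oplus> x"
    and "\<And>x y. x \<in> carrier R \<Longrightarrow> y \<in> carrier R \<Longrightarrow> x \<otimes> y \<in> carrier R"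
    and "\<one> \<in> carrier R"
    and "\<And>x y z. x \<in> carrier R \<Longrightarrow> y \<in> carrier R \<Longrightarrow> z \<in> carrier R \<Longrightarrow>
      (x \<otimes> y) \<otimes> z = x \<otimes> (y \<otimes> z)"
    and "\<And>x. x \<in> carrier R \<Longrightarrow> \<one> \<otimes> x = x"
    and comm: "\<And>x y. x \<in> carrier R \<Longrightarrow> y \<in> carrier R \<Longrightarrow> x \<otimes> y = y \<otimes> x"
    and distr: "\<And>x y z. x \<in> carrier R \<Longrightarrow> y \<in> carrier R \<Longrightarrow> z \<in> carrier R \<Longrightarrow>
      (x \<oplus> y) \<otimes> z = x \<otimes> z \<oplus> y \<otimes> z"
    and null: "\<And>x. x \<in> carrier R \<Longrightarrow> \<zero> \<otimes> x = \<zero>"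
  shows "csemiring R"
proof -
  interpret m: comm_monoid R by (rule comm_monoidI) (use assms in auto)
  interpret a: abelian_monoid R by (rule abelian_monoidI) (use assms in auto)
  have "semiring R"
  proof
    fix x y z assume xyz: "x \<in> carrier R" "y \<in> carrier R" "z \<in> carrier R"
    show "(x \<oplus> y) \<otimes> z = x \<otimes> z \<oplus> y \<otimes> z" by (rule distr) fact+
    show "z \<otimes> (x \<oplus> y) = z \<otimes> x \<oplus> z \<otimes> y"
      using distr[OF xyz] comm[of z] xyz by auto
  next
    fix x assume x: "x \<in> carrier R"
    show "\<zero> \<otimes> x = \<zero>" by (rule null) fact
    then show "x \<otimes> \<zero> = \<zero>" using comm[OF x, of \<zero>] by auto
  qed
  then show ?thesis by (simp add: csemiring_def m.comm_monoid_axioms)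
qed

context csemiring begin

lemma Units_iff: "x \<in> Units R \<longleftrightarrow> x \<in> carrier R \<and> (\<exists>y\<in>carrier R. x \<otimes> y = \<one>)"
  using m_comm by (auto simp: Units_def)

lemma Units_factor:
  assumes "x \<in> carrier R" "y \<in> carrier R" "x \<otimes> y \<in> Units R"
  shows "x \<in> Units R"
  using assms m_assoc[of x y] by (auto simp: Units_iff)

lemma Units_r_cancel:
  assumes "z \<in> Units R" "x \<in> carrier R" "y \<in> carrier R" "x \<otimes> z = y \<otimes> z"
  shows "x = y"
  using assms m_comm[of _ z] Units_closed[of z] by (metis Units_l_cancel)

lemma Units_pow: "x \<in> Units R \<Longrightarrow> x [^] (n::nat) \<in> Units R"
  by (induction n) auto

abbreviation Loc :: "'a \<Rightarrow> ('a \<times> 'a) set ring" where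
  "Loc f \<equiv> localization R f"

abbreviation canon :: "'a \<Rightarrow> 'a \<Rightarrow> ('a \<times> 'a) set" where
  "canon f a \<equiv> fraction R f a \<one>"

lemma powers_iff: "s \<in> powers R f \<longleftrightarrow> (\<exists>n::nat. s = f [^] n)"
  by (auto simp: powers_def)

lemma powers_closed: "f \<in> carrier R \<Longrightarrow> s \<in> powers R f \<Longrightarrow> s \<in> carrier R"
  by (auto simp: powers_iff)

lemma pow_in_powers [simp]: "f [^] (n::nat) \<in> powers R f"
  by (auto simp: powers_iff)

lemma one_in_powers [simp]: "\<one> \<in> powers R f"
  using pow_in_powers[of f 0] by (simp del: pow_in_powers)

lemma powers_mult: "f \<in> carrier R \<Longrightarrow> s \<in> powers R f \<Longrightarrow> t \<in> powers R f \<Longrightarrow> s \<otimes> t \<in> powers R f"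
  using nat_pow_mult by (force simp: powers_iff)

lemma frac_rel_iff:
  "((a, s), (b, t)) \<in> frac_rel R f \<longleftrightarrow>
     a \<in> carrier R \<and> b \<in> carrier R \<and> s \<in> powers R f \<and> t \<in> powers R f \<and>
     (\<exists>w\<in>powers R f. w \<otimes> a \<otimes> t = w \<otimes> b \<otimes> s)"
  by (auto simp: frac_rel_def)

lemma equiv_frac_rel:
  assumes f: "f \<in> carrier R"
  shows "equiv (carrier R \<times> powers R f) (frac_rel R f)"
proof (rule equivI)
  show "frac_rel R f \<subseteq> (carrier R \<times> powers R f) \<times> carrier R \<times> powers R f"
    by (auto simp: frac_rel_def)
  show "refl_on (carrier R \<times> powers R f) (frac_rel R f)"
    using one_in_powers[of f] by (force intro: refl_onI simp: frac_rel_iff)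
  show "sym (frac_rel R f)"
    by (rule symI) (auto simp: frac_rel_def eq_commute)
  show "trans (frac_rel R f)"
  proof (rule transI, clarsimp simp: frac_rel_iff)
    fix a s b t c r w w'
    assume car: "a \<in> carrier R" "b \<in> carrier R" "c \<in> carrier R"
      and pow: "s \<in> powers R f" "t \<in> powers R f" "r \<in> powers R f" "w \<in> powers R f" "w' \<in> powers R f"
      and 1: "w \<otimes> a \<otimes> t = w \<otimes> b \<otimes> s" and 2: "w' \<otimes> b \<otimes> r = w' \<otimes> c \<otimes> t"
    note pc = pow[THEN powers_closed[OF f]]
    have "(w \<otimes> w' \<otimes> t) \<otimes> a \<otimes> r = (w \<otimes> a \<otimes> t) \<otimes> (w' \<otimes> r)"
      using car pc by (simp add: m_assoc m_comm m_lcomm)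
    also have "\<dots> = (w' \<otimes> b \<otimes> r) \<otimes> (w \<otimes> s)"
      unfolding 1 using car pc by (simp add: m_assoc m_comm m_lcomm)
    also have "\<dots> = (w \<otimes> w' \<otimes> t) \<otimes> c \<otimes> s"
      unfolding 2 using car pc by (simp add: m_assoc m_comm m_lcomm)
    finally show "\<exists>w\<in>powers R f. w \<otimes> a \<otimes> r = w \<otimes> c \<otimes> s"
      using pow powers_mult[OF f] by blast
  qed
qed

lemma fraction_eq_iff:
  assumes "f \<in> carrier R" "a \<in> carrier R" "s \<in> powers R f" "b \<in> carrier R" "t \<in> powers R f"
  shows "fraction R f a s = fraction R f b t \<longleftrightarrow> (\<exists>w\<in>powers R f. w \<otimes> a \<otimes> t = w \<otimes> b \<otimes> s)"
  unfolding fraction_def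
  using assms eq_equiv_class_iff[OF equiv_frac_rel[OF assms(1)], of "(a, s)" "(b, t)"]
  by (auto simp: frac_rel_iff)

lemma fraction_eqI:
  assumes "f \<in> carrier R" "a \<in> carrier R" "s \<in> powers R f" "b \<in> carrier R" "t \<in> powers R f"
    "a \<otimes> t = b \<otimes> s"
  shows "fraction R f a s = fraction R f b t"
  using assms powers_closed[OF assms(1)] fraction_eq_iff[OF assms(1-5)]
  by (auto intro!: bexI[of _ \<one>])

lemma fraction_closed:
  "a \<in> carrier R \<Longrightarrow> s \<in> powers R f \<Longrightarrow> fraction R f a s \<in> carrier (Loc f)"
  by (auto simp: localization_def fraction_def quotient_def)

lemma localization_cases:
  assumes "x \<in> carrier (Loc f)"
  obtains a s where "a \<in> carrier R" "s \<in> powers R f" "x = fraction R f a s"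
  using assms by (auto simp: localization_def fraction_def quotient_def)

lemma in_fraction_iff:
  "(b, t) \<in> fraction R f a s \<longleftrightarrow> ((a, s), (b, t)) \<in> frac_rel R f"
  by (simp add: fraction_def)

lemma in_fractionD:
  assumes f: "f \<in> carrier R" and p: "(b, t) \<in> fraction R f a s"
  shows "b \<in> carrier R" "t \<in> powers R f" "a \<in> carrier R" "s \<in> powers R f"
    "fraction R f b t = fraction R f a s"
  using p equiv_class_eq[OF equiv_frac_rel[OF f], of "(a,s)" "(b,t)"]
  by (auto simp: in_fraction_iff frac_rel_iff fraction_def)

text \<open>Reduces a binary operation defined as a union over two classes to its independence of the
  representatives.\<close>

lemma UN_UN_const:
  assumes "(a, s) \<in> X" "(b, t) \<in> Y"
    "\<And>a' s' b' t'. (a', s') \<in> X \<Longrightarrow> (b', t') \<in> Y \<Longrightarrow> F a' s' b' t' = C"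
  shows "(\<Union>(a', s')\<in>X. \<Union>(b', t')\<in>Y. F a' s' b' t') = C"
  using assms by fast

lemma localization_mult:
    "X \<otimes>\<^bsub>Loc f\<^esub> Y = (\<Union>(a, s)\<in>X. \<Union>(b, t)\<in>Y. fraction R f (a \<otimes> b) (s \<otimes> t))"
  and localization_add:
    "X \<oplus>\<^bsub>Loc f\<^esub> Y =
      (\<Union>(a, s)\<in>X. \<Union>(b, t)\<in>Y. fraction R f (a \<otimes> t \<oplus> b \<otimes> s) (s \<otimes> t))"
  and localization_one: "\<one>\<^bsub>Loc f\<^esub> = canon f \<one>"
  and localization_zero: "\<zero>\<^bsub>Loc f\<^esub> = canon f \<zero>"
  by (simp_all add: localization_def)

lemma fraction_mult:
  assumes f: "f \<in> carrier R" and a: "a \<in> carrier R" "s \<in> powers R f"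
    and b: "b \<in> carrier R" "t \<in> powers R f"
  shows "fraction R f a s \<otimes>\<^bsub>Loc f\<^esub> fraction R f b t = fraction R f (a \<otimes> b) (s \<otimes> t)"
proof -
  have "fraction R f (a' \<otimes> b') (s' \<otimes> t') = fraction R f (a \<otimes> b) (s \<otimes> t)"
    if "(a', s') \<in> fraction R f a s" "(b', t') \<in> fraction R f b t" for a' s' b' t'
  proof -
    note D = in_fractionD[OF f that(1)] in_fractionD[OF f that(2)]
    obtain w w' where w: "w \<in> powers R f" "w \<otimes> a' \<otimes> s = w \<otimes> a \<otimes> s'"
      "w' \<in> powers R f" "w' \<otimes> b' \<otimes> t = w' \<otimes> b \<otimes> t'"
      using D fraction_eq_iff[OF f] by metis
    note pc = powers_closed[OF f]
    have "(w \<otimes> w') \<otimes> (a' \<otimes> b') \<otimes> (s \<otimes> t) = (w \<otimes> a' \<otimes> s) \<otimes> (w' \<otimes> b' \<otimes> t)"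
      using D w(1,3) pc by (simp add: m_assoc m_comm m_lcomm)
    also have "\<dots> = (w \<otimes> w') \<otimes> (a \<otimes> b) \<otimes> (s' \<otimes> t')"
      unfolding w(2,4) using D w(1,3) pc by (simp add: m_assoc m_comm m_lcomm)
    finally show ?thesis
      by (subst fraction_eq_iff[OF f])
        (use D powers_mult[OF f] w(1,3) in \<open>auto intro!: bexI[of _ "w \<otimes> w'"]\<close>)
  qed
  moreover have "(a, s) \<in> fraction R f a s" "(b, t) \<in> fraction R f b t"
    using a b equiv_class_self[OF equiv_frac_rel[OF f]] by (auto simp: fraction_def)
  ultimately show ?thesis
    unfolding localization_mult by (intro UN_UN_const)
qed

lemma fraction_add:
  assumes f: "f \<in> carrier R" and a: "a \<in> carrier R" "s \<in> powers R f"
    and b: "b \<in> carrier R" "t \<in> powers R f"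
  shows "fraction R f a s \<oplus>\<^bsub>Loc f\<^esub> fraction R f b t =
    fraction R f (a \<otimes> t \<oplus> b \<otimes> s) (s \<otimes> t)"
proof -
  have "fraction R f (a' \<otimes> t' \<oplus> b' \<otimes> s') (s' \<otimes> t') = fraction R f (a \<otimes> t \<oplus> b \<otimes> s) (s \<otimes> t)"
    if "(a', s') \<in> fraction R f a s" "(b', t') \<in> fraction R f b t" for a' s' b' t'
  proof -
    note D = in_fractionD[OF f that(1)] in_fractionD[OF f that(2)]
    obtain w w' where w: "w \<in> powers R f" "w \<otimes> a' \<otimes> s = w \<otimes> a \<otimes> s'"
      "w' \<in> powers R f" "w' \<otimes> b' \<otimes> t = w' \<otimes> b \<otimes> t'"
      using D fraction_eq_iff[OF f] by metis
    note pc = powers_closed[OF f]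
    have "(w \<otimes> w') \<otimes> (a' \<otimes> t' \<oplus> b' \<otimes> s') \<otimes> (s \<otimes> t) =
        (w \<otimes> a' \<otimes> s) \<otimes> (w' \<otimes> t \<otimes> t') \<oplus> (w' \<otimes> b' \<otimes> t) \<otimes> (w \<otimes> s \<otimes> s')"
      using D w(1,3) pc by (simp add: semiring_ac)
    also have "\<dots> = (w \<otimes> w') \<otimes> (a \<otimes> t \<oplus> b \<otimes> s) \<otimes> (s' \<otimes> t')"
      unfolding w(2,4) using D w(1,3) pc by (simp add: semiring_ac)
    finally show ?thesis
      by (subst fraction_eq_iff[OF f])
        (use D powers_mult[OF f] w(1,3) pc in \<open>auto intro!: bexI[of _ "w \<otimes> w'"]\<close>)
  qed
  moreover have "(a, s) \<in> fraction R f a s" "(b, t) \<in> fraction R f b t"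
    using a b equiv_class_self[OF equiv_frac_rel[OF f]] by (auto simp: fraction_def)
  ultimately show ?thesis
    unfolding localization_add by (intro UN_UN_const)
qed

lemma csemiring_localization:
  assumes f: "f \<in> carrier R"
  shows "csemiring (Loc f)"
proof -
  note pc = powers_closed[OF f]
  note fr = fraction_mult[OF f] fraction_add[OF f] localization_one localization_zero
    fraction_closed powers_mult[OF f] pc
  show ?thesis
  proof (rule csemiringI)
    fix x y z
    assume "x \<in> carrier (Loc f)" "y \<in> carrier (Loc f)"
      "z \<in> carrier (Loc f)"
    then obtain a s b t c r where e: "x = fraction R f a s" "y = fraction R f b t"
        "z = fraction R f c r"
      and c: "a \<in> carrier R" "b \<in> carrier R" "c \<in> carrier R"
        "s \<in> powers R f" "t \<in> powers R f" "r \<in> powers R f"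
      by (metis localization_cases)
    show "x \<oplus>\<^bsub>Loc f\<^esub> y \<oplus>\<^bsub>Loc f\<^esub> z =
      x \<oplus>\<^bsub>Loc f\<^esub> (y \<oplus>\<^bsub>Loc f\<^esub> z)"
      unfolding e using c by (simp add: fr semiring_ac)
    show "x \<otimes>\<^bsub>Loc f\<^esub> y \<otimes>\<^bsub>Loc f\<^esub> z =
      x \<otimes>\<^bsub>Loc f\<^esub> (y \<otimes>\<^bsub>Loc f\<^esub> z)"
      unfolding e using c by (simp add: fr semiring_ac)
    show "(x \<oplus>\<^bsub>Loc f\<^esub> y) \<otimes>\<^bsub>Loc f\<^esub> z =
      x \<otimes>\<^bsub>Loc f\<^esub> z \<oplus>\<^bsub>Loc f\<^esub> y \<otimes>\<^bsub>Loc f\<^esub> z"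
      unfolding e using c by (simp add: fr) (rule fraction_eqI[OF f]; simp add: fr semiring_ac)
  next
    fix x y
    assume "x \<in> carrier (Loc f)" "y \<in> carrier (Loc f)"
    then obtain a s b t where e: "x = fraction R f a s" "y = fraction R f b t"
      and c: "a \<in> carrier R" "b \<in> carrier R" "s \<in> powers R f" "t \<in> powers R f"
      by (metis localization_cases)
    show "x \<oplus>\<^bsub>Loc f\<^esub> y \<in> carrier (Loc f)"
      "x \<otimes>\<^bsub>Loc f\<^esub> y \<in> carrier (Loc f)"
      unfolding e using c by (simp_all add: fr)
    show "x \<oplus>\<^bsub>Loc f\<^esub> y = y \<oplus>\<^bsub>Loc f\<^esub> x"
      "x \<otimes>\<^bsub>Loc f\<^esub> y = y \<otimes>\<^bsub>Loc f\<^esub> x"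
      unfolding e using c by (simp_all add: fr semiring_ac)
  next
    fix x
    assume "x \<in> carrier (Loc f)"
    then obtain a s where e: "x = fraction R f a s" and c: "a \<in> carrier R" "s \<in> powers R f"
      by (metis localization_cases)
    show "\<zero>\<^bsub>Loc f\<^esub> \<oplus>\<^bsub>Loc f\<^esub> x = x"
      "\<one>\<^bsub>Loc f\<^esub> \<otimes>\<^bsub>Loc f\<^esub> x = x"
      unfolding e using c by (simp_all add: fr)
    show "\<zero>\<^bsub>Loc f\<^esub> \<otimes>\<^bsub>Loc f\<^esub> x = \<zero>\<^bsub>Loc f\<^esub>"
      unfolding e using c by (simp add: fr) (rule fraction_eqI[OF f]; simp add: fr)
  qed (simp_all add: fr)
qed

end

context csemiring begin

lemma canon_closed: "a \<in> carrier R \<Longrightarrow> canon f a \<in> carrier (Loc f)"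
  by (simp add: fraction_closed)

lemma canon_mult:
  "f \<in> carrier R \<Longrightarrow> a \<in> carrier R \<Longrightarrow> b \<in> carrier R \<Longrightarrow>
    canon f a \<otimes>\<^bsub>Loc f\<^esub> canon f b = canon f (a \<otimes> b)"
  by (simp add: fraction_mult)

lemma canon_add:
  "f \<in> carrier R \<Longrightarrow> a \<in> carrier R \<Longrightarrow> b \<in> carrier R \<Longrightarrow>
    canon f a \<oplus>\<^bsub>Loc f\<^esub> canon f b = canon f (a \<oplus> b)"
  by (simp add: fraction_add)

lemma canon_eq_iff:
  assumes "f \<in> carrier R" "a \<in> carrier R" "b \<in> carrier R"
  shows "canon f a = canon f b \<longleftrightarrow> (\<exists>n::nat. f [^] n \<otimes> a = f [^] n \<otimes> b)"
proof -
  have "(w \<otimes> a \<otimes> \<one> = w \<otimes> b \<otimes> \<one>) = (w \<otimes> a = w \<otimes> b)" if "w \<in> powers R f" for w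
    using powers_closed[OF assms(1) that] assms by simp
  then show ?thesis using assms by (auto simp: fraction_eq_iff) (auto simp: powers_iff)
qed

lemma canon_pow_Units:
  assumes f: "f \<in> carrier R"
  shows "canon f (f [^] (n::nat)) \<in> Units (Loc f)"
proof -
  interpret L: csemiring "Loc f" by (rule csemiring_localization[OF f])
  have "canon f (f [^] n) \<otimes>\<^bsub>Loc f\<^esub> fraction R f \<one> (f [^] n) =
      \<one>\<^bsub>Loc f\<^esub>"
    using f by (simp add: fraction_mult localization_one fraction_eqI)
  then show ?thesis using f by (auto simp: L.Units_iff intro!: fraction_closed)
qed

text \<open>Since \<open>f\<^sup>n/1\<close> is a unit of \<open>R\<^sub>f\<close>, the equation \<open>x \<cdot> f\<^sup>n/1 = a/1\<close> determines \<open>x\<close>. Elements of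
  localizations are handled through such equations below: every homomorphism carries them along, so no choice of
  representatives has to be justified again.\<close>

lemma clear_denominator:
  assumes f: "f \<in> carrier R" and x: "x \<in> carrier (Loc f)"
  obtains a n where "a \<in> carrier R"
    "x \<otimes>\<^bsub>Loc f\<^esub> canon f (f [^] (n::nat)) = canon f a"
proof -
  obtain a s where as: "a \<in> carrier R" "s \<in> powers R f" "x = fraction R f a s"
    using x by (rule localization_cases)
  obtain n :: nat where n: "s = f [^] n" using as by (auto simp: powers_iff)
  have "x \<otimes>\<^bsub>Loc f\<^esub> canon f (f [^] n) = canon f a"
    unfolding as n using f as(1) by (simp add: fraction_mult fraction_eqI)
  then show ?thesis using that as(1) by blast
qed

text \<open>If \<open>a/1\<close> has the inverse \<open>b/f\<^sup>n\<close>, then \<open>f\<^sup>m a b = f\<^sup>m f\<^sup>n\<close> for some \<open>m\<close>. Conversely a divisor of a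
  unit is a unit.\<close>

lemma canon_Units_iff:
  assumes f: "f \<in> carrier R" and a: "a \<in> carrier R"
  shows "canon f a \<in> Units (Loc f) \<longleftrightarrow>
    (\<exists>c\<in>carrier R. \<exists>n::nat. a \<otimes> c = f [^] n)"
proof -
  interpret L: csemiring "Loc f" by (rule csemiring_localization[OF f])
  show ?thesis
  proof
    assume "canon f a \<in> Units (Loc f)"
    then obtain x where x: "x \<in> carrier (Loc f)"
        "canon f a \<otimes>\<^bsub>Loc f\<^esub> x = \<one>\<^bsub>Loc f\<^esub>"
      by (auto simp: L.Units_iff)
    obtain b and n :: nat where b: "b \<in> carrier R"
        "x \<otimes>\<^bsub>Loc f\<^esub> canon f (f [^] n) = canon f b"
      using clear_denominator[OF f x(1)] by blast
    have "canon f (a \<otimes> b) = canon f a \<otimes>\<^bsub>Loc f\<^esub> canon f b"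
      using f a b(1) by (simp add: canon_mult)
    also have "\<dots> = (canon f a \<otimes>\<^bsub>Loc f\<^esub> x)
        \<otimes>\<^bsub>Loc f\<^esub> canon f (f [^] n)"
      using f a x(1) by (subst L.m_assoc) (auto simp: b(2) canon_closed)
    also have "\<dots> = canon f (f [^] n)"
      using f by (simp add: x(2) canon_closed)
    finally obtain m :: nat where "f [^] m \<otimes> (a \<otimes> b) = f [^] m \<otimes> f [^] n"
      using f a b(1) by (auto simp: canon_eq_iff)
    then have "a \<otimes> (b \<otimes> f [^] m) = f [^] (m + n)"
      using f a b(1) nat_pow_mult[OF f, of m n] by (simp add: m_assoc m_comm m_lcomm)
    then show "\<exists>c\<in>carrier R. \<exists>n::nat. a \<otimes> c = f [^] n" using f b(1) by blast
  next
    assume "\<exists>c\<in>carrier R. \<exists>n::nat. a \<otimes> c = f [^] n"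
    then obtain c and n :: nat where c: "c \<in> carrier R" "a \<otimes> c = f [^] n" by blast
    have "canon f a \<otimes>\<^bsub>Loc f\<^esub> canon f c \<in> Units (Loc f)"
      using f a c canon_pow_Units[OF f] by (simp add: canon_mult)
    then show "canon f a \<in> Units (Loc f)"
      using L.Units_factor canon_closed a c(1) by blast
  qed
qed

end

section \<open>Homomorphisms out of a localization\<close>

locale csemiring_hom = R: csemiring R + S: csemiring S
  for R (structure) and S (structure) and h +
  assumes hom: "h \<in> ring_hom R S" and hom_zero: "h \<zero>\<^bsub>R\<^esub> = \<zero>\<^bsub>S\<^esub>"
begin

lemma hom_closed: "a \<in> carrier R \<Longrightarrow> h a \<in> carrier S"
  by (rule ring_hom_closed[OF hom])

lemma hom_mult: "a \<in> carrier R \<Longrightarrow> b \<in> carrier R \<Longrightarrow> h (a \<otimes>\<^bsub>R\<^esub> b) = h a \<otimes>\<^bsub>S\<^esub> h b"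
  by (rule ring_hom_mult[OF hom])

lemma hom_add: "a \<in> carrier R \<Longrightarrow> b \<in> carrier R \<Longrightarrow> h (a \<oplus>\<^bsub>R\<^esub> b) = h a \<oplus>\<^bsub>S\<^esub> h b"
  by (rule ring_hom_add[OF hom])

lemma hom_one: "h \<one>\<^bsub>R\<^esub> = \<one>\<^bsub>S\<^esub>"
  by (rule ring_hom_one[OF hom])

lemma hom_pow: "a \<in> carrier R \<Longrightarrow> h (a [^]\<^bsub>R\<^esub> (n::nat)) = h a [^]\<^bsub>S\<^esub> n"
  by (induction n) (auto simp: hom_one hom_mult hom_closed)

lemma hom_Units: "a \<in> Units R \<Longrightarrow> h a \<in> Units S"
  unfolding R.Units_iff S.Units_iff by (metis hom_closed hom_mult hom_one)

text \<open>For \<open>f\<close> with \<open>h(f)\<close> invertible this is the unique extension of \<open>h\<close> to \<open>R\<^sub>f\<close>. The condition refers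
  to all ways of writing \<open>x\<close> as \<open>a/f\<^sup>n\<close>, which makes the value a unique element by definition and
  leaves existence to be shown.\<close>

definition extend :: "'a \<Rightarrow> ('a \<times> 'a) set \<Rightarrow> 'c" where
  "extend f x = (THE y. y \<in> carrier S \<and> (\<forall>a\<in>carrier R. \<forall>n::nat.
     x \<otimes>\<^bsub>R.Loc f\<^esub> R.canon f (f [^]\<^bsub>R\<^esub> n) = R.canon f a \<longrightarrow>
     y \<otimes>\<^bsub>S\<^esub> h (f [^]\<^bsub>R\<^esub> n) = h a))"

context
  fixes f assumes f: "f \<in> carrier R" and unit: "h f \<in> Units S"
begin

lemma hom_pow_Units: "h (f [^]\<^bsub>R\<^esub> (n::nat)) \<in> Units S"
  using S.Units_pow[OF unit] f by (simp add: hom_pow)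

text \<open>Two presentations \<open>a/f\<^sup>n = b/f\<^sup>m\<close> satisfy \<open>f\<^sup>p a f\<^sup>m = f\<^sup>p b f\<^sup>n\<close> for some \<open>p\<close>; after \<open>h\<close> the factor
  \<open>f\<^sup>p\<close> becomes a unit and can be cancelled.\<close>

lemma denominators_agree:
  assumes x: "x \<in> carrier (R.Loc f)" and a: "a \<in> carrier R" and b: "b \<in> carrier R"
    and xa: "x \<otimes>\<^bsub>R.Loc f\<^esub> R.canon f (f [^]\<^bsub>R\<^esub> (n::nat)) = R.canon f a"
    and xb: "x \<otimes>\<^bsub>R.Loc f\<^esub> R.canon f (f [^]\<^bsub>R\<^esub> (m::nat)) = R.canon f b"
  shows "h a \<otimes>\<^bsub>S\<^esub> h (f [^]\<^bsub>R\<^esub> m) = h b \<otimes>\<^bsub>S\<^esub> h (f [^]\<^bsub>R\<^esub> n)"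
proof -
  interpret L: csemiring "R.Loc f" by (rule R.csemiring_localization[OF f])
  let ?\<iota> = "\<lambda>a. R.canon f a"
  have "?\<iota> (a \<otimes>\<^bsub>R\<^esub> f [^]\<^bsub>R\<^esub> m) = (x \<otimes>\<^bsub>R.Loc f\<^esub> ?\<iota> (f [^]\<^bsub>R\<^esub> n)) \<otimes>\<^bsub>R.Loc f\<^esub> ?\<iota> (f [^]\<^bsub>R\<^esub> m)"
    unfolding xa using f a by (simp add: R.canon_mult)
  also have "\<dots> = (x \<otimes>\<^bsub>R.Loc f\<^esub> ?\<iota> (f [^]\<^bsub>R\<^esub> m)) \<otimes>\<^bsub>R.Loc f\<^esub> ?\<iota> (f [^]\<^bsub>R\<^esub> n)"
    using x f R.canon_closed by (simp add: L.m_assoc L.m_comm L.m_lcomm)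
  also have "\<dots> = ?\<iota> (b \<otimes>\<^bsub>R\<^esub> f [^]\<^bsub>R\<^esub> n)"
    unfolding xb using f b by (simp add: R.canon_mult)
  finally obtain p :: nat where
    "f [^]\<^bsub>R\<^esub> p \<otimes>\<^bsub>R\<^esub> (a \<otimes>\<^bsub>R\<^esub> f [^]\<^bsub>R\<^esub> m) = f [^]\<^bsub>R\<^esub> p \<otimes>\<^bsub>R\<^esub> (b \<otimes>\<^bsub>R\<^esub> f [^]\<^bsub>R\<^esub> n)"
    using f a b by (auto simp: R.canon_eq_iff)
  then have "h (f [^]\<^bsub>R\<^esub> p) \<otimes>\<^bsub>S\<^esub> (h a \<otimes>\<^bsub>S\<^esub> h (f [^]\<^bsub>R\<^esub> m)) =
      h (f [^]\<^bsub>R\<^esub> p) \<otimes>\<^bsub>S\<^esub> (h b \<otimes>\<^bsub>S\<^esub> h (f [^]\<^bsub>R\<^esub> n))"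
    using f a b by (metis hom_mult R.nat_pow_closed R.m_closed)
  then show ?thesis
    using S.Units_l_cancel[OF hom_pow_Units] hom_closed f a b by simp
qed

lemma extend_value:
  assumes x: "x \<in> carrier (R.Loc f)" and a: "a \<in> carrier R"
    and xa: "x \<otimes>\<^bsub>R.Loc f\<^esub> R.canon f (f [^]\<^bsub>R\<^esub> (n::nat)) = R.canon f a"
  shows "extend f x \<in> carrier S" "extend f x \<otimes>\<^bsub>S\<^esub> h (f [^]\<^bsub>R\<^esub> n) = h a"
proof -
  let ?P = "\<lambda>y. y \<in> carrier S \<and> (\<forall>a\<in>carrier R. \<forall>n::nat.
     x \<otimes>\<^bsub>R.Loc f\<^esub> R.canon f (f [^]\<^bsub>R\<^esub> n) = R.canon f a \<longrightarrow>
     y \<otimes>\<^bsub>S\<^esub> h (f [^]\<^bsub>R\<^esub> n) = h a)"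
  define y where "y = h a \<otimes>\<^bsub>S\<^esub> inv\<^bsub>S\<^esub> (h (f [^]\<^bsub>R\<^esub> n))"
  note ic = S.Units_inv_closed[OF hom_pow_Units, of n]
  have y: "y \<in> carrier S" using ic hom_closed[OF a] by (simp add: y_def)
  have yn: "y \<otimes>\<^bsub>S\<^esub> h (f [^]\<^bsub>R\<^esub> n) = h a"
    using ic hom_closed a f hom_pow_Units[of n] by (simp add: y_def S.m_assoc)
  have "?P y"
  proof (intro conjI ballI allI impI y)
    fix b and m :: nat assume b: "b \<in> carrier R"
      "x \<otimes>\<^bsub>R.Loc f\<^esub> R.canon f (f [^]\<^bsub>R\<^esub> m) = R.canon f b"
    have "(y \<otimes>\<^bsub>S\<^esub> h (f [^]\<^bsub>R\<^esub> m)) \<otimes>\<^bsub>S\<^esub> h (f [^]\<^bsub>R\<^esub> n) =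
        (y \<otimes>\<^bsub>S\<^esub> h (f [^]\<^bsub>R\<^esub> n)) \<otimes>\<^bsub>S\<^esub> h (f [^]\<^bsub>R\<^esub> m)"
      using y hom_closed f by (simp add: S.m_assoc S.m_comm S.m_lcomm)
    also have "\<dots> = h b \<otimes>\<^bsub>S\<^esub> h (f [^]\<^bsub>R\<^esub> n)"
      unfolding yn by (rule denominators_agree[OF x a b(1) xa b(2)])
    finally show "y \<otimes>\<^bsub>S\<^esub> h (f [^]\<^bsub>R\<^esub> m) = h b"
      using S.Units_r_cancel[OF hom_pow_Units[of n]] y hom_closed f b(1) by simp
  qed
  moreover have "y' = y" if "?P y'" for y'
  proof -
    have "y' \<otimes>\<^bsub>S\<^esub> h (f [^]\<^bsub>R\<^esub> n) = y \<otimes>\<^bsub>S\<^esub> h (f [^]\<^bsub>R\<^esub> n)" using that a xa yn by simp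
    then show ?thesis using S.Units_r_cancel[OF hom_pow_Units[of n]] y that by blast
  qed
  ultimately have "extend f x = y" unfolding extend_def by (rule the_equality)
  then show "extend f x \<in> carrier S" "extend f x \<otimes>\<^bsub>S\<^esub> h (f [^]\<^bsub>R\<^esub> n) = h a"
    using y yn by auto
qed

lemma extend_closed: "x \<in> carrier (R.Loc f) \<Longrightarrow> extend f x \<in> carrier S"
  using R.clear_denominator[OF f] extend_value by metis

lemma extend_eqI:
  assumes x: "x \<in> carrier (R.Loc f)" and a: "a \<in> carrier R"
    and xa: "x \<otimes>\<^bsub>R.Loc f\<^esub> R.canon f (f [^]\<^bsub>R\<^esub> (n::nat)) = R.canon f a"
    and y: "y \<in> carrier S" "y \<otimes>\<^bsub>S\<^esub> h (f [^]\<^bsub>R\<^esub> n) = h a"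
  shows "extend f x = y"
  by (rule S.Units_r_cancel[OF hom_pow_Units[of n]]) (simp_all add: extend_value[OF x a xa] y)

lemma extend_canon:
  assumes a: "a \<in> carrier R"
  shows "extend f (R.canon f a) = h a"
  by (rule extend_eqI[of _ a 0])
    (use f a in \<open>simp_all add: R.canon_closed R.canon_mult hom_closed hom_one\<close>)

lemma extend_hom: "csemiring_hom (R.Loc f) S (extend f)"
proof -
  interpret L: csemiring "R.Loc f" by (rule R.csemiring_localization[OF f])
  let ?\<iota> = "\<lambda>a. R.canon f a"
  note cc = R.canon_closed R.nat_pow_closed[OF f] hom_closed extend_closed
  have pow: "?\<iota> (f [^]\<^bsub>R\<^esub> (n + m)) = ?\<iota> (f [^]\<^bsub>R\<^esub> n) \<otimes>\<^bsub>R.Loc f\<^esub> ?\<iota> (f [^]\<^bsub>R\<^esub> m)"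
    "h (f [^]\<^bsub>R\<^esub> (n + m)) = h (f [^]\<^bsub>R\<^esub> n) \<otimes>\<^bsub>S\<^esub> h (f [^]\<^bsub>R\<^esub> m)" for n m :: nat
    using f by (simp_all add: R.canon_mult R.nat_pow_mult hom_mult[symmetric])
  have mult_add: "extend f (x \<otimes>\<^bsub>R.Loc f\<^esub> y) = extend f x \<otimes>\<^bsub>S\<^esub> extend f y"
      "extend f (x \<oplus>\<^bsub>R.Loc f\<^esub> y) = extend f x \<oplus>\<^bsub>S\<^esub> extend f y"
    if x: "x \<in> carrier (R.Loc f)" and y: "y \<in> carrier (R.Loc f)" for x y
  proof -
    obtain a b and n m :: nat where a: "a \<in> carrier R"
        "x \<otimes>\<^bsub>R.Loc f\<^esub> ?\<iota> (f [^]\<^bsub>R\<^esub> n) = ?\<iota> a"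
      and b: "b \<in> carrier R" "y \<otimes>\<^bsub>R.Loc f\<^esub> ?\<iota> (f [^]\<^bsub>R\<^esub> m) = ?\<iota> b"
      using R.clear_denominator[OF f x] R.clear_denominator[OF f y] by metis
    note ex = extend_value[OF x a] and ey = extend_value[OF y b]
    have "(x \<otimes>\<^bsub>R.Loc f\<^esub> y) \<otimes>\<^bsub>R.Loc f\<^esub> ?\<iota> (f [^]\<^bsub>R\<^esub> (n + m)) =
        (x \<otimes>\<^bsub>R.Loc f\<^esub> ?\<iota> (f [^]\<^bsub>R\<^esub> n)) \<otimes>\<^bsub>R.Loc f\<^esub> (y \<otimes>\<^bsub>R.Loc f\<^esub> ?\<iota> (f [^]\<^bsub>R\<^esub> m))"
      unfolding pow using x y cc(1,2) by (simp add: L.m_assoc L.m_comm L.m_lcomm)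
    also have "\<dots> = ?\<iota> (a \<otimes>\<^bsub>R\<^esub> b)" unfolding a(2) b(2) by (rule R.canon_mult[OF f a(1) b(1)])
    finally have xy: "(x \<otimes>\<^bsub>R.Loc f\<^esub> y) \<otimes>\<^bsub>R.Loc f\<^esub> ?\<iota> (f [^]\<^bsub>R\<^esub> (n + m)) = ?\<iota> (a \<otimes>\<^bsub>R\<^esub> b)" .
    have "(extend f x \<otimes>\<^bsub>S\<^esub> extend f y) \<otimes>\<^bsub>S\<^esub> h (f [^]\<^bsub>R\<^esub> (n + m)) =
        (extend f x \<otimes>\<^bsub>S\<^esub> h (f [^]\<^bsub>R\<^esub> n)) \<otimes>\<^bsub>S\<^esub> (extend f y \<otimes>\<^bsub>S\<^esub> h (f [^]\<^bsub>R\<^esub> m))"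
      unfolding pow using ex(1) ey(1) cc(2,3) by (simp add: S.m_assoc S.m_comm S.m_lcomm)
    also have "\<dots> = h (a \<otimes>\<^bsub>R\<^esub> b)" unfolding ex(2) ey(2) using a b by (simp add: hom_mult)
    finally show "extend f (x \<otimes>\<^bsub>R.Loc f\<^esub> y) = extend f x \<otimes>\<^bsub>S\<^esub> extend f y"
      using x y a(1) b(1) ex(1) ey(1) xy by (intro extend_eqI) auto
    have "(x \<oplus>\<^bsub>R.Loc f\<^esub> y) \<otimes>\<^bsub>R.Loc f\<^esub> ?\<iota> (f [^]\<^bsub>R\<^esub> (n + m)) =
        (x \<otimes>\<^bsub>R.Loc f\<^esub> ?\<iota> (f [^]\<^bsub>R\<^esub> n)) \<otimes>\<^bsub>R.Loc f\<^esub> ?\<iota> (f [^]\<^bsub>R\<^esub> m) \<oplus>\<^bsub>R.Loc f\<^esub>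
        (y \<otimes>\<^bsub>R.Loc f\<^esub> ?\<iota> (f [^]\<^bsub>R\<^esub> m)) \<otimes>\<^bsub>R.Loc f\<^esub> ?\<iota> (f [^]\<^bsub>R\<^esub> n)"
      unfolding pow using x y cc(1,2) by (simp add: L.semiring_ac)
    also have "\<dots> = ?\<iota> (a \<otimes>\<^bsub>R\<^esub> f [^]\<^bsub>R\<^esub> m \<oplus>\<^bsub>R\<^esub> b \<otimes>\<^bsub>R\<^esub> f [^]\<^bsub>R\<^esub> n)"
      unfolding a(2) b(2) using f a(1) b(1) by (simp add: R.canon_mult R.canon_add)
    finally have xy: "(x \<oplus>\<^bsub>R.Loc f\<^esub> y) \<otimes>\<^bsub>R.Loc f\<^esub> ?\<iota> (f [^]\<^bsub>R\<^esub> (n + m)) =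
      ?\<iota> (a \<otimes>\<^bsub>R\<^esub> f [^]\<^bsub>R\<^esub> m \<oplus>\<^bsub>R\<^esub> b \<otimes>\<^bsub>R\<^esub> f [^]\<^bsub>R\<^esub> n)" .
    have "(extend f x \<oplus>\<^bsub>S\<^esub> extend f y) \<otimes>\<^bsub>S\<^esub> h (f [^]\<^bsub>R\<^esub> (n + m)) =
        (extend f x \<otimes>\<^bsub>S\<^esub> h (f [^]\<^bsub>R\<^esub> n)) \<otimes>\<^bsub>S\<^esub> h (f [^]\<^bsub>R\<^esub> m) \<oplus>\<^bsub>S\<^esub>
        (extend f y \<otimes>\<^bsub>S\<^esub> h (f [^]\<^bsub>R\<^esub> m)) \<otimes>\<^bsub>S\<^esub> h (f [^]\<^bsub>R\<^esub> n)"
      unfolding pow using ex(1) ey(1) cc(2,3) by (simp add: S.semiring_ac)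
    also have "\<dots> = h (a \<otimes>\<^bsub>R\<^esub> f [^]\<^bsub>R\<^esub> m \<oplus>\<^bsub>R\<^esub> b \<otimes>\<^bsub>R\<^esub> f [^]\<^bsub>R\<^esub> n)"
      unfolding ex(2) ey(2) using a(1) b(1) cc(2) by (simp add: hom_mult hom_add)
    finally show "extend f (x \<oplus>\<^bsub>R.Loc f\<^esub> y) = extend f x \<oplus>\<^bsub>S\<^esub> extend f y"
      using x y a(1) b(1) ex(1) ey(1) xy cc(2) by (intro extend_eqI) auto
  qed
  show ?thesis
  proof
    show "extend f \<in> ring_hom (R.Loc f) S"
      by (rule ring_hom_memI)
        (simp_all add: extend_closed mult_add, simp add: R.localization_one extend_canon hom_one)
    show "extend f \<zero>\<^bsub>R.Loc f\<^esub> = \<zero>\<^bsub>S\<^esub>"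
      by (simp add: R.localization_zero extend_canon hom_zero)
  qed
qed

text \<open>Uniqueness in the universal property of \<open>R\<^sub>f\<close>.\<close>

lemma hom_from_localization_value:
  assumes k: "csemiring_hom (R.Loc f) S k"
    and ka: "\<And>a. a \<in> carrier R \<Longrightarrow> k (R.canon f a) = h a"
    and x: "x \<in> carrier (R.Loc f)"
  shows "k x = extend f x"
proof -
  interpret k: csemiring_hom "R.Loc f" S k by (rule k)
  obtain a and n :: nat where a: "a \<in> carrier R"
      "x \<otimes>\<^bsub>R.Loc f\<^esub> R.canon f (f [^]\<^bsub>R\<^esub> n) = R.canon f a"
    using R.clear_denominator[OF f x] by metis
  have "k x \<otimes>\<^bsub>S\<^esub> h (f [^]\<^bsub>R\<^esub> n) = h a"
    using k.hom_mult[OF x, of "R.canon f (f [^]\<^bsub>R\<^esub> n)"] f a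
    by (simp add: ka R.canon_closed)
  then show ?thesis using extend_eqI[OF x a k.hom_closed[OF x]] by simp
qed

end

end

lemma semiring_hom_iff:
  assumes "csemiring R" "csemiring S"
  shows "h \<in> semiring_hom R S \<longleftrightarrow> csemiring_hom R S h \<and> h \<in> extensional (carrier R)"
  using assms by (auto simp: semiring_hom_def csemiring_hom_def csemiring_hom_axioms_def)

lemma csemiring_hom_cong:
  assumes "csemiring_hom R S h" "\<And>a. a \<in> carrier R \<Longrightarrow> h' a = h a"
  shows "csemiring_hom R S h'"
proof -
  interpret csemiring_hom R S h by fact
  show ?thesis
    by unfold_locales (auto intro!: ring_hom_memI simp: assms(2) hom_closed hom_mult hom_add hom_one hom_zero)
qed

lemma csemiring_hom_comp:
  assumes "csemiring_hom R S h" "csemiring_hom S Q k"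
  shows "csemiring_hom R Q (\<lambda>a. k (h a))"
proof -
  interpret h: csemiring_hom R S h by fact
  interpret k: csemiring_hom S Q k by fact
  show ?thesis
    by unfold_locales (auto intro!: ring_hom_memI simp: h.hom_closed h.hom_mult h.hom_add h.hom_one
        h.hom_zero k.hom_closed k.hom_mult k.hom_add k.hom_one k.hom_zero)
qed

lemma (in csemiring) csemiring_hom_canon:
  assumes f: "f \<in> carrier R"
  shows "csemiring_hom R (Loc f) (\<lambda>a. canon f a)"
proof -
  interpret L: csemiring "Loc f" by (rule csemiring_localization[OF f])
  show ?thesis
    by unfold_locales (auto intro!: ring_hom_memI
        simp: canon_closed canon_mult[OF f] canon_add[OF f] localization_one localization_zero)
qed

lemma (in csemiring) csemiring_hom_id: "csemiring_hom R R (\<lambda>a. a)"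
  by unfold_locales (auto intro!: ring_hom_memI)

context csemiring_hom begin

lemma hom_canon: "g \<in> carrier S \<Longrightarrow>
    csemiring_hom R (S.Loc g) (\<lambda>a. S.canon g (h a))"
  by (rule csemiring_hom_comp[OF csemiring_hom_axioms S.csemiring_hom_canon])

context
  fixes f g assumes f: "f \<in> carrier R" and g: "g \<in> carrier S"
    and unit: "S.canon g (h f) \<in> Units (S.Loc g)"
begin

interpretation j: csemiring_hom R "S.Loc g" "\<lambda>a. S.canon g (h a)"
  by (rule hom_canon[OF g])

text \<open>\<open>loc_map\<close> is the universal property applied to \<open>R \<rightarrow> S \<rightarrow> S\<^sub>g\<close>.\<close>

lemma loc_map_eq_extend: "loc_map R f S g h = restrict (j.extend f) (carrier (R.Loc f))"
  unfolding loc_map_def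
proof (rule the_equality)
  let ?e = "restrict (j.extend f) (carrier (R.Loc f))"
  note L = R.csemiring_localization[OF f] S.csemiring_localization[OF g]
  have "csemiring_hom (R.Loc f) (S.Loc g) ?e"
    by (rule csemiring_hom_cong[OF j.extend_hom[OF f unit]]) simp
  then show "?e \<in> semiring_hom (R.Loc f) (S.Loc g) \<and>
      (\<forall>a\<in>carrier R. ?e (R.canon f a) = S.canon g (h a))"
    by (simp add: semiring_hom_iff[OF L] R.canon_closed j.extend_canon[OF f unit])
  fix k assume "k \<in> semiring_hom (R.Loc f) (S.Loc g) \<and>
      (\<forall>a\<in>carrier R. k (R.canon f a) = S.canon g (h a))"
  then have k: "csemiring_hom (R.Loc f) (S.Loc g) k"
      "k \<in> extensional (carrier (R.Loc f))"
      "\<And>a. a \<in> carrier R \<Longrightarrow> k (R.canon f a) = S.canon g (h a)"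
    by (auto simp: semiring_hom_iff[OF L])
  show "k = ?e"
    using j.hom_from_localization_value[OF f unit k(1,3)] k(2)
    by (auto intro!: extensionalityI[of _ "carrier (R.Loc f)"])
qed

lemma loc_map_hom: "csemiring_hom (R.Loc f) (S.Loc g) (loc_map R f S g h)"
  by (rule csemiring_hom_cong[OF j.extend_hom[OF f unit]]) (simp add: loc_map_eq_extend)

lemma loc_map_closed:
  "x \<in> carrier (R.Loc f) \<Longrightarrow> loc_map R f S g h x \<in> carrier (S.Loc g)"
  using csemiring_hom.hom_closed[OF loc_map_hom] .

lemma loc_map_canon:
  "a \<in> carrier R \<Longrightarrow> loc_map R f S g h (R.canon f a) = S.canon g (h a)"
  by (simp add: loc_map_eq_extend R.canon_closed j.extend_canon[OF f unit])

lemma loc_map_value: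
  assumes "x \<in> carrier (R.Loc f)" "a \<in> carrier R"
    "x \<otimes>\<^bsub>R.Loc f\<^esub> R.canon f (f [^]\<^bsub>R\<^esub> (n::nat)) = R.canon f a"
  shows "loc_map R f S g h x \<otimes>\<^bsub>S.Loc g\<^esub> S.canon g (h (f [^]\<^bsub>R\<^esub> n)) =
    S.canon g (h a)"
  using j.extend_value[OF f unit assms] assms(1) by (simp add: loc_map_eq_extend)

text \<open>The tool for all identities between maps of localizations: \<open>y\<close> is the image of \<open>x = a/f\<^sup>n\<close> as soon
  as it satisfies the image of the equation \<open>x \<cdot> f\<^sup>n/1 = a/1\<close>.\<close>

lemma loc_map_eqI:
  assumes "x \<in> carrier (R.Loc f)" "a \<in> carrier R"
    "x \<otimes>\<^bsub>R.Loc f\<^esub> R.canon f (f [^]\<^bsub>R\<^esub> (n::nat)) = R.canon f a"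
    "y \<in> carrier (S.Loc g)"
    "y \<otimes>\<^bsub>S.Loc g\<^esub> S.canon g (h (f [^]\<^bsub>R\<^esub> n)) = S.canon g (h a)"
  shows "loc_map R f S g h x = y"
  using j.extend_eqI[OF f unit assms] assms(1) by (simp add: loc_map_eq_extend)

end

end

section \<open>The sheaf of localizations on principal opens\<close>

context csemiring begin

text \<open>The principal open \<open>D\<^sub>\<Gamma>(f)\<close>, described without \<open>\<Gamma>\<close>.\<close>

definition D :: "'a \<Rightarrow> 'a set set" where
  "D f = {P. prime_set P \<and> f \<notin> P}"

lemma D_mult: "f \<in> carrier R \<Longrightarrow> g \<in> carrier R \<Longrightarrow> D (f \<otimes> g) = D f \<inter> D g"
  by (auto simp: D_def prime_setD(5))

text \<open>If \<open>D(g) \<subseteq> D(f)\<close>, every prime above the principal ideal \<open>fR\<close> contains \<open>g\<close>, so a power of \<open>g\<close> is a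
  multiple of \<open>f\<close>. Hence the restriction map \<open>R\<^sub>f \<rightarrow> R\<^sub>g\<close> exists exactly when \<open>D(g) \<subseteq> D(f)\<close>.\<close>

lemma D_subset_iff:
  assumes f: "f \<in> carrier R" and g: "g \<in> carrier R"
  shows "D g \<subseteq> D f \<longleftrightarrow> canon g f \<in> Units (Loc g)"
  unfolding canon_Units_iff[OF g f]
proof
  assume sub: "D g \<subseteq> D f"
  have "g \<in> P" if P: "prime_set P" "(\<lambda>c. f \<otimes> c) ` carrier R \<subseteq> P" for P
  proof -
    have "f \<otimes> \<one> \<in> P" using P(2) by blast
    then show ?thesis using sub P(1) f by (auto simp: D_def)
  qed
  then obtain n :: nat where "g [^] n \<in> (\<lambda>c. f \<otimes> c) ` carrier R"
    using power_mem_ideal[OF ideal_set_principal[OF f] g] by blast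
  then show "\<exists>c\<in>carrier R. \<exists>n::nat. f \<otimes> c = g [^] n" by (metis imageE)
next
  assume "\<exists>c\<in>carrier R. \<exists>n::nat. f \<otimes> c = g [^] n"
  then obtain c and n :: nat where c: "c \<in> carrier R" "f \<otimes> c = g [^] n" by blast
  show "D g \<subseteq> D f"
  proof
    fix P assume P: "P \<in> D g"
    then have "g [^] n \<notin> P" using prime_set_pow[OF _ g] by (auto simp: D_def)
    then show "P \<in> D f" using P prime_setD(5)[of P f c] f c by (auto simp: D_def)
  qed
qed

context
  fixes f g assumes f: "f \<in> carrier R" and g: "g \<in> carrier R" and sub: "D g \<subseteq> D f"
begin

interpretation i: csemiring_hom R R "\<lambda>a. a" by (rule csemiring_hom_id)

lemmas loc_restr_unit = D_subset_iff[OF f g, THEN iffD1, OF sub]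

lemma loc_restr_hom: "csemiring_hom (Loc f) (Loc g) (loc_restr R f g)"
  unfolding loc_restr_def by (rule i.loc_map_hom[OF f g loc_restr_unit])

lemma loc_restr_closed: "x \<in> carrier (Loc f) \<Longrightarrow> loc_restr R f g x \<in> carrier (Loc g)"
  unfolding loc_restr_def by (rule i.loc_map_closed[OF f g loc_restr_unit])

lemma loc_restr_canon: "a \<in> carrier R \<Longrightarrow> loc_restr R f g (canon f a) = canon g a"
  unfolding loc_restr_def by (rule i.loc_map_canon[OF f g loc_restr_unit])

lemma loc_restr_value:
  assumes "x \<in> carrier (Loc f)" "a \<in> carrier R" "x \<otimes>\<^bsub>Loc f\<^esub> canon f (f [^] (n::nat)) = canon f a"
  shows "loc_restr R f g x \<otimes>\<^bsub>Loc g\<^esub> canon g (f [^] n) = canon g a"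
  unfolding loc_restr_def by (rule i.loc_map_value[OF f g loc_restr_unit assms])

lemma loc_restr_eqI:
  assumes "x \<in> carrier (Loc f)" "a \<in> carrier R" "x \<otimes>\<^bsub>Loc f\<^esub> canon f (f [^] (n::nat)) = canon f a"
    "y \<in> carrier (Loc g)" "y \<otimes>\<^bsub>Loc g\<^esub> canon g (f [^] n) = canon g a"
  shows "loc_restr R f g x = y"
  unfolding loc_restr_def by (rule i.loc_map_eqI[OF f g loc_restr_unit assms])

end

lemma loc_restr_trans:
  assumes f: "f \<in> carrier R" and g: "g \<in> carrier R" and k: "k \<in> carrier R"
    and fg: "D g \<subseteq> D f" and gk: "D k \<subseteq> D g" and x: "x \<in> carrier (Loc f)"
  shows "loc_restr R g k (loc_restr R f g x) = loc_restr R f k x"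
proof -
  interpret \<rho>: csemiring_hom "Loc g" "Loc k" "loc_restr R g k" by (rule loc_restr_hom[OF g k gk])
  obtain a and n :: nat where a: "a \<in> carrier R" "x \<otimes>\<^bsub>Loc f\<^esub> canon f (f [^] n) = canon f a"
    using clear_denominator[OF f x] by metis
  note v = loc_restr_closed[OF f g fg x] loc_restr_value[OF f g fg x a]
  have "loc_restr R g k (loc_restr R f g x) \<otimes>\<^bsub>Loc k\<^esub> canon k (f [^] n) =
      loc_restr R g k (loc_restr R f g x \<otimes>\<^bsub>Loc g\<^esub> canon g (f [^] n))"
    using v(1) f by (simp add: \<rho>.hom_mult canon_closed loc_restr_canon[OF g k gk])
  also have "\<dots> = canon k a" using v(2) a(1) by (simp add: loc_restr_canon[OF g k gk])
  finally show ?thesis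
    by (intro loc_restr_eqI[OF f k subset_trans[OF gk fg] x a, symmetric])
      (simp_all add: \<rho>.hom_closed v(1))
qed

text \<open>Over rings, this says that the kernel of \<open>R\<^sub>f \<rightarrow> R\<^sub>f\<^sub>g\<close> is killed by powers of \<open>g\<close>. Equality in
  \<open>R\<^sub>f\<^sub>g\<close> is witnessed by some factor \<open>(fg)\<^sup>p\<close>, from which the unit \<open>f\<^sup>p\<close> of \<open>R\<^sub>f\<close> cancels.\<close>

lemma loc_restr_eq_imp_power:
  assumes f: "f \<in> carrier R" and g: "g \<in> carrier R"
    and z: "z \<in> carrier (Loc f)" and w: "w \<in> carrier (Loc f)"
    and eq: "loc_restr R f (f \<otimes> g) z = loc_restr R f (f \<otimes> g) w"
  obtains p :: nat where "canon f (g [^] p) \<otimes>\<^bsub>Loc f\<^esub> z = canon f (g [^] p) \<otimes>\<^bsub>Loc f\<^esub> w"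
proof -
  interpret L: csemiring "Loc f" by (rule csemiring_localization[OF f])
  interpret M: csemiring "Loc (f \<otimes> g)" by (rule csemiring_localization) (simp add: f g)
  have fg: "f \<otimes> g \<in> carrier R" "D (f \<otimes> g) \<subseteq> D f" using f g by (simp_all add: D_mult)
  obtain a b and n m :: nat where a: "a \<in> carrier R" "z \<otimes>\<^bsub>Loc f\<^esub> canon f (f [^] n) = canon f a"
    and b: "b \<in> carrier R" "w \<otimes>\<^bsub>Loc f\<^esub> canon f (f [^] m) = canon f b"
    using clear_denominator[OF f z] clear_denominator[OF f w] by metis
  note vz = loc_restr_value[OF f fg z a] and vw = loc_restr_value[OF f fg w b, folded eq]
  note cl = loc_restr_closed[OF f fg z]
  let ?k = "canon (f \<otimes> g)"
  have "?k (a \<otimes> f [^] m) = (loc_restr R f (f \<otimes> g) z \<otimes>\<^bsub>Loc (f \<otimes> g)\<^esub> ?k (f [^] n)) \<otimes>\<^bsub>Loc (f \<otimes> g)\<^esub> ?k (f [^] m)"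
    unfolding vz using a f fg by (simp add: canon_mult)
  also have "\<dots> = (loc_restr R f (f \<otimes> g) z \<otimes>\<^bsub>Loc (f \<otimes> g)\<^esub> ?k (f [^] m)) \<otimes>\<^bsub>Loc (f \<otimes> g)\<^esub> ?k (f [^] n)"
    using cl f by (simp add: M.m_assoc M.m_comm M.m_lcomm canon_closed)
  also have "\<dots> = ?k (b \<otimes> f [^] n)"
    unfolding vw using b f fg by (simp add: canon_mult)
  finally obtain p :: nat where
    "(f \<otimes> g) [^] p \<otimes> (a \<otimes> f [^] m) = (f \<otimes> g) [^] p \<otimes> (b \<otimes> f [^] n)"
    using a b f fg by (auto simp: canon_eq_iff)
  then have "f [^] p \<otimes> (g [^] p \<otimes> (a \<otimes> f [^] m)) = f [^] p \<otimes> (g [^] p \<otimes> (b \<otimes> f [^] n))"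
    using a b f g by (simp add: nat_pow_distrib m_assoc)
  then have e: "canon f (g [^] p \<otimes> (a \<otimes> f [^] m)) = canon f (g [^] p \<otimes> (b \<otimes> f [^] n))"
    using a b f g by (subst canon_eq_iff) auto
  have u: "canon f (f [^] n) \<otimes>\<^bsub>Loc f\<^esub> canon f (f [^] m) \<in> Units (Loc f)"
    using canon_pow_Units[OF f] by blast
  have "canon f (g [^] p) \<otimes>\<^bsub>Loc f\<^esub> z \<otimes>\<^bsub>Loc f\<^esub> (canon f (f [^] n) \<otimes>\<^bsub>Loc f\<^esub> canon f (f [^] m)) =
    canon f (g [^] p) \<otimes>\<^bsub>Loc f\<^esub> ((z \<otimes>\<^bsub>Loc f\<^esub> canon f (f [^] n)) \<otimes>\<^bsub>Loc f\<^esub> canon f (f [^] m))"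
    using z f g by (simp add: L.m_assoc canon_closed)
  also have "\<dots> = canon f (g [^] p) \<otimes>\<^bsub>Loc f\<^esub> ((w \<otimes>\<^bsub>Loc f\<^esub> canon f (f [^] m)) \<otimes>\<^bsub>Loc f\<^esub> canon f (f [^] n))"
    unfolding a(2) b(2) using e a(1) b(1) f g by (simp add: canon_mult)
  also have "\<dots> = canon f (g [^] p) \<otimes>\<^bsub>Loc f\<^esub> w \<otimes>\<^bsub>Loc f\<^esub> (canon f (f [^] n) \<otimes>\<^bsub>Loc f\<^esub> canon f (f [^] m))"
    using w f g by (simp add: L.m_assoc L.m_comm L.m_lcomm canon_closed)
  finally have "canon f (g [^] p) \<otimes>\<^bsub>Loc f\<^esub> z = canon f (g [^] p) \<otimes>\<^bsub>Loc f\<^esub> w"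
    using L.Units_r_cancel[OF u] z w g canon_closed by simp
  then show ?thesis by (rule that)
qed

text \<open>Separatedness. The \<open>r\<close> with \<open>r y = r y'\<close> form an ideal. It contains a power of each \<open>F i\<close>; as the
  \<open>D(F i)\<close> cover \<open>D(h)\<close>, it contains a power of \<open>h\<close>, which is a unit of \<open>R\<^sub>h\<close>.\<close>

lemma localization_eqI_cover:
  assumes h: "h \<in> carrier R" and y: "y \<in> carrier (Loc h)" and y': "y' \<in> carrier (Loc h)"
    and F: "\<And>i. i \<in> I \<Longrightarrow> F i \<in> carrier R" and cover: "D h \<subseteq> (\<Union>i\<in>I. D (F i))"
    and eq: "\<And>i. i \<in> I \<Longrightarrow> loc_restr R h (h \<otimes> F i) y = loc_restr R h (h \<otimes> F i) y'"
  shows "y = y'"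
proof -
  interpret L: csemiring "Loc h" by (rule csemiring_localization[OF h])
  define J where "J = {r \<in> carrier R. canon h r \<otimes>\<^bsub>Loc h\<^esub> y = canon h r \<otimes>\<^bsub>Loc h\<^esub> y'}"
  have "ideal_set J"
  proof (rule ideal_setI)
    show "\<zero> \<in> J" using y y' by (simp add: J_def localization_zero[symmetric])
    show "a \<oplus> b \<in> J" if "a \<in> J" "b \<in> J" for a b
      using that y y' h by (auto simp: J_def canon_add[symmetric] canon_closed L.l_distr)
    show "a \<otimes> b \<in> J" if "a \<in> J" "b \<in> carrier R" for a b
    proof -
      have "canon h (a \<otimes> b) \<otimes>\<^bsub>Loc h\<^esub> z = canon h b \<otimes>\<^bsub>Loc h\<^esub> (canon h a \<otimes>\<^bsub>Loc h\<^esub> z)"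
        if "z \<in> carrier (Loc h)" for z
        using that \<open>a \<in> J\<close> \<open>b \<in> carrier R\<close> h
        by (simp add: J_def canon_mult[symmetric] canon_closed L.m_assoc L.m_comm L.m_lcomm)
      then show ?thesis using that y y' by (simp add: J_def)
    qed
  qed (auto simp: J_def)
  moreover have "h \<in> P" if P: "prime_set P" "J \<subseteq> P" for P
  proof -
    have "F i \<in> P" if i: "i \<in> I" for i
    proof -
      obtain p :: nat where "canon h (F i [^] p) \<otimes>\<^bsub>Loc h\<^esub> y = canon h (F i [^] p) \<otimes>\<^bsub>Loc h\<^esub> y'"
        using loc_restr_eq_imp_power[OF h F[OF i] y y' eq[OF i]] by blast
      then have "F i [^] p \<in> J" using F[OF i] by (simp add: J_def)
      then show ?thesis using prime_set_pow[OF P(1) F[OF i]] P(2) by blast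
    qed
    then show ?thesis using cover P(1) by (auto simp: D_def)
  qed
  ultimately obtain n :: nat where "h [^] n \<in> J" using power_mem_ideal[OF _ h] by blast
  then show ?thesis
    using L.Units_l_cancel[OF canon_pow_Units[OF h] y y'] by (simp add: J_def)
qed

lemma D_zero: "D \<zero> = {}"
  using prime_setD(4) by (auto simp: D_def)

lemma D_add: "f \<in> carrier R \<Longrightarrow> g \<in> carrier R \<Longrightarrow> D (f \<oplus> g) \<subseteq> D f \<union> D g"
  using ideal_setD(3)[OF prime_setD(1)] by (auto simp: D_def)

lemma D_pow: "f \<in> carrier R \<Longrightarrow> D f \<subseteq> D (f [^] (n::nat))"
  using prime_set_pow by (auto simp: D_def)

text \<open>The \<open>r\<close> for which \<open>D(r)\<close> is covered by finitely many \<open>D(F i)\<close> form an ideal containing all \<open>F i\<close>, hence a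
  power of \<open>h\<close>.\<close>

lemma quasi_compact_D:
  assumes h: "h \<in> carrier R" and F: "\<And>i. i \<in> I \<Longrightarrow> F i \<in> carrier R"
    and cover: "D h \<subseteq> (\<Union>i\<in>I. D (F i))"
  obtains J where "finite J" "J \<subseteq> I" "D h \<subseteq> (\<Union>i\<in>J. D (F i))"
proof -
  define K where "K = {r \<in> carrier R. \<exists>J. finite J \<and> J \<subseteq> I \<and> D r \<subseteq> (\<Union>i\<in>J. D (F i))}"
  have "ideal_set K"
  proof (rule ideal_setI)
    show "\<zero> \<in> K" by (auto simp: K_def D_zero)
    show "a \<oplus> b \<in> K" if "a \<in> K" "b \<in> K" for a b
    proof -
      obtain J where J: "finite J" "J \<subseteq> I" "D a \<subseteq> (\<Union>i\<in>J. D (F i))" "a \<in> carrier R"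
        using \<open>a \<in> K\<close> by (auto simp: K_def)
      obtain J' where J': "finite J'" "J' \<subseteq> I" "D b \<subseteq> (\<Union>i\<in>J'. D (F i))" "b \<in> carrier R"
        using \<open>b \<in> K\<close> by (auto simp: K_def)
      have "D (a \<oplus> b) \<subseteq> (\<Union>i\<in>J \<union> J'. D (F i))"
        using D_add[OF J(4) J'(4)] J(3) J'(3) by blast
      then show ?thesis using J J' by (auto simp: K_def intro!: exI[of _ "J \<union> J'"])
    qed
    show "a \<otimes> b \<in> K" if "a \<in> K" "b \<in> carrier R" for a b
      using that by (auto simp: K_def D_mult)
  qed (auto simp: K_def)
  moreover have "h \<in> P" if P: "prime_set P" "K \<subseteq> P" for P
  proof -
    have "F i \<in> P" if "i \<in> I" for i
    proof -
      have "F i \<in> K" using that F by (auto simp: K_def intro!: exI[of _ "{i}"])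
      then show ?thesis using P by blast
    qed
    then show ?thesis using cover P(1) by (auto simp: D_def)
  qed
  ultimately obtain n :: nat where "h [^] n \<in> K" using power_mem_ideal[OF _ h] by blast
  then show ?thesis using that D_pow[OF h, of n] unfolding K_def by blast
qed

text \<open>Gluing on principal opens without subtraction and without partitions of unity. For a finite
  subcover \<open>J\<close>, consider the ideal \<open>K\<close> of common denominators: the \<open>r\<close> for which one \<open>c\<close> of \<open>R\<close> equals \<open>r x\<^sub>i\<close>
  in \<open>R\<^sub>F\<^sub>i\<close> for all \<open>i\<close> in \<open>J\<close>. If it contains a power of each \<open>F j\<close>, it contains some \<open>h\<^sup>m\<close>, and \<open>c/h\<^sup>m\<close> is the
  glued element. That \<open>F j\<close> has a power in \<open>K\<close> is what compatibility of the \<open>x\<^sub>i\<close> says: with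
  \<open>x\<^sub>j = a/(F j)\<^sup>n\<close>, the elements \<open>(F j)\<^sup>n x\<^sub>i\<close> and \<open>a\<close> agree on \<open>D(F i \<cdot> F j)\<close>.\<close>

lemma localization_glue:
  assumes h: "h \<in> carrier R" and F: "\<And>i. i \<in> I \<Longrightarrow> F i \<in> carrier R"
    and x: "\<And>i. i \<in> I \<Longrightarrow> x i \<in> carrier (Loc (F i))"
    and compat: "\<And>i j. i \<in> I \<Longrightarrow> j \<in> I \<Longrightarrow>
      loc_restr R (F i) (F i \<otimes> F j) (x i) = loc_restr R (F j) (F i \<otimes> F j) (x j)"
    and cover: "D h \<subseteq> (\<Union>i\<in>I. D (F i))"
  obtains y where "y \<in> carrier (Loc h)"
    "\<And>i. i \<in> I \<Longrightarrow> loc_restr R h (h \<otimes> F i) y = loc_restr R (F i) (h \<otimes> F i) (x i)"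
proof -
  obtain J where fin: "finite J" and JI: "J \<subseteq> I" and coverJ: "D h \<subseteq> (\<Union>i\<in>J. D (F i))"
    using quasi_compact_D[OF h F cover] by metis
  note FJ = F[OF subsetD[OF JI]] and xJ = x[OF subsetD[OF JI]]
  note L = csemiring_localization[OF FJ]
  define K where "K = {r \<in> carrier R. \<exists>c\<in>carrier R. \<forall>i\<in>J.
    canon (F i) c = canon (F i) r \<otimes>\<^bsub>Loc (F i)\<^esub> x i}"
  have "ideal_set K"
  proof (rule ideal_setI)
    have "canon (F i) \<zero> = canon (F i) \<zero> \<otimes>\<^bsub>Loc (F i)\<^esub> x i" if "i \<in> J" for i
      using semiring.l_null[OF csemiring.axioms(1)[OF L[OF that]] xJ[OF that]]
      by (simp add: localization_zero)
    then show "\<zero> \<in> K" by (auto simp: K_def intro!: bexI[of _ \<zero>])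
    show "a \<oplus> b \<in> K" if "a \<in> K" "b \<in> K" for a b
    proof -
      obtain c d where c: "c \<in> carrier R" "d \<in> carrier R" "a \<in> carrier R" "b \<in> carrier R"
        "\<And>i. i \<in> J \<Longrightarrow> canon (F i) c = canon (F i) a \<otimes>\<^bsub>Loc (F i)\<^esub> x i"
        "\<And>i. i \<in> J \<Longrightarrow> canon (F i) d = canon (F i) b \<otimes>\<^bsub>Loc (F i)\<^esub> x i"
        using \<open>a \<in> K\<close> \<open>b \<in> K\<close> by (auto simp: K_def)
      have "canon (F i) (c \<oplus> d) = canon (F i) (a \<oplus> b) \<otimes>\<^bsub>Loc (F i)\<^esub> x i" if "i \<in> J" for i
      proof -
        interpret L: csemiring "Loc (F i)" by (rule L[OF that])
        show ?thesis using c xJ[OF that] FJ[OF that] that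
          by (simp add: canon_add[symmetric] canon_closed L.l_distr)
      qed
      then show ?thesis using c(1-4) by (auto simp: K_def)
    qed
    show "a \<otimes> b \<in> K" if "a \<in> K" "b \<in> carrier R" for a b
    proof -
      obtain c where c: "c \<in> carrier R" "a \<in> carrier R"
        "\<And>i. i \<in> J \<Longrightarrow> canon (F i) c = canon (F i) a \<otimes>\<^bsub>Loc (F i)\<^esub> x i"
        using \<open>a \<in> K\<close> by (auto simp: K_def)
      have "canon (F i) (c \<otimes> b) = canon (F i) (a \<otimes> b) \<otimes>\<^bsub>Loc (F i)\<^esub> x i" if "i \<in> J" for i
      proof -
        interpret L: csemiring "Loc (F i)" by (rule L[OF that])
        show ?thesis using c xJ[OF that] FJ[OF that] that \<open>b \<in> carrier R\<close>
          by (simp add: canon_mult[symmetric] canon_closed L.m_assoc L.m_comm L.m_lcomm)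
      qed
      then show ?thesis using c(1,2) that(2) by (auto simp: K_def)
    qed
  qed (auto simp: K_def)
  moreover have "h \<in> P" if P: "prime_set P" "K \<subseteq> P" for P
  proof -
    have "F j \<in> P" if j: "j \<in> J" for j
    proof -
      note Fj = FJ[OF j] and xj = xJ[OF j]
      obtain a and n :: nat where a: "a \<in> carrier R"
          "x j \<otimes>\<^bsub>Loc (F j)\<^esub> canon (F j) (F j [^] n) = canon (F j) a"
        using clear_denominator[OF Fj xj] by metis
      \<comment> \<open>\<open>Q i p\<close>: in \<open>R\<^sub>F\<^sub>i\<close>, the factor \<open>(F j)\<^sup>p\<close> makes \<open>(F j)\<^sup>n x\<^sub>i\<close> and \<open>a\<close> equal. Such \<open>p\<close> can be enlarged,
        so one exponent serves the finite set \<open>J\<close>.\<close>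
      define Q where "Q i p \<longleftrightarrow> canon (F i) (F j [^] (p::nat)) \<otimes>\<^bsub>Loc (F i)\<^esub>
        (canon (F i) (F j [^] n) \<otimes>\<^bsub>Loc (F i)\<^esub> x i) =
        canon (F i) (F j [^] p) \<otimes>\<^bsub>Loc (F i)\<^esub> canon (F i) a" for i p
      have Q: "\<exists>p. Q i p" if i: "i \<in> J" for i
      proof -
        note Fi = FJ[OF i] and xi = xJ[OF i]
        interpret L: csemiring "Loc (F i)" by (rule L[OF i])
        have ij: "F i \<otimes> F j \<in> carrier R" "D (F i \<otimes> F j) \<subseteq> D (F i)" "D (F i \<otimes> F j) \<subseteq> D (F j)"
          using Fi Fj by (simp_all add: D_mult)
        interpret \<rho>: csemiring_hom "Loc (F i)" "Loc (F i \<otimes> F j)" "loc_restr R (F i) (F i \<otimes> F j)"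
          by (rule loc_restr_hom[OF Fi ij(1,2)])
        have "loc_restr R (F i) (F i \<otimes> F j) (canon (F i) (F j [^] n) \<otimes>\<^bsub>Loc (F i)\<^esub> x i) =
          loc_restr R (F j) (F i \<otimes> F j) (x j) \<otimes>\<^bsub>Loc (F i \<otimes> F j)\<^esub> canon (F i \<otimes> F j) (F j [^] n)"
          using xi Fj compat[of i j] i j JI \<rho>.hom_closed[OF xi]
          by (simp add: \<rho>.hom_mult canon_closed loc_restr_canon[OF Fi ij(1,2)] \<rho>.S.m_comm subset_iff)
        also have "\<dots> = loc_restr R (F i) (F i \<otimes> F j) (canon (F i) a)"
          using loc_restr_value[OF Fj ij(1,3) xj a] loc_restr_canon[OF Fi ij(1,2) a(1)] by simp
        finally show ?thesis
          using loc_restr_eq_imp_power[OF Fi Fj _ canon_closed[OF a(1)]] xi Fj canon_closed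
          unfolding Q_def by (metis L.m_closed nat_pow_closed)
      qed
      have Q_mono: "Q i (p + q)" if i: "i \<in> J" and "Q i p" for i p q
      proof -
        interpret L: csemiring "Loc (F i)" by (rule L[OF i])
        have *: "canon (F i) (F j [^] (p + q)) \<otimes>\<^bsub>Loc (F i)\<^esub> z =
            canon (F i) (F j [^] q) \<otimes>\<^bsub>Loc (F i)\<^esub> (canon (F i) (F j [^] p) \<otimes>\<^bsub>Loc (F i)\<^esub> z)"
          if "z \<in> carrier (Loc (F i))" for z
          using that Fj FJ[OF i]
          by (simp add: L.m_assoc[symmetric] canon_closed canon_mult nat_pow_mult add.commute)
        show ?thesis using that xJ[OF i] a(1) Fj unfolding Q_def
          by (simp add: * canon_closed)
      qed
      obtain p where p: "\<And>i. i \<in> J \<Longrightarrow> Q i (p i)" using Q by metis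
      define N where "N = Max (insert 0 (p ` J))"
      have QN: "Q i N" if "i \<in> J" for i
        using Q_mono[OF that p[OF that], of "N - p i"] that fin by (simp add: N_def)
      have "canon (F i) (F j [^] N \<otimes> a) = canon (F i) (F j [^] N \<otimes> F j [^] n) \<otimes>\<^bsub>Loc (F i)\<^esub> x i"
        if "i \<in> J" for i
      proof -
        interpret L: csemiring "Loc (F i)" by (rule L[OF that])
        show ?thesis using QN[OF that] a(1) Fj FJ[OF that] xJ[OF that] unfolding Q_def
          by (simp add: canon_mult[symmetric] canon_closed L.m_assoc)
      qed
      then have "F j [^] (N + n) \<in> K"
        using a(1) Fj by (auto simp: K_def nat_pow_mult[symmetric] intro!: bexI[of _ "F j [^] N \<otimes> a"])
      then show ?thesis using prime_set_pow[OF P(1) Fj] P(2) by blast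
    qed
    then show ?thesis using coverJ P(1) by (auto simp: D_def)
  qed
  ultimately obtain m :: nat where "h [^] m \<in> K" using power_mem_ideal[OF _ h] by blast
  then obtain c where c: "c \<in> carrier R"
      "\<And>i. i \<in> J \<Longrightarrow> canon (F i) c = canon (F i) (h [^] m) \<otimes>\<^bsub>Loc (F i)\<^esub> x i"
    by (auto simp: K_def)
  define y where "y = fraction R h c (h [^] m)"
  have y: "y \<in> carrier (Loc h)" unfolding y_def using c(1) by (simp add: fraction_closed)
  have ym: "y \<otimes>\<^bsub>Loc h\<^esub> canon h (h [^] m) = canon h c"
    unfolding y_def using h c(1) by (simp add: fraction_mult fraction_eqI)
  have hF: "h \<otimes> F i \<in> carrier R" "D (h \<otimes> F i) \<subseteq> D h" "D (h \<otimes> F i) \<subseteq> D (F i)" if "i \<in> I" for i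
    using F[OF that] h by (simp_all add: D_mult)
  have onJ: "loc_restr R h (h \<otimes> F j) y = loc_restr R (F j) (h \<otimes> F j) (x j)" if j: "j \<in> J" for j
  proof -
    note Fj = FJ[OF j] and xj = xJ[OF j] and hj = hF[OF subsetD[OF JI j]]
    interpret \<rho>: csemiring_hom "Loc (F j)" "Loc (h \<otimes> F j)" "loc_restr R (F j) (h \<otimes> F j)"
      by (rule loc_restr_hom[OF Fj hj(1,3)])
    have "loc_restr R (F j) (h \<otimes> F j) (x j) \<otimes>\<^bsub>Loc (h \<otimes> F j)\<^esub> canon (h \<otimes> F j) (h [^] m) =
        loc_restr R (F j) (h \<otimes> F j) (canon (F j) (h [^] m) \<otimes>\<^bsub>Loc (F j)\<^esub> x j)"
      using xj h \<rho>.hom_closed[OF xj]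
      by (simp add: \<rho>.hom_mult canon_closed loc_restr_canon[OF Fj hj(1,3)] \<rho>.S.m_comm)
    also have "\<dots> = canon (h \<otimes> F j) c"
      using c loc_restr_canon[OF Fj hj(1,3)] j by (simp flip: c(2))
    finally show ?thesis
      by (intro loc_restr_eqI[OF h hj(1,2) y c(1) ym]) (simp_all add: \<rho>.hom_closed xj)
  qed
  \<comment> \<open>For the indices outside \<open>J\<close>, compare on the opens \<open>D(h \<cdot> F i \<cdot> F j)\<close> with \<open>j\<close> in \<open>J\<close>, which cover
    \<open>D(h \<cdot> F i)\<close>.\<close>
  have "loc_restr R h (h \<otimes> F i) y = loc_restr R (F i) (h \<otimes> F i) (x i)" if i: "i \<in> I" for i
  proof (rule localization_eqI_cover[where I = J and F = F])
    note Fi = F[OF i] and xi = x[OF i] and hi = hF[OF i]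
    show "h \<otimes> F i \<in> carrier R" by (rule hi)
    show "loc_restr R h (h \<otimes> F i) y \<in> carrier (Loc (h \<otimes> F i))"
      by (rule loc_restr_closed[OF h hi(1,2) y])
    show "loc_restr R (F i) (h \<otimes> F i) (x i) \<in> carrier (Loc (h \<otimes> F i))"
      by (rule loc_restr_closed[OF Fi hi(1,3) xi])
    show "D (h \<otimes> F i) \<subseteq> (\<Union>j\<in>J. D (F j))" using hi(2) coverJ by blast
    fix j assume j: "j \<in> J"
    note Fj = FJ[OF j] and xj = xJ[OF j] and hj = hF[OF subsetD[OF JI j]]
    show "F j \<in> carrier R" by (rule Fj)
    let ?k = "h \<otimes> F i \<otimes> F j"
    have k: "?k \<in> carrier R" "D ?k \<subseteq> D (h \<otimes> F i)" "D ?k \<subseteq> D (h \<otimes> F j)"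
        "D ?k \<subseteq> D (F i \<otimes> F j)"
      using h Fi Fj by (auto simp: D_mult)
    have ij: "F i \<otimes> F j \<in> carrier R" "D (F i \<otimes> F j) \<subseteq> D (F i)" "D (F i \<otimes> F j) \<subseteq> D (F j)"
      using Fi Fj by (simp_all add: D_mult)
    have "loc_restr R (h \<otimes> F i) ?k (loc_restr R h (h \<otimes> F i) y) =
        loc_restr R (h \<otimes> F j) ?k (loc_restr R h (h \<otimes> F j) y)"
      using loc_restr_trans[OF h hi(1) k(1) hi(2) k(2) y] loc_restr_trans[OF h hj(1) k(1) hj(2) k(3) y]
      by simp
    also have "\<dots> = loc_restr R (F j) ?k (x j)"
      unfolding onJ[OF j] by (rule loc_restr_trans[OF Fj hj(1) k(1) hj(3) k(3) xj])
    also have "\<dots> = loc_restr R (F i \<otimes> F j) ?k (loc_restr R (F i) (F i \<otimes> F j) (x i))"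
      unfolding compat[OF i subsetD[OF JI j]]
      by (rule loc_restr_trans[OF Fj ij(1) k(1) ij(3) k(4) xj, symmetric])
    also have "\<dots> = loc_restr R (h \<otimes> F i) ?k (loc_restr R (F i) (h \<otimes> F i) (x i))"
      using loc_restr_trans[OF Fi ij(1) k(1) ij(2) k(4) xi] loc_restr_trans[OF Fi hi(1) k(1) hi(3) k(2) xi]
      by simp
    finally show "loc_restr R (h \<otimes> F i) ?k (loc_restr R h (h \<otimes> F i) y) =
      loc_restr R (h \<otimes> F i) ?k (loc_restr R (F i) (h \<otimes> F i) (x i))" .
  qed
  then show ?thesis using that y by blast
qed

end

section \<open>The affine scheme of a ternary semiring\<close>

locale affine = csemiring R
  for G :: "('g, 'k) monoid_scheme" and R :: "('a, 'm) ring_scheme" (structure) and u :: "'g \<Rightarrow> 'a" +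
  assumes comm_group_G: "comm_group G" and gamma_R: "gamma_semiring G R u"
begin

abbreviation Sec :: "'a set set \<Rightarrow> ('a \<Rightarrow> ('a \<times> 'a) set) ring" where
  "Sec U \<equiv> structure_sections G R u U"

abbreviation Sp :: "'a set set" where "Sp \<equiv> spec_set G R u"

text \<open>The index set of a section over \<open>U\<close>; it equals \<open>opens_within\<close> (\<open>opens_within_eq\<close> below). As for \<open>D\<close>, stating it
  through ordinary primes makes the results on localizations applicable.\<close>

definition Prin :: "'a set set \<Rightarrow> 'a set" where
  "Prin U = {f \<in> carrier R. D f \<subseteq> U}"

lemma u_Units: "\<gamma> \<in> carrier G \<Longrightarrow> u \<gamma> \<in> Units R"
  using gamma_R by (auto simp: gamma_semiring_def hom_def units_of_def)

lemma u_closed: "\<gamma> \<in> carrier G \<Longrightarrow> u \<gamma> \<in> carrier R"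
  using u_Units by blast

lemma one_G: "\<one>\<^bsub>G\<^esub> \<in> carrier G"
  using comm_group_G comm_group.axioms(2) group.is_monoid monoid.one_closed by blast

text \<open>For absorption take \<open>c = u\<^sub>1\<inverse>\<close> in the ternary product \<open>a b c u\<^sub>1\<close>, where the index 1 is the neutral element
  of \<open>\<Gamma>\<close>.\<close>

lemma gamma_ideal_iff: "gamma_ideal G R u I \<longleftrightarrow> ideal_set I"
proof
  assume I: "gamma_ideal G R u I"
  show "ideal_set I"
  proof (rule ideal_setI)
    fix a b assume a: "a \<in> I" and b: "b \<in> carrier R"
    have ac: "a \<in> carrier R" using I a by (auto simp: gamma_ideal_def)
    have "tern R u \<one>\<^bsub>G\<^esub> a b (inv (u \<one>\<^bsub>G\<^esub>)) \<in> I"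
      using I a b u_Units[OF one_G] by (auto simp: gamma_ideal_def one_G)
    then show "a \<otimes> b \<in> I"
      using ac b u_Units[OF one_G] by (simp add: tern_def m_assoc u_closed one_G)
  qed (use I in \<open>auto simp: gamma_ideal_def\<close>)
next
  assume I: "ideal_set I"
  show "gamma_ideal G R u I"
    using ideal_setD[OF I] u_closed by (auto simp: gamma_ideal_def tern_def)
qed

text \<open>The third factor of a ternary product can be taken to be 1, which a proper ideal does not
  contain; nor does a prime ideal contain the unit \<open>u\<^sub>\<gamma>\<close>.\<close>

lemma prime_gamma_ideal_iff: "prime_gamma_ideal G R u P \<longleftrightarrow> prime_set P"
proof -
  have proper: "\<one> \<notin> P \<longleftrightarrow> P \<noteq> carrier R" if P: "ideal_set P"
  proof
    show "P \<noteq> carrier R" if "\<one> \<notin> P" using that by auto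
    show "\<one> \<notin> P" if "P \<noteq> carrier R"
    proof
      assume "\<one> \<in> P"
      then have "b \<in> P" if "b \<in> carrier R" for b using ideal_setD(4)[OF P, of \<one> b] that by simp
      then show False using ideal_setD(1)[OF P] \<open>P \<noteq> carrier R\<close> by blast
    qed
  qed
  show ?thesis
  proof
    assume P: "prime_gamma_ideal G R u P"
    then have id: "ideal_set P" and 1: "\<one> \<notin> P"
      using proper by (auto simp: prime_gamma_ideal_def gamma_ideal_iff)
    have "a \<in> P \<or> b \<in> P" if ab: "a \<in> carrier R" "b \<in> carrier R" "a \<otimes> b \<in> P" for a b
    proof -
      have "tern R u \<one>\<^bsub>G\<^esub> a b \<one> \<in> P"
        using ab ideal_setD(4)[OF id ab(3) u_closed[OF one_G]] by (simp add: tern_def)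
      then show ?thesis using P 1 ab one_G unfolding prime_gamma_ideal_def by blast
    qed
    then show "prime_set P" using id 1 by (auto simp: prime_set_def)
  next
    assume P: "prime_set P"
    have "u \<gamma> \<notin> P" if "\<gamma> \<in> carrier G" for \<gamma>
    proof
      assume "u \<gamma> \<in> P"
      then have "u \<gamma> \<otimes> inv (u \<gamma>) \<in> P"
        using ideal_setD(4)[OF prime_setD(1)[OF P]] u_Units[OF that] by blast
      then show False using u_Units[OF that] prime_setD(2)[OF P] by simp
    qed
    then have "a \<in> P \<or> b \<in> P \<or> c \<in> P"
      if "a \<in> carrier R" "b \<in> carrier R" "c \<in> carrier R" "\<gamma> \<in> carrier G" "tern R u \<gamma> a b c \<in> P" for a b c \<gamma>
      using that prime_setD(5)[OF P] u_closed[OF that(4)] by (auto simp: tern_def)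
    then show "prime_gamma_ideal G R u P"
      using proper[OF prime_setD(1)[OF P]] prime_setD(1,2)[OF P]
      by (simp add: prime_gamma_ideal_def gamma_ideal_iff)
  qed
qed

lemma Sp_eq: "Sp = {P. prime_set P}"
  by (simp add: spec_set_def prime_gamma_ideal_iff)

lemma basic_open_eq: "basic_open G R u f = D f"
  by (auto simp: basic_open_def D_def Sp_eq)

lemma opens_within_eq: "opens_within G R u U = Prin U"
  by (simp add: opens_within_def Prin_def basic_open_eq)

lemma D_subset_Sp: "D f \<subseteq> Sp"
  by (auto simp: D_def Sp_eq)

lemma D_one: "D \<one> = Sp"
  using prime_setD(2) by (auto simp: D_def Sp_eq)

lemma Prin_iff: "f \<in> Prin U \<longleftrightarrow> f \<in> carrier R \<and> D f \<subseteq> U"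
  by (simp add: Prin_def)

lemma Prin_mono: "V \<subseteq> U \<Longrightarrow> Prin V \<subseteq> Prin U"
  by (auto simp: Prin_def)

lemma Prin_Sp: "Prin Sp = carrier R"
  using D_subset_Sp by (auto simp: Prin_def)

text \<open>A set \<open>U\<close> that is a union of principal opens is the complement of \<open>V(I)\<close> for \<open>I\<close> the ideal of all
  \<open>f\<close> with \<open>D(f) \<subseteq> U\<close>. In the form on the right, closure under
  unions and finite intersections is immediate.\<close>

lemma open_set_iff:
  "(\<exists>I. gamma_ideal G R u I \<and> U = Sp - vanishing G R u I) \<longleftrightarrow>
    U \<subseteq> Sp \<and> (\<forall>P\<in>U. \<exists>f\<in>Prin U. P \<in> D f)" (is "?L \<longleftrightarrow> ?R")
proof
  assume ?L
  then obtain I where I: "ideal_set I" and U: "U = Sp - vanishing G R u I"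
    by (auto simp: gamma_ideal_iff)
  have "\<exists>f\<in>Prin U. P \<in> D f" if "P \<in> U" for P
  proof -
    obtain f where "f \<in> I" "f \<notin> P" using \<open>P \<in> U\<close> by (auto simp: U vanishing_def)
    then show ?thesis using ideal_setD(1)[OF I] that
      by (intro bexI[of _ f]) (auto simp: U vanishing_def Prin_def D_def Sp_eq)
  qed
  then show ?R using U by blast
next
  assume R: ?R
  have "ideal_set (Prin U)"
  proof (rule ideal_setI)
    show "a \<oplus> b \<in> Prin U" if "a \<in> Prin U" "b \<in> Prin U" for a b
      using that D_add[of a b] by (auto simp: Prin_iff)
    show "a \<otimes> b \<in> Prin U" if "a \<in> Prin U" "b \<in> carrier R" for a b
      using that by (auto simp: Prin_iff D_mult)
  qed (auto simp: Prin_iff D_zero)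
  moreover have "U = Sp - vanishing G R u (Prin U)"
  proof -
    have "P \<in> U \<longleftrightarrow> \<not> Prin U \<subseteq> P" if "P \<in> Sp" for P
      using R that unfolding Prin_def D_def Sp_eq by blast
    then show ?thesis using R by (auto simp: vanishing_def)
  qed
  ultimately show ?L by (auto simp: gamma_ideal_iff)
qed

lemma openin_zariski_iff:
  "openin (zariski G R u) U \<longleftrightarrow> U \<subseteq> Sp \<and> (\<forall>P\<in>U. \<exists>f\<in>Prin U. P \<in> D f)"
proof -
  have "istopology (\<lambda>U. U \<subseteq> Sp \<and> (\<forall>P\<in>U. \<exists>f\<in>Prin U. P \<in> D f))"
    unfolding istopology_def
  proof (intro conjI allI impI ballI)
    fix U V P
    assume U: "U \<subseteq> Sp \<and> (\<forall>P\<in>U. \<exists>f\<in>Prin U. P \<in> D f)" and V: "V \<subseteq> Sp \<and> (\<forall>P\<in>V. \<exists>f\<in>Prin V. P \<in> D f)"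
    show "U \<inter> V \<subseteq> Sp" using U by blast
    assume "P \<in> U \<inter> V"
    then obtain f g where "f \<in> Prin U" "P \<in> D f" "g \<in> Prin V" "P \<in> D g" using U V by blast
    then show "\<exists>f\<in>Prin (U \<inter> V). P \<in> D f"
      by (intro bexI[of _ "f \<otimes> g"]) (auto simp: Prin_iff D_mult)
  next
    fix \<K> P
    assume K: "\<forall>U\<in>\<K>. U \<subseteq> Sp \<and> (\<forall>P\<in>U. \<exists>f\<in>Prin U. P \<in> D f)"
    then show "\<Union>\<K> \<subseteq> Sp" by blast
    assume "P \<in> \<Union>\<K>"
    then obtain U f where "U \<in> \<K>" "f \<in> Prin U" "P \<in> D f" using K by blast
    then show "\<exists>f\<in>Prin (\<Union>\<K>). P \<in> D f" using Prin_mono[of U "\<Union>\<K>"] by blast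
  qed
  then show ?thesis unfolding zariski_def open_set_iff by (simp add: topology_inverse')
qed

lemma openin_D: "f \<in> carrier R \<Longrightarrow> openin (zariski G R u) (D f)"
  using D_subset_Sp by (auto simp: openin_zariski_iff Prin_iff)

lemma topspace_zariski: "topspace (zariski G R u) = Sp"
  using openin_D[of \<one>] openin_zariski_iff[of "topspace (zariski G R u)"] openin_subset[of _ Sp]
  by (auto simp: D_one)

lemma openin_Sp: "openin (zariski G R u) Sp"
  using openin_topspace[of "zariski G R u"] by (simp add: topspace_zariski)

lemma open_eq_Union: "openin (zariski G R u) U \<Longrightarrow> U = (\<Union>f\<in>Prin U. D f)"
  by (auto simp: openin_zariski_iff Prin_iff)


subsection \<open>Sections\<close>

lemma section_iff:
  "s \<in> carrier (Sec U) \<longleftrightarrow> s \<in> extensional (Prin U) \<and> (\<forall>f\<in>Prin U. s f \<in> carrier (Loc f)) \<and>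
     (\<forall>f\<in>Prin U. \<forall>g\<in>carrier R. D g \<subseteq> D f \<longrightarrow> loc_restr R f g (s f) = s g)"
  by (auto simp: structure_sections_def opens_within_eq basic_open_eq PiE_def Pi_def)

lemma sectionD:
  assumes "s \<in> carrier (Sec U)"
  shows "s \<in> extensional (Prin U)" "\<And>f. f \<in> Prin U \<Longrightarrow> s f \<in> carrier (Loc f)"
    "\<And>f g. f \<in> Prin U \<Longrightarrow> g \<in> carrier R \<Longrightarrow> D g \<subseteq> D f \<Longrightarrow> loc_restr R f g (s f) = s g"
  using assms by (auto simp: section_iff)

lemma section_ops:
  assumes "f \<in> Prin U"
  shows "(s \<otimes>\<^bsub>Sec U\<^esub> t) f = s f \<otimes>\<^bsub>Loc f\<^esub> t f" "(s \<oplus>\<^bsub>Sec U\<^esub> t) f = s f \<oplus>\<^bsub>Loc f\<^esub> t f"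
    "\<one>\<^bsub>Sec U\<^esub> f = \<one>\<^bsub>Loc f\<^esub>" "\<zero>\<^bsub>Sec U\<^esub> f = \<zero>\<^bsub>Loc f\<^esub>"
  using assms by (auto simp: structure_sections_def opens_within_eq)

lemma section_ops_extensional:
  "s \<otimes>\<^bsub>Sec U\<^esub> t \<in> extensional (Prin U)" "s \<oplus>\<^bsub>Sec U\<^esub> t \<in> extensional (Prin U)"
  "\<one>\<^bsub>Sec U\<^esub> \<in> extensional (Prin U)" "\<zero>\<^bsub>Sec U\<^esub> \<in> extensional (Prin U)"
  by (auto simp: structure_sections_def opens_within_eq)

lemma section_eqI:
  assumes "s \<in> extensional (Prin U)" "t \<in> extensional (Prin U)" "\<And>f. f \<in> Prin U \<Longrightarrow> s f = t f"
  shows "s = t"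
  using assms by (rule extensionalityI)

lemma Loc_csemiring: "f \<in> Prin U \<Longrightarrow> csemiring (Loc f)"
  by (simp add: csemiring_localization Prin_iff)

lemma section_ops_closed:
  assumes "s \<in> carrier (Sec U)" "t \<in> carrier (Sec U)"
  shows "s \<otimes>\<^bsub>Sec U\<^esub> t \<in> carrier (Sec U)" "s \<oplus>\<^bsub>Sec U\<^esub> t \<in> carrier (Sec U)"
proof -
  have *: "(\<forall>f\<in>Prin U. p f \<in> carrier (Loc f)) \<and>
      (\<forall>f\<in>Prin U. \<forall>g\<in>carrier R. D g \<subseteq> D f \<longrightarrow> loc_restr R f g (p f) = p g)"
    if p: "p = s \<otimes>\<^bsub>Sec U\<^esub> t \<or> p = s \<oplus>\<^bsub>Sec U\<^esub> t" for p
  proof (intro conjI ballI impI)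
    fix f assume f: "f \<in> Prin U"
    interpret L: csemiring "Loc f" by (rule Loc_csemiring[OF f])
    note st = sectionD(2)[OF assms(1) f] sectionD(2)[OF assms(2) f]
    show "p f \<in> carrier (Loc f)" using p st by (auto simp: section_ops[OF f])
    fix g assume g: "g \<in> carrier R" "D g \<subseteq> D f"
    then have gP: "g \<in> Prin U" using f by (auto simp: Prin_iff)
    interpret \<rho>: csemiring_hom "Loc f" "Loc g" "loc_restr R f g"
      using f g by (intro loc_restr_hom) (auto simp: Prin_iff)
    show "loc_restr R f g (p f) = p g"
      using p st sectionD(3)[OF assms(1) f g] sectionD(3)[OF assms(2) f g]
      by (auto simp: section_ops[OF f] section_ops[OF gP] \<rho>.hom_mult \<rho>.hom_add)
  qed
  show "s \<otimes>\<^bsub>Sec U\<^esub> t \<in> carrier (Sec U)" "s \<oplus>\<^bsub>Sec U\<^esub> t \<in> carrier (Sec U)"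
    unfolding section_iff using * section_ops_extensional by auto
qed

lemma zero_one_section: "\<one>\<^bsub>Sec U\<^esub> \<in> carrier (Sec U)" "\<zero>\<^bsub>Sec U\<^esub> \<in> carrier (Sec U)"
proof -
  have *: "(\<forall>f\<in>Prin U. p f \<in> carrier (Loc f)) \<and>
      (\<forall>f\<in>Prin U. \<forall>g\<in>carrier R. D g \<subseteq> D f \<longrightarrow> loc_restr R f g (p f) = p g)"
    if p: "p = \<one>\<^bsub>Sec U\<^esub> \<or> p = \<zero>\<^bsub>Sec U\<^esub>" for p
  proof (intro conjI ballI impI)
    fix f assume f: "f \<in> Prin U"
    interpret L: csemiring "Loc f" by (rule Loc_csemiring[OF f])
    show "p f \<in> carrier (Loc f)" using p by (auto simp: section_ops[OF f])
    fix g assume g: "g \<in> carrier R" "D g \<subseteq> D f"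
    then have gP: "g \<in> Prin U" using f by (auto simp: Prin_iff)
    interpret \<rho>: csemiring_hom "Loc f" "Loc g" "loc_restr R f g"
      using f g by (intro loc_restr_hom) (auto simp: Prin_iff)
    show "loc_restr R f g (p f) = p g"
      using p by (auto simp: section_ops[OF f] section_ops[OF gP] \<rho>.hom_one \<rho>.hom_zero)
  qed
  show "\<one>\<^bsub>Sec U\<^esub> \<in> carrier (Sec U)" "\<zero>\<^bsub>Sec U\<^esub> \<in> carrier (Sec U)"
    unfolding section_iff using * section_ops_extensional by auto
qed

lemma csemiring_Sec: "csemiring (Sec U)"
proof (rule csemiringI)
  fix x y z assume xyz: "x \<in> carrier (Sec U)" "y \<in> carrier (Sec U)" "z \<in> carrier (Sec U)"
  note c = xyz[THEN sectionD(2)]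
  have *: "(x \<oplus>\<^bsub>Sec U\<^esub> y \<oplus>\<^bsub>Sec U\<^esub> z) f = (x \<oplus>\<^bsub>Sec U\<^esub> (y \<oplus>\<^bsub>Sec U\<^esub> z)) f"
    "(x \<otimes>\<^bsub>Sec U\<^esub> y \<otimes>\<^bsub>Sec U\<^esub> z) f = (x \<otimes>\<^bsub>Sec U\<^esub> (y \<otimes>\<^bsub>Sec U\<^esub> z)) f"
    "((x \<oplus>\<^bsub>Sec U\<^esub> y) \<otimes>\<^bsub>Sec U\<^esub> z) f = (x \<otimes>\<^bsub>Sec U\<^esub> z \<oplus>\<^bsub>Sec U\<^esub> y \<otimes>\<^bsub>Sec U\<^esub> z) f"
    if f: "f \<in> Prin U" for f
  proof -
    interpret L: csemiring "Loc f" by (rule Loc_csemiring[OF f])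
    show "(x \<oplus>\<^bsub>Sec U\<^esub> y \<oplus>\<^bsub>Sec U\<^esub> z) f = (x \<oplus>\<^bsub>Sec U\<^esub> (y \<oplus>\<^bsub>Sec U\<^esub> z)) f"
      "(x \<otimes>\<^bsub>Sec U\<^esub> y \<otimes>\<^bsub>Sec U\<^esub> z) f = (x \<otimes>\<^bsub>Sec U\<^esub> (y \<otimes>\<^bsub>Sec U\<^esub> z)) f"
      "((x \<oplus>\<^bsub>Sec U\<^esub> y) \<otimes>\<^bsub>Sec U\<^esub> z) f = (x \<otimes>\<^bsub>Sec U\<^esub> z \<oplus>\<^bsub>Sec U\<^esub> y \<otimes>\<^bsub>Sec U\<^esub> z) f"
      using c[OF f] by (simp_all add: section_ops[OF f] L.m_assoc L.a_assoc L.l_distr)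
  qed
  show "x \<oplus>\<^bsub>Sec U\<^esub> y \<oplus>\<^bsub>Sec U\<^esub> z = x \<oplus>\<^bsub>Sec U\<^esub> (y \<oplus>\<^bsub>Sec U\<^esub> z)"
    "x \<otimes>\<^bsub>Sec U\<^esub> y \<otimes>\<^bsub>Sec U\<^esub> z = x \<otimes>\<^bsub>Sec U\<^esub> (y \<otimes>\<^bsub>Sec U\<^esub> z)"
    "(x \<oplus>\<^bsub>Sec U\<^esub> y) \<otimes>\<^bsub>Sec U\<^esub> z = x \<otimes>\<^bsub>Sec U\<^esub> z \<oplus>\<^bsub>Sec U\<^esub> y \<otimes>\<^bsub>Sec U\<^esub> z"
    by (rule section_eqI[OF section_ops_extensional(2) section_ops_extensional(2)], erule *)
      (rule section_eqI[OF section_ops_extensional(1) section_ops_extensional(1)], erule *,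
       rule section_eqI[OF section_ops_extensional(1) section_ops_extensional(2)], erule *)
next
  fix x y assume xy: "x \<in> carrier (Sec U)" "y \<in> carrier (Sec U)"
  note c = xy[THEN sectionD(2)]
  have *: "(x \<oplus>\<^bsub>Sec U\<^esub> y) f = (y \<oplus>\<^bsub>Sec U\<^esub> x) f" "(x \<otimes>\<^bsub>Sec U\<^esub> y) f = (y \<otimes>\<^bsub>Sec U\<^esub> x) f"
    if f: "f \<in> Prin U" for f
  proof -
    interpret L: csemiring "Loc f" by (rule Loc_csemiring[OF f])
    show "(x \<oplus>\<^bsub>Sec U\<^esub> y) f = (y \<oplus>\<^bsub>Sec U\<^esub> x) f" "(x \<otimes>\<^bsub>Sec U\<^esub> y) f = (y \<otimes>\<^bsub>Sec U\<^esub> x) f"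
      using c[OF f] by (simp_all add: section_ops[OF f] L.m_comm L.a_comm)
  qed
  show "x \<oplus>\<^bsub>Sec U\<^esub> y = y \<oplus>\<^bsub>Sec U\<^esub> x" "x \<otimes>\<^bsub>Sec U\<^esub> y = y \<otimes>\<^bsub>Sec U\<^esub> x"
    by (rule section_eqI; fact * section_ops_extensional)+
  show "x \<oplus>\<^bsub>Sec U\<^esub> y \<in> carrier (Sec U)" "x \<otimes>\<^bsub>Sec U\<^esub> y \<in> carrier (Sec U)"
    by (rule section_ops_closed[OF xy])+
next
  fix x assume x: "x \<in> carrier (Sec U)"
  note c = sectionD(2)[OF x] and e = sectionD(1)[OF x]
  have *: "(\<zero>\<^bsub>Sec U\<^esub> \<oplus>\<^bsub>Sec U\<^esub> x) f = x f" "(\<one>\<^bsub>Sec U\<^esub> \<otimes>\<^bsub>Sec U\<^esub> x) f = x f"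
    "(\<zero>\<^bsub>Sec U\<^esub> \<otimes>\<^bsub>Sec U\<^esub> x) f = \<zero>\<^bsub>Sec U\<^esub> f"
    if f: "f \<in> Prin U" for f
  proof -
    interpret L: csemiring "Loc f" by (rule Loc_csemiring[OF f])
    show "(\<zero>\<^bsub>Sec U\<^esub> \<oplus>\<^bsub>Sec U\<^esub> x) f = x f" "(\<one>\<^bsub>Sec U\<^esub> \<otimes>\<^bsub>Sec U\<^esub> x) f = x f"
      "(\<zero>\<^bsub>Sec U\<^esub> \<otimes>\<^bsub>Sec U\<^esub> x) f = \<zero>\<^bsub>Sec U\<^esub> f"
      using c[OF f] by (simp_all add: section_ops[OF f])
  qed
  show "\<zero>\<^bsub>Sec U\<^esub> \<oplus>\<^bsub>Sec U\<^esub> x = x" "\<one>\<^bsub>Sec U\<^esub> \<otimes>\<^bsub>Sec U\<^esub> x = x" "\<zero>\<^bsub>Sec U\<^esub> \<otimes>\<^bsub>Sec U\<^esub> x = \<zero>\<^bsub>Sec U\<^esub>"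
    by (rule section_eqI; fact * e section_ops_extensional)+
qed (rule zero_one_section)+

lemma section_eqI_cover:
  assumes s: "s \<in> carrier (Sec U)" and t: "t \<in> carrier (Sec U)"
    and F: "\<And>i. i \<in> I \<Longrightarrow> F i \<in> Prin U" and cover: "U \<subseteq> (\<Union>i\<in>I. D (F i))"
    and eq: "\<And>i. i \<in> I \<Longrightarrow> s (F i) = t (F i)"
  shows "s = t"
proof (rule section_eqI[OF sectionD(1)[OF s] sectionD(1)[OF t]])
  fix f assume f: "f \<in> Prin U"
  then have fc: "f \<in> carrier R" by (simp add: Prin_iff)
  show "s f = t f"
  proof (rule localization_eqI_cover[OF fc sectionD(2)[OF s f] sectionD(2)[OF t f]])
    show "D f \<subseteq> (\<Union>i\<in>I. D (F i))" using f cover by (auto simp: Prin_iff)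
    fix i assume i: "i \<in> I"
    then show Fi: "F i \<in> carrier R" using F by (simp add: Prin_iff)
    have sub: "f \<otimes> F i \<in> carrier R" "D (f \<otimes> F i) \<subseteq> D f" "D (f \<otimes> F i) \<subseteq> D (F i)"
      using fc Fi by (simp_all add: D_mult)
    show "loc_restr R f (f \<otimes> F i) (s f) = loc_restr R f (f \<otimes> F i) (t f)"
      using sectionD(3)[OF s f sub(1,2)] sectionD(3)[OF t f sub(1,2)]
        sectionD(3)[OF s F[OF i] sub(1,3)] sectionD(3)[OF t F[OF i] sub(1,3)] eq[OF i] by simp
  qed
qed

text \<open>The value at each \<open>h\<close> comes from gluing in \<open>R\<^sub>h\<close>; the values are compatible because they are determined
  on the cover. The index type is arbitrary so that one element \<open>F i\<close> may carry several indices, as happens both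
  for the sheaf property and for non-injective homomorphisms.\<close>

lemma section_glue:
  assumes F: "\<And>i. i \<in> I \<Longrightarrow> F i \<in> carrier R"
    and x: "\<And>i. i \<in> I \<Longrightarrow> x i \<in> carrier (Loc (F i))"
    and compat: "\<And>i j. i \<in> I \<Longrightarrow> j \<in> I \<Longrightarrow>
      loc_restr R (F i) (F i \<otimes> F j) (x i) = loc_restr R (F j) (F i \<otimes> F j) (x j)"
    and U: "U = (\<Union>i\<in>I. D (F i))"
  obtains s where "s \<in> carrier (Sec U)" "\<And>i. i \<in> I \<Longrightarrow> s (F i) = x i"
proof -
  have "\<forall>h\<in>Prin U. \<exists>y. y \<in> carrier (Loc h) \<and>
      (\<forall>i\<in>I. loc_restr R h (h \<otimes> F i) y = loc_restr R (F i) (h \<otimes> F i) (x i))"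
  proof
    fix h assume "h \<in> Prin U"
    then have h: "h \<in> carrier R" "D h \<subseteq> (\<Union>i\<in>I. D (F i))" using U by (simp_all add: Prin_iff)
    show "\<exists>y. y \<in> carrier (Loc h) \<and>
        (\<forall>i\<in>I. loc_restr R h (h \<otimes> F i) y = loc_restr R (F i) (h \<otimes> F i) (x i))"
      by (rule localization_glue[OF h(1) F x compat h(2)]) auto
  qed
  from bchoice[OF this] obtain y where
    y: "\<And>h. h \<in> Prin U \<Longrightarrow> y h \<in> carrier (Loc h)"
    and yi: "\<And>h i. h \<in> Prin U \<Longrightarrow> i \<in> I \<Longrightarrow>
      loc_restr R h (h \<otimes> F i) (y h) = loc_restr R (F i) (h \<otimes> F i) (x i)" by blast
  define s where "s = restrict y (Prin U)"
  have hF: "h \<otimes> F i \<in> carrier R" "D (h \<otimes> F i) \<subseteq> D h" "D (h \<otimes> F i) \<subseteq> D (F i)"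
    if "h \<in> carrier R" "i \<in> I" for h i
    using that F by (simp_all add: D_mult)
  have "s \<in> carrier (Sec U)"
    unfolding section_iff
  proof (intro conjI ballI impI)
    show "s \<in> extensional (Prin U)" by (simp add: s_def)
    fix f assume f: "f \<in> Prin U"
    show "s f \<in> carrier (Loc f)" using f y by (simp add: s_def)
    fix g assume g: "g \<in> carrier R" and sub: "D g \<subseteq> D f"
    have fc: "f \<in> carrier R" and gP: "g \<in> Prin U" using f g sub by (auto simp: Prin_iff)
    have "loc_restr R f g (y f) = y g"
    proof (rule localization_eqI_cover[OF g loc_restr_closed[OF fc g sub y[OF f]] y[OF gP] F])
      show "D g \<subseteq> (\<Union>i\<in>I. D (F i))" using gP U by (simp add: Prin_iff)
      fix i assume i: "i \<in> I"
      note gi = hF[OF g i] and fi = hF[OF fc i]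
      have gf: "D (g \<otimes> F i) \<subseteq> D (f \<otimes> F i)" using sub fc g F[OF i] by (auto simp: D_mult)
      have "loc_restr R g (g \<otimes> F i) (loc_restr R f g (y f)) =
          loc_restr R (f \<otimes> F i) (g \<otimes> F i) (loc_restr R f (f \<otimes> F i) (y f))"
        using loc_restr_trans[OF fc g gi(1) sub gi(2) y[OF f]]
          loc_restr_trans[OF fc fi(1) gi(1) fi(2) gf y[OF f]] by simp
      also have "\<dots> = loc_restr R (F i) (g \<otimes> F i) (x i)"
        unfolding yi[OF f i] by (rule loc_restr_trans[OF F[OF i] fi(1) gi(1) fi(3) gf x[OF i]])
      finally show "loc_restr R g (g \<otimes> F i) (loc_restr R f g (y f)) = loc_restr R g (g \<otimes> F i) (y g)"
        by (simp add: yi[OF gP i])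
    qed
    then show "loc_restr R f g (s f) = s g" using f gP by (simp add: s_def)
  qed
  moreover have "s (F i) = x i" if i: "i \<in> I" for i
  proof -
    have FP: "F i \<in> Prin U" using F[OF i] U i by (auto simp: Prin_iff)
    have "y (F i) = x i"
    proof (rule localization_eqI_cover[OF F[OF i] y[OF FP] x[OF i] F])
      show "D (F i) \<subseteq> (\<Union>i\<in>I. D (F i))" using i by blast
      fix j assume "j \<in> I"
      then show "loc_restr R (F i) (F i \<otimes> F j) (y (F i)) = loc_restr R (F i) (F i \<otimes> F j) (x i)"
        using yi[OF FP] compat[OF i] by simp
    qed
    then show ?thesis using FP by (simp add: s_def)
  qed
  ultimately show ?thesis using that by blast
qed

lemma section_restrict:
  assumes "s \<in> carrier (Sec U)" "V \<subseteq> U"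
  shows "restrict s (Prin V) \<in> carrier (Sec V)"
proof -
  have "g \<in> Prin V" if "f \<in> Prin V" "g \<in> carrier R" "D g \<subseteq> D f" for f g
    using that by (auto simp: Prin_iff)
  then show ?thesis
    using sectionD[OF assms(1)] Prin_mono[OF assms(2)] by (auto simp: section_iff)
qed

lemma restrict_hom:
  assumes "V \<subseteq> U"
  shows "csemiring_hom (Sec U) (Sec V) (\<lambda>s. restrict s (Prin V))"
proof -
  interpret U: csemiring "Sec U" by (rule csemiring_Sec)
  interpret V: csemiring "Sec V" by (rule csemiring_Sec)
  have P: "f \<in> Prin U" if "f \<in> Prin V" for f using that Prin_mono[OF assms] by blast
  show ?thesis
  proof
    show "(\<lambda>s. restrict s (Prin V)) \<in> ring_hom (Sec U) (Sec V)"
      by (intro ring_hom_memI section_restrict[OF _ assms] section_eqI[where U = V])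
        (simp_all add: section_ops_extensional section_ops P)
    show "restrict \<zero>\<^bsub>Sec U\<^esub> (Prin V) = \<zero>\<^bsub>Sec V\<^esub>"
      by (rule section_eqI[where U = V]) (simp_all add: section_ops_extensional section_ops P)
  qed
qed

lemma Spec_sel [simp]:
  "space_top (Spec G R u) = zariski G R u" "sections (Spec G R u) = structure_sections G R u"
  "restr (Spec G R u) U V s = restrict s (Prin V)" "gunit (Spec G R u) \<gamma> = eta G R u (u \<gamma>)"
  by (simp_all add: Spec_def opens_within_eq)

text \<open>Inverses are unique, hence the pointwise inverses of a section are again compatible with
  restriction.\<close>

lemma Sec_Units_iff:
  assumes s: "s \<in> carrier (Sec U)"
  shows "s \<in> Units (Sec U) \<longleftrightarrow> (\<forall>f\<in>Prin U. s f \<in> Units (Loc f))"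
proof -
  interpret U: csemiring "Sec U" by (rule csemiring_Sec)
  show ?thesis
  proof
    assume "s \<in> Units (Sec U)"
    then obtain t where t: "t \<in> carrier (Sec U)" "s \<otimes>\<^bsub>Sec U\<^esub> t = \<one>\<^bsub>Sec U\<^esub>" by (auto simp: U.Units_iff)
    show "\<forall>f\<in>Prin U. s f \<in> Units (Loc f)"
    proof
      fix f assume f: "f \<in> Prin U"
      interpret L: csemiring "Loc f" by (rule Loc_csemiring[OF f])
      have "s f \<otimes>\<^bsub>Loc f\<^esub> t f = \<one>\<^bsub>Loc f\<^esub>"
        using section_ops(1)[OF f, of s t] t(2) section_ops(3)[OF f] by simp
      then show "s f \<in> Units (Loc f)"
        using sectionD(2)[OF s f] sectionD(2)[OF t(1) f] by (auto simp: L.Units_iff)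
    qed
  next
    assume un: "\<forall>f\<in>Prin U. s f \<in> Units (Loc f)"
    define t where "t = (\<lambda>f\<in>Prin U. inv\<^bsub>Loc f\<^esub> s f)"
    have t: "t \<in> carrier (Sec U)"
      unfolding section_iff
    proof (intro conjI ballI impI)
      show "t \<in> extensional (Prin U)" by (simp add: t_def)
      fix f assume f: "f \<in> Prin U"
      interpret L: csemiring "Loc f" by (rule Loc_csemiring[OF f])
      show "t f \<in> carrier (Loc f)" using un f by (simp add: t_def)
      fix g assume g: "g \<in> carrier R" "D g \<subseteq> D f"
      then have gP: "g \<in> Prin U" using f by (auto simp: Prin_iff)
      interpret \<rho>: csemiring_hom "Loc f" "Loc g" "loc_restr R f g"
        using f g by (intro loc_restr_hom) (auto simp: Prin_iff)
      have uf: "s f \<in> Units (Loc f)" and ug: "s g \<in> Units (Loc g)" using un f gP by auto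
      have "loc_restr R f g (inv\<^bsub>Loc f\<^esub> s f) \<otimes>\<^bsub>Loc g\<^esub> s g = \<one>\<^bsub>Loc g\<^esub>"
        using uf sectionD(2)[OF s f] sectionD(3)[OF s f g]
          \<rho>.hom_mult[of "inv\<^bsub>Loc f\<^esub> s f" "s f"] by (simp add: \<rho>.hom_one)
      then show "loc_restr R f g (t f) = t g"
        using \<rho>.S.Units_r_cancel[OF ug, of "loc_restr R f g (inv\<^bsub>Loc f\<^esub> s f)" "inv\<^bsub>Loc g\<^esub> s g"] uf ug f gP
        by (simp add: t_def \<rho>.hom_closed)
    qed
    have "s \<otimes>\<^bsub>Sec U\<^esub> t = \<one>\<^bsub>Sec U\<^esub>"
    proof (rule section_eqI; (rule section_ops_extensional)?)
      fix f assume f: "f \<in> Prin U"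
      interpret L: csemiring "Loc f" by (rule Loc_csemiring[OF f])
      show "(s \<otimes>\<^bsub>Sec U\<^esub> t) f = \<one>\<^bsub>Sec U\<^esub> f" using un f by (simp add: section_ops[OF f] t_def)
    qed
    then show "s \<in> Units (Sec U)" using s t by (auto simp: U.Units_iff)
  qed
qed

subsection \<open>Global sections\<close>

lemma eta_apply:
  "a \<in> carrier R \<Longrightarrow> eta G R u a = (\<lambda>f\<in>carrier R. canon f a)"
  by (simp add: eta_def opens_within_eq Prin_Sp)

lemma eta_section: "a \<in> carrier R \<Longrightarrow> eta G R u a \<in> carrier (Sec Sp)"
  by (auto simp: section_iff eta_apply Prin_Sp canon_closed loc_restr_canon)

lemma eta_hom: "csemiring_hom R (Sec Sp) (eta G R u)"
proof -
  interpret S: csemiring "Sec Sp" by (rule csemiring_Sec)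
  have f: "f \<in> Prin Sp" if "f \<in> carrier R" for f using that by (simp add: Prin_Sp)
  show ?thesis
  proof
    show "eta G R u \<in> ring_hom R (Sec Sp)"
      by (intro ring_hom_memI eta_section section_eqI[where U = Sp] section_ops_extensional)
        (simp_all add: section_ops[OF f] Prin_Sp eta_apply canon_mult canon_add localization_one)
    show "eta G R u \<zero> = \<zero>\<^bsub>Sec Sp\<^esub>"
      by (intro section_eqI[where U = Sp] section_ops_extensional)
        (simp_all add: section_ops[OF f] Prin_Sp eta_apply localization_zero)
  qed
qed

lemma eta_inj: "inj_on (eta G R u) (carrier R)"
proof (rule inj_onI)
  fix a b assume ab: "a \<in> carrier R" "b \<in> carrier R" "eta G R u a = eta G R u b"
  have "eta G R u a \<one> = eta G R u b \<one>" by (simp only: ab(3))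
  then have "canon \<one> a = canon \<one> b" using ab(1,2) by (simp add: eta_apply)
  then show "a = b" using ab(1,2) by (auto simp: canon_eq_iff)
qed

text \<open>As \<open>D(1)\<close> is the whole space and all powers of 1 are 1, a global section is determined by its value
  at the index 1, which has the form \<open>a/1\<close>.\<close>

lemma eta_surj:
  assumes s: "s \<in> carrier (Sec Sp)"
  obtains a where "a \<in> carrier R" "s = eta G R u a"
proof -
  have 1: "\<one> \<in> Prin Sp" by (simp add: Prin_Sp)
  obtain a and n :: nat where a: "a \<in> carrier R" "s \<one> \<otimes>\<^bsub>Loc \<one>\<^esub> canon \<one> (\<one> [^] n) = canon \<one> a"
    using clear_denominator[OF one_closed sectionD(2)[OF s 1]] by metis
  interpret L: csemiring "Loc \<one>" by (rule csemiring_localization) simp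
  have s1: "s \<one> = canon \<one> a"
    using a sectionD(2)[OF s 1] by (simp flip: localization_one)
  have "s = eta G R u a"
  proof (rule section_eqI[OF sectionD(1)[OF s] sectionD(1)[OF eta_section[OF a(1)]]])
    fix f assume "f \<in> Prin Sp"
    then have f: "f \<in> carrier R" by (simp add: Prin_Sp)
    show "s f = eta G R u a f"
      using sectionD(3)[OF s 1 f] loc_restr_canon[OF one_closed f _ a(1)] D_subset_Sp f a(1)
      by (simp add: s1 D_one eta_apply)
  qed
  then show ?thesis using that a(1) by blast
qed

lemma eta_bij: "bij_betw (eta G R u) (carrier R) (carrier (Sec Sp))"
  using eta_inj eta_surj eta_section by (auto simp: bij_betw_def)

lemma section_value:
  assumes s: "s \<in> carrier (Sec U)" and f: "f \<in> Prin U"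
    and a: "a \<in> carrier R" "s f \<otimes>\<^bsub>Loc f\<^esub> canon f (f [^] (n::nat)) = canon f a"
    and g: "g \<in> carrier R" "D g \<subseteq> D f"
  shows "s g \<otimes>\<^bsub>Loc g\<^esub> canon g (f [^] n) = canon g a"
  using loc_restr_value[OF _ g sectionD(2)[OF s f] a] sectionD(3)[OF s f g] f by (simp add: Prin_iff)

text \<open>The maximal ideal of the stalk at \<open>P\<close>, phrased for sections. If \<open>s = a/f\<^sup>n\<close> is invertible on a smaller \<open>D(h)\<close>
  around \<open>P\<close>, then so is \<open>a/1\<close>, hence \<open>D(h) \<subseteq> D(a)\<close>. Conversely \<open>s\<close> is invertible on \<open>D(fa)\<close>.\<close>

lemma unit_germ_iff:
  assumes s: "s \<in> carrier (Sec U)" and f: "f \<in> Prin U" and P: "P \<in> D f"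
    and a: "a \<in> carrier R" "s f \<otimes>\<^bsub>Loc f\<^esub> canon f (f [^] (n::nat)) = canon f a"
  shows "unit_germ (Spec G R u) U s P \<longleftrightarrow> a \<notin> P"
proof -
  have fc: "f \<in> carrier R" using f by (simp add: Prin_iff)
  have P': "prime_set P" "f \<notin> P" using P by (auto simp: D_def)
  note val = section_value[OF s f a]
  show ?thesis
  proof
    assume "unit_germ (Spec G R u) U s P"
    then obtain W where W: "openin (zariski G R u) W" "P \<in> W" "W \<subseteq> U"
        "restrict s (Prin W) \<in> Units (Sec W)" by (auto simp: unit_germ_def)
    obtain g where g: "g \<in> Prin W" "P \<in> D g" using W(1,2) by (auto simp: openin_zariski_iff)
    define h where "h = f \<otimes> g"
    have gc: "g \<in> carrier R" using g by (simp add: Prin_iff)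
    have h: "h \<in> carrier R" "D h \<subseteq> D f" "D h \<subseteq> D g" "P \<in> D h"
      using fc gc g P by (simp_all add: h_def D_mult)
    have hW: "h \<in> Prin W" using h g by (auto simp: Prin_iff)
    interpret L: csemiring "Loc h" by (rule csemiring_localization[OF h(1)])
    have "s h \<in> Units (Loc h)"
      using W(4) hW Sec_Units_iff[OF section_restrict[OF s W(3)]] by auto
    moreover have "canon h (f [^] n) \<in> Units (Loc h)"
      using D_subset_iff[of "f [^] n" h] D_pow[OF fc, of n] h fc by auto
    ultimately have "canon h a \<in> Units (Loc h)"
      using val[OF h(1,2)] L.Units_m_closed by metis
    then have "D h \<subseteq> D a" using D_subset_iff[OF a(1) h(1)] by simp
    then show "a \<notin> P" using h(4) by (auto simp: D_def)
  next
    assume aP: "a \<notin> P"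
    define W where "W = D (f \<otimes> a)"
    have W: "openin (zariski G R u) W" "P \<in> W" "W \<subseteq> U"
    proof -
      show "openin (zariski G R u) W" unfolding W_def using fc a(1) by (intro openin_D) simp
      show "P \<in> W" "W \<subseteq> U" using fc a(1) f P P' aP by (auto simp: W_def D_mult Prin_iff) (auto simp: D_def)
    qed
    have "s h \<in> Units (Loc h)" if h: "h \<in> Prin W" for h
    proof -
      have hc: "h \<in> carrier R" "D h \<subseteq> D f" "D h \<subseteq> D a"
        using h fc a(1) by (auto simp: Prin_iff W_def D_mult)
      interpret L: csemiring "Loc h" by (rule csemiring_localization[OF hc(1)])
      have hU: "h \<in> Prin U" using h W(3) by (auto simp: Prin_iff)
      have "canon h a \<in> Units (Loc h)" using D_subset_iff[OF a(1) hc(1)] hc(3) by simp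
      then show ?thesis
        using val[OF hc(1,2)] L.Units_factor[OF sectionD(2)[OF s hU] canon_closed, of "f [^] n"] fc by simp
    qed
    then have "restrict s (Prin W) \<in> Units (Sec W)"
      using Sec_Units_iff[OF section_restrict[OF s W(3)]] by auto
    then show "unit_germ (Spec G R u) U s P" unfolding unit_germ_def using W by auto
  qed
qed

lemma unit_germ_eta_iff:
  assumes "a \<in> carrier R" "P \<in> Sp"
  shows "unit_germ (Spec G R u) Sp (eta G R u a) P \<longleftrightarrow> a \<notin> P"
  by (rule unit_germ_iff[OF eta_section[OF assms(1)], of \<one> _ _ 0])
    (use assms in \<open>simp_all add: Prin_Sp D_one eta_apply canon_mult\<close>)

subsection \<open>The sheaf property\<close>

text \<open>Gluing sections \<open>s V\<close> reduces to gluing the elements \<open>s V f\<close> over the principal opens \<open>D(f) \<subseteq> V\<close>, indexed by the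
  pairs \<open>(V, f)\<close>.\<close>

lemma sheaf_glue_unique:
  assumes op: "\<And>V. V \<in> \<U> \<Longrightarrow> openin (zariski G R u) V"
    and s: "\<And>V. V \<in> \<U> \<Longrightarrow> s V \<in> carrier (Sec V)"
    and compat: "\<And>V W. V \<in> \<U> \<Longrightarrow> W \<in> \<U> \<Longrightarrow>
      restrict (s V) (Prin (V \<inter> W)) = restrict (s W) (Prin (V \<inter> W))"
  shows "\<exists>!t. t \<in> carrier (Sec (\<Union>\<U>)) \<and> (\<forall>V\<in>\<U>. restrict t (Prin V) = s V)"
proof -
  define I where "I = Sigma \<U> Prin"
  have U: "\<Union>\<U> = (\<Union>i\<in>I. D (snd i))"
  proof -
    have "\<Union>\<U> = (\<Union>V\<in>\<U>. \<Union>f\<in>Prin V. D f)" using open_eq_Union[OF op] by auto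
    also have "\<dots> = (\<Union>i\<in>I. D (snd i))" by (force simp: I_def)
    finally show ?thesis .
  qed
  have F: "snd i \<in> carrier R" if "i \<in> I" for i using that by (auto simp: I_def Prin_iff)
  have FU: "snd i \<in> Prin (\<Union>\<U>)" if "i \<in> I" for i using that by (force simp: I_def Prin_iff)
  have x: "s (fst i) (snd i) \<in> carrier (Loc (snd i))" if "i \<in> I" for i
    using that sectionD(2)[OF s] by (auto simp: I_def)
  have "loc_restr R (snd i) (snd i \<otimes> snd j) (s (fst i) (snd i)) =
      loc_restr R (snd j) (snd i \<otimes> snd j) (s (fst j) (snd j))" if "i \<in> I" "j \<in> I" for i j
  proof -
    obtain V f W g where ij: "i = (V, f)" "j = (W, g)" "V \<in> \<U>" "W \<in> \<U>" "f \<in> Prin V" "g \<in> Prin W"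
      using \<open>i \<in> I\<close> \<open>j \<in> I\<close> by (auto simp: I_def)
    have fg: "f \<otimes> g \<in> carrier R" "D (f \<otimes> g) \<subseteq> D f" "D (f \<otimes> g) \<subseteq> D g" "f \<otimes> g \<in> Prin (V \<inter> W)"
      using ij by (auto simp: Prin_iff D_mult)
    have "loc_restr R f (f \<otimes> g) (s V f) = s V (f \<otimes> g)"
      by (rule sectionD(3)[OF s[OF ij(3)] ij(5) fg(1,2)])
    also have "\<dots> = s W (f \<otimes> g)" using fun_cong[OF compat[OF ij(3,4)], of "f \<otimes> g"] fg(4) by simp
    also have "\<dots> = loc_restr R g (f \<otimes> g) (s W g)"
      by (rule sectionD(3)[OF s[OF ij(4)] ij(6) fg(1,3), symmetric])
    finally show ?thesis by (simp add: ij)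
  qed
  then obtain t where t: "t \<in> carrier (Sec (\<Union>\<U>))" "\<And>i. i \<in> I \<Longrightarrow> t (snd i) = s (fst i) (snd i)"
    using section_glue[OF F x _ U] by blast
  show ?thesis
  proof (rule ex1I[of _ t])
    show "t \<in> carrier (Sec (\<Union>\<U>)) \<and> (\<forall>V\<in>\<U>. restrict t (Prin V) = s V)"
    proof (intro conjI ballI t(1))
      fix V assume V: "V \<in> \<U>"
      show "restrict t (Prin V) = s V"
      proof (rule section_eqI[OF _ sectionD(1)[OF s[OF V]]])
        fix f assume f: "f \<in> Prin V"
        then have "(V, f) \<in> I" using V by (simp add: I_def)
        then show "restrict t (Prin V) f = s V f" using t(2)[of "(V, f)"] f by simp
      qed simp
    qed
    fix t' assume t': "t' \<in> carrier (Sec (\<Union>\<U>)) \<and> (\<forall>V\<in>\<U>. restrict t' (Prin V) = s V)"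
    show "t' = t"
    proof (rule section_eqI_cover[OF _ t(1) FU])
      show "t' \<in> carrier (Sec (\<Union>\<U>))" using t' by simp
      show "\<Union>\<U> \<subseteq> (\<Union>i\<in>I. D (snd i))" using U by simp
      fix i assume i: "i \<in> I"
      then have "fst i \<in> \<U>" "snd i \<in> Prin (fst i)" by (auto simp: I_def)
      then have "restrict t' (Prin (fst i)) (snd i) = s (fst i) (snd i)" using t' by simp
      then show "t' (snd i) = t (snd i)" using \<open>snd i \<in> Prin (fst i)\<close> t(2)[OF i] by simp
    qed
  qed
qed

lemma sheaf_Spec: "sheaf_of_semirings (Spec G R u)"
proof -
  have rr: "Prin V \<inter> Prin W = Prin W" if "W \<subseteq> V" for V W
    using Prin_mono[OF that] by blast
  have hom: "restrict (\<lambda>s. restrict s (Prin V)) (carrier (Sec U)) \<in> semiring_hom (Sec U) (Sec V)"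
    if "V \<subseteq> U" for U V
    by (simp add: semiring_hom_iff[OF csemiring_Sec csemiring_Sec])
      (rule csemiring_hom_cong[OF restrict_hom[OF that]], simp)
  show ?thesis
    unfolding sheaf_of_semirings_def Spec_sel
  proof (intro conjI allI impI ballI)
    fix U s assume "s \<in> carrier (Sec U)"
    then show "restrict s (Prin U) = s" using sectionD(1) by (simp add: extensional_restrict)
  next
    fix \<U> s
    assume "(\<forall>V\<in>\<U>. openin (zariski G R u) V \<and> s V \<in> carrier (Sec V)) \<and>
       (\<forall>V\<in>\<U>. \<forall>W\<in>\<U>. restrict (s V) (Prin (V \<inter> W)) = restrict (s W) (Prin (V \<inter> W)))"
    then show "\<exists>!t. t \<in> carrier (Sec (\<Union>\<U>)) \<and> (\<forall>V\<in>\<U>. restrict t (Prin V) = s V)"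
      by (intro sheaf_glue_unique) auto
  qed (auto simp: csemiring_Sec hom rr)
qed

lemma gunit_hom: "gunit (Spec G R u) \<in> hom G (units_of (Sec Sp))"
proof -
  interpret \<eta>: csemiring_hom R "Sec Sp" "eta G R u" by (rule eta_hom)
  have "u \<in> hom G (units_of R)" using gamma_R by (simp add: gamma_semiring_def)
  then show ?thesis
    using u_closed \<eta>.hom_Units u_Units by (auto simp: hom_def units_of_def \<eta>.hom_mult)
qed

lemma gamma_space_Spec: "gamma_space G (Spec G R u)"
  using sheaf_Spec gunit_hom by (simp add: gamma_space_def topspace_zariski)

lemma gamma_semiring_global: "gamma_semiring G (Sec Sp) (gunit (Spec G R u))"
  using csemiring_Sec gunit_hom by (simp add: gamma_semiring_def)

end

section \<open>The morphism of spectra induced by a homomorphism\<close>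

locale affine_hom = T: affine G T u + S: affine G S v
  for G :: "('g, 'k) monoid_scheme" and T :: "('a, 'm) ring_scheme" and u :: "'g \<Rightarrow> 'a"
    and S :: "('b, 'n) ring_scheme" and v :: "'g \<Rightarrow> 'b" and \<phi> :: "'a \<Rightarrow> 'b" +
  assumes phi: "\<phi> \<in> tsr_hom G T u S v"
begin

sublocale h: csemiring_hom T S \<phi>
  using phi T.csemiring_axioms S.csemiring_axioms by (simp add: tsr_hom_def semiring_hom_iff)

lemma phi_u: "\<gamma> \<in> carrier G \<Longrightarrow> \<phi> (u \<gamma>) = v \<gamma>"
  using phi by (simp add: tsr_hom_def)

lemma phi_extensional: "\<phi> \<in> extensional (carrier T)"
  using phi by (simp add: tsr_hom_def semiring_hom_def)

abbreviation pt :: "'b set \<Rightarrow> 'a set" where "pt \<equiv> Spec_point G T S v \<phi>"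

definition pre :: "'a set set \<Rightarrow> 'b set set" where
  "pre U = {P \<in> S.Sp. pt P \<in> U}"

lemma pt_eq: "P \<in> S.Sp \<Longrightarrow> pt P = {a \<in> carrier T. \<phi> a \<in> P}"
  by (simp add: Spec_point_def)

lemma pt_in_Sp:
  assumes "P \<in> S.Sp" shows "pt P \<in> T.Sp"
proof -
  have P: "S.prime_set P" using assms by (simp add: S.Sp_eq)
  note id = S.ideal_setD[OF S.prime_setD(1)[OF P]]
  have "T.ideal_set {a \<in> carrier T. \<phi> a \<in> P}"
    by (rule T.ideal_setI) (auto simp: h.hom_zero h.hom_add h.hom_mult h.hom_closed id)
  then have "T.prime_set {a \<in> carrier T. \<phi> a \<in> P}"
    unfolding T.prime_set_def
    using S.prime_setD(2)[OF P] S.prime_setD(5)[OF P] h.hom_closed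
    by (auto simp: h.hom_one h.hom_mult)
  then show ?thesis by (simp add: pt_eq[OF assms] T.Sp_eq)
qed

lemma pt_in_D_iff:
  assumes "P \<in> S.Sp" "f \<in> carrier T"
  shows "pt P \<in> T.D f \<longleftrightarrow> P \<in> S.D (\<phi> f)"
  using pt_in_Sp[OF assms(1)] assms by (auto simp: T.D_def S.D_def T.Sp_eq S.Sp_eq pt_eq)

lemma pre_D: "f \<in> carrier T \<Longrightarrow> pre (T.D f) = S.D (\<phi> f)"
  using S.D_subset_Sp[of "\<phi> f"] pt_in_D_iff unfolding pre_def by blast

lemma pre_Sp: "pre T.Sp = S.Sp"
  using pt_in_Sp by (auto simp: pre_def)

lemma pre_mono: "V \<subseteq> U \<Longrightarrow> pre V \<subseteq> pre U"
  by (auto simp: pre_def)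

lemma phi_Prin: "f \<in> T.Prin U \<Longrightarrow> \<phi> f \<in> S.Prin (pre U)"
  using pre_mono[of "T.D f" U] by (auto simp: T.Prin_iff S.Prin_iff h.hom_closed pre_D)

lemma D_phi_mono:
  "f \<in> carrier T \<Longrightarrow> f' \<in> carrier T \<Longrightarrow> T.D f' \<subseteq> T.D f \<Longrightarrow> S.D (\<phi> f') \<subseteq> S.D (\<phi> f)"
  using pre_mono[of "T.D f'" "T.D f"] by (simp add: pre_D)

lemma pre_eq_Union:
  assumes "openin (zariski G T u) U"
  shows "pre U = (\<Union>f\<in>T.Prin U. S.D (\<phi> f))"
proof -
  have "pre U = (\<Union>f\<in>T.Prin U. pre (T.D f))"
    using T.open_eq_Union[OF assms] by (auto simp: pre_def)
  then show ?thesis by (simp add: pre_D T.Prin_iff)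
qed

lemma openin_pre:
  assumes "openin (zariski G T u) U"
  shows "openin (zariski G S v) (pre U)"
  unfolding pre_eq_Union[OF assms]
  by (intro openin_Union) (auto simp: T.Prin_iff h.hom_closed intro!: S.openin_D)

lemma phi_unit: "f \<in> carrier T \<Longrightarrow> g \<in> carrier S \<Longrightarrow> S.D g \<subseteq> S.D (\<phi> f) \<Longrightarrow>
    S.canon g (\<phi> f) \<in> Units (S.Loc g)"
  using S.D_subset_iff h.hom_closed by blast

text \<open>This lemma and the next one are the two triangles that express naturality of \<open>T\<^sub>f \<rightarrow> S\<^sub>\<phi>\<^sub>(\<^sub>f\<^sub>)\<close> in \<open>f\<close>; the
  diagonal is the map \<open>T\<^sub>f \<rightarrow> S\<^sub>g\<close>.\<close>

lemma loc_restr_loc_map: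
  assumes f: "f \<in> carrier T" and g: "g \<in> carrier S" and sub: "S.D g \<subseteq> S.D (\<phi> f)"
    and x: "x \<in> carrier (T.Loc f)"
  shows "loc_restr S (\<phi> f) g (loc_map T f S (\<phi> f) \<phi> x) = loc_map T f S g \<phi> x"
proof -
  note pf = h.hom_closed[OF f]
  obtain a and n :: nat where a: "a \<in> carrier T" "x \<otimes>\<^bsub>T.Loc f\<^esub> T.canon f (f [^]\<^bsub>T\<^esub> n) = T.canon f a"
    using T.clear_denominator[OF f x] by metis
  note un = phi_unit[OF f pf subset_refl]
  note c = h.loc_map_closed[OF f pf un x]
  show ?thesis
    by (rule h.loc_map_eqI[OF f g phi_unit[OF f g sub] x a, symmetric])
      (use h.loc_map_value[OF f pf un x a] S.loc_restr_value[OF pf g sub c h.hom_closed[OF a(1)]]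
        S.loc_restr_closed[OF pf g sub c] f in \<open>simp_all add: h.hom_pow\<close>)
qed

lemma loc_map_loc_restr:
  assumes f: "f \<in> carrier T" and f': "f' \<in> carrier T" and g: "g \<in> carrier S"
    and sub: "T.D f' \<subseteq> T.D f" and sub': "S.D g \<subseteq> S.D (\<phi> f')"
    and x: "x \<in> carrier (T.Loc f)"
  shows "loc_map T f' S g \<phi> (loc_restr T f f' x) = loc_map T f S g \<phi> x"
proof -
  interpret k: csemiring_hom "T.Loc f'" "S.Loc g" "loc_map T f' S g \<phi>"
    by (rule h.loc_map_hom[OF f' g phi_unit[OF f' g sub']])
  obtain a and n :: nat where a: "a \<in> carrier T" "x \<otimes>\<^bsub>T.Loc f\<^esub> T.canon f (f [^]\<^bsub>T\<^esub> n) = T.canon f a"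
    using T.clear_denominator[OF f x] by metis
  note c = T.loc_restr_closed[OF f f' sub x]
  have "loc_map T f' S g \<phi> (loc_restr T f f' x) \<otimes>\<^bsub>S.Loc g\<^esub> S.canon g (\<phi> (f [^]\<^bsub>T\<^esub> n)) =
      loc_map T f' S g \<phi> (loc_restr T f f' x \<otimes>\<^bsub>T.Loc f'\<^esub> T.canon f' (f [^]\<^bsub>T\<^esub> n))"
    using c f by (simp add: k.hom_mult T.canon_closed h.loc_map_canon[OF f' g phi_unit[OF f' g sub']])
  also have "\<dots> = S.canon g (\<phi> a)"
    using T.loc_restr_value[OF f f' sub x a] a(1) by (simp add: h.loc_map_canon[OF f' g phi_unit[OF f' g sub']])
  finally show ?thesis
    using sub' D_phi_mono[OF f f' sub]
    by (intro h.loc_map_eqI[OF f g phi_unit[OF f g] x a, symmetric] k.hom_closed[OF c]) auto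
qed

abbreviation lmap :: "'a \<Rightarrow> ('a \<times> 'a) set \<Rightarrow> ('b \<times> 'b) set" where
  "lmap f \<equiv> loc_map T f S (\<phi> f) \<phi>"

lemma lmap_hom: "f \<in> carrier T \<Longrightarrow> csemiring_hom (T.Loc f) (S.Loc (\<phi> f)) (lmap f)"
  by (rule h.loc_map_hom) (simp_all add: h.hom_closed phi_unit)

lemma lmap_closed: "f \<in> carrier T \<Longrightarrow> x \<in> carrier (T.Loc f) \<Longrightarrow> lmap f x \<in> carrier (S.Loc (\<phi> f))"
  by (rule csemiring_hom.hom_closed[OF lmap_hom])

lemma lmap_canon: "f \<in> carrier T \<Longrightarrow> a \<in> carrier T \<Longrightarrow> lmap f (T.canon f a) = S.canon (\<phi> f) (\<phi> a)"
  by (rule h.loc_map_canon) (simp_all add: h.hom_closed phi_unit)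

lemma lmap_value:
  assumes "f \<in> carrier T" "x \<in> carrier (T.Loc f)" "a \<in> carrier T"
    "x \<otimes>\<^bsub>T.Loc f\<^esub> T.canon f (f [^]\<^bsub>T\<^esub> (n::nat)) = T.canon f a"
  shows "lmap f x \<otimes>\<^bsub>S.Loc (\<phi> f)\<^esub> S.canon (\<phi> f) (\<phi> f [^]\<^bsub>S\<^esub> n) = S.canon (\<phi> f) (\<phi> a)"
  using h.loc_map_value[OF assms(1) h.hom_closed[OF assms(1)] phi_unit assms(2-4)] assms(1)
  by (simp add: h.hom_pow h.hom_closed)

text \<open>The sets \<open>D(\<phi>(f))\<close> with \<open>D(f) \<subseteq> U\<close> cover the preimage of \<open>U\<close>, and the images of the \<open>s f\<close> are compatible:
  on \<open>D(\<phi>(fg))\<close> both restrictions are the image of \<open>s(fg)\<close>. So the section defining \<open>Spec_map\<close> exists and is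
  unique.\<close>

lemma pull_ex1:
  assumes U: "openin (zariski G T u) U" and s: "s \<in> carrier (T.Sec U)"
  shows "\<exists>!t. t \<in> carrier (S.Sec (pre U)) \<and> (\<forall>f\<in>T.Prin U. t (\<phi> f) = lmap f (s f))"
proof -
  have c: "f \<in> carrier T" "\<phi> f \<in> carrier S" if "f \<in> T.Prin U" for f
    using that by (auto simp: T.Prin_iff h.hom_closed)
  have half: "loc_restr S (\<phi> f) (\<phi> (f \<otimes>\<^bsub>T\<^esub> g)) (lmap f (s f)) = lmap (f \<otimes>\<^bsub>T\<^esub> g) (s (f \<otimes>\<^bsub>T\<^esub> g))"
    "loc_restr S (\<phi> g) (\<phi> (f \<otimes>\<^bsub>T\<^esub> g)) (lmap g (s g)) = lmap (f \<otimes>\<^bsub>T\<^esub> g) (s (f \<otimes>\<^bsub>T\<^esub> g))"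
    if f: "f \<in> T.Prin U" and g: "g \<in> T.Prin U" for f g
  proof -
    have fg: "f \<otimes>\<^bsub>T\<^esub> g \<in> carrier T" "T.D (f \<otimes>\<^bsub>T\<^esub> g) \<subseteq> T.D f" "T.D (f \<otimes>\<^bsub>T\<^esub> g) \<subseteq> T.D g"
      using c f g by (simp_all add: T.D_mult)
    have "loc_restr S (\<phi> k) (\<phi> (f \<otimes>\<^bsub>T\<^esub> g)) (lmap k (s k)) = lmap (f \<otimes>\<^bsub>T\<^esub> g) (s (f \<otimes>\<^bsub>T\<^esub> g))"
      if k: "k \<in> T.Prin U" "T.D (f \<otimes>\<^bsub>T\<^esub> g) \<subseteq> T.D k" for k
      using loc_restr_loc_map[OF c(1)[OF k(1)] h.hom_closed[OF fg(1)] D_phi_mono[OF c(1)[OF k(1)] fg(1) k(2)]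
            T.sectionD(2)[OF s k(1)]]
        loc_map_loc_restr[OF c(1)[OF k(1)] fg(1) h.hom_closed[OF fg(1)] k(2) subset_refl
            T.sectionD(2)[OF s k(1)]]
        T.sectionD(3)[OF s k(1) fg(1) k(2)] by simp
    then show "loc_restr S (\<phi> f) (\<phi> (f \<otimes>\<^bsub>T\<^esub> g)) (lmap f (s f)) = lmap (f \<otimes>\<^bsub>T\<^esub> g) (s (f \<otimes>\<^bsub>T\<^esub> g))"
      "loc_restr S (\<phi> g) (\<phi> (f \<otimes>\<^bsub>T\<^esub> g)) (lmap g (s g)) = lmap (f \<otimes>\<^bsub>T\<^esub> g) (s (f \<otimes>\<^bsub>T\<^esub> g))"
      using f g fg by blast+
  qed
  obtain t where t: "t \<in> carrier (S.Sec (pre U))" "\<And>f. f \<in> T.Prin U \<Longrightarrow> t (\<phi> f) = lmap f (s f)"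
  proof (rule S.section_glue[where I = "T.Prin U" and F = \<phi> and x = "\<lambda>f. lmap f (s f)" and U = "pre U"])
    show "\<phi> f \<in> carrier S" if "f \<in> T.Prin U" for f using that by (rule c)
    show "lmap f (s f) \<in> carrier (S.Loc (\<phi> f))" if "f \<in> T.Prin U" for f
      using that by (intro lmap_closed c T.sectionD(2)[OF s])
    show "loc_restr S (\<phi> f) (\<phi> f \<otimes>\<^bsub>S\<^esub> \<phi> g) (lmap f (s f)) = loc_restr S (\<phi> g) (\<phi> f \<otimes>\<^bsub>S\<^esub> \<phi> g) (lmap g (s g))"
      if "f \<in> T.Prin U" "g \<in> T.Prin U" for f g
      using half[OF that] c that by (simp add: h.hom_mult)
    show "pre U = (\<Union>f\<in>T.Prin U. S.D (\<phi> f))" by (rule pre_eq_Union[OF U])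
  qed blast
  show ?thesis
  proof (rule ex1I[of _ t])
    show "t \<in> carrier (S.Sec (pre U)) \<and> (\<forall>f\<in>T.Prin U. t (\<phi> f) = lmap f (s f))" using t by blast
    fix t' assume t': "t' \<in> carrier (S.Sec (pre U)) \<and> (\<forall>f\<in>T.Prin U. t' (\<phi> f) = lmap f (s f))"
    show "t' = t"
    proof (rule S.section_eqI_cover[where I = "T.Prin U" and F = \<phi>, OF conjunct1[OF t'] t(1) phi_Prin])
      show "pre U \<subseteq> (\<Union>f\<in>T.Prin U. S.D (\<phi> f))" by (simp add: pre_eq_Union[OF U])
    qed (use t' t(2) in auto)
  qed
qed

text \<open>Pullback of sections along \<open>Spec(\<phi>)\<close>.\<close>

abbreviation pull :: "'a set set \<Rightarrow> ('a \<Rightarrow> ('a \<times> 'a) set) \<Rightarrow> 'b \<Rightarrow> ('b \<times> 'b) set" where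
  "pull \<equiv> snd (Spec_map G T u S v \<phi>)"

lemma pull_eq_The:
  assumes "openin (zariski G T u) U" "s \<in> carrier (T.Sec U)"
  shows "pull U s = (THE t. t \<in> carrier (S.Sec (pre U)) \<and> (\<forall>f\<in>T.Prin U. t (\<phi> f) = lmap f (s f)))"
  using assms by (simp add: Spec_map_def T.opens_within_eq pre_def)

lemma
  assumes U: "openin (zariski G T u) U" and s: "s \<in> carrier (T.Sec U)"
  shows pull_closed: "pull U s \<in> carrier (S.Sec (pre U))"
    and pull_value: "\<And>f. f \<in> T.Prin U \<Longrightarrow> pull U s (\<phi> f) = lmap f (s f)"
  using theI'[OF pull_ex1[OF U s]] by (simp_all add: pull_eq_The[OF U s])

lemma pull_eqI:
  assumes U: "openin (zariski G T u) U" and s: "s \<in> carrier (T.Sec U)"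
    and t: "t \<in> carrier (S.Sec (pre U))" "\<And>f. f \<in> T.Prin U \<Longrightarrow> t (\<phi> f) = lmap f (s f)"
  shows "pull U s = t"
  unfolding pull_eq_The[OF U s] by (rule the1_equality[OF pull_ex1[OF U s]]) (use t in blast)

lemma pull_hom:
  assumes U: "openin (zariski G T u) U"
  shows "csemiring_hom (T.Sec U) (S.Sec (pre U)) (pull U)"
proof -
  interpret A: csemiring "T.Sec U" by (rule T.csemiring_Sec)
  interpret B: csemiring "S.Sec (pre U)" by (rule S.csemiring_Sec)
  have fc: "f \<in> carrier T" if "f \<in> T.Prin U" for f using that by (simp add: T.Prin_iff)
  note v = pull_value[OF U] T.section_ops S.section_ops[OF phi_Prin] T.sectionD(2)
    csemiring_hom.hom_mult[OF lmap_hom[OF fc]] csemiring_hom.hom_add[OF lmap_hom[OF fc]]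
    csemiring_hom.hom_one[OF lmap_hom[OF fc]] csemiring_hom.hom_zero[OF lmap_hom[OF fc]]
  show ?thesis
  proof
    show "pull U \<in> ring_hom (T.Sec U) (S.Sec (pre U))"
      by (rule ring_hom_memI; (rule pull_eqI[OF U])?) (simp_all add: v pull_closed[OF U])
    show "pull U \<zero>\<^bsub>T.Sec U\<^esub> = \<zero>\<^bsub>S.Sec (pre U)\<^esub>"
      by (rule pull_eqI[OF U]) (simp_all add: v)
  qed
qed

lemma pull_restrict:
  assumes "openin (zariski G T u) U" "openin (zariski G T u) V" "V \<subseteq> U" "s \<in> carrier (T.Sec U)"
  shows "pull V (restrict s (T.Prin V)) = restrict (pull U s) (S.Prin (pre V))"
proof (rule pull_eqI[OF assms(2) T.section_restrict[OF assms(4,3)]])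
  show "restrict (pull U s) (S.Prin (pre V)) \<in> carrier (S.Sec (pre V))"
    by (rule S.section_restrict[OF pull_closed[OF assms(1,4)] pre_mono[OF assms(3)]])
  fix f assume f: "f \<in> T.Prin V"
  then have "f \<in> T.Prin U" using T.Prin_mono[OF assms(3)] by blast
  then show "restrict (pull U s) (S.Prin (pre V)) (\<phi> f) = lmap f (restrict s (T.Prin V) f)"
    using f phi_Prin[OF f] pull_value[OF assms(1,4)] by simp
qed

lemma pull_eta:
  assumes a: "a \<in> carrier T"
  shows "pull T.Sp (eta G T u a) = eta G S v (\<phi> a)"
proof (rule pull_eqI[OF T.openin_Sp T.eta_section[OF a]])
  show "eta G S v (\<phi> a) \<in> carrier (S.Sec (pre T.Sp))"
    unfolding pre_Sp by (rule S.eta_section[OF h.hom_closed[OF a]])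
qed (use a in \<open>simp add: h.hom_closed T.Prin_Sp T.eta_apply S.eta_apply lmap_canon\<close>)

lemma fst_Spec_map: "fst (Spec_map G T u S v \<phi>) = pt"
  by (simp add: Spec_map_def)

lemma preim_Spec_map: "preim (Spec G S v) (Spec_map G T u S v \<phi>) U = pre U"
  by (simp add: preim_def pre_def fst_Spec_map S.topspace_zariski)

lemma ringed_morphism_Spec_map:
  "ringed_morphism (Spec G S v) (Spec G T u) (Spec_map G T u S v \<phi>)"
  unfolding ringed_morphism_def fst_Spec_map preim_Spec_map T.Spec_sel S.Spec_sel
proof (intro conjI allI impI ballI)
  show "pt \<in> extensional (topspace (zariski G S v))"
    by (simp add: Spec_point_def S.topspace_zariski)
  show "continuous_map (zariski G S v) (zariski G T u) pt"
    using openin_pre pt_in_Sp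
    by (simp add: continuous_map_def S.topspace_zariski T.topspace_zariski pre_def)
  show "pull \<in> extensional {V. openin (zariski G T u) V}"
    by (simp add: Spec_map_def)
next
  fix V assume V: "openin (zariski G T u) V"
  have "pull V \<in> extensional (carrier (T.Sec V))" using V by (simp add: Spec_map_def)
  then show "pull V \<in> semiring_hom (T.Sec V) (S.Sec (pre V))"
    using pull_hom[OF V] by (simp add: semiring_hom_iff T.csemiring_Sec S.csemiring_Sec)
next
  fix V W s assume "openin (zariski G T u) V \<and> openin (zariski G T u) W \<and> W \<subseteq> V"
    "s \<in> carrier (T.Sec V)"
  then show "pull W (restrict s (T.Prin W)) = restrict (pull V s) (S.Prin (pre W))"
    using pull_restrict by blast
qed

text \<open>Near \<open>\<phi>\<inverse>(P)\<close> write \<open>s = a/f\<^sup>n\<close>; its pullback is \<open>\<phi>(a)/\<phi>(f)\<^sup>n\<close> near \<open>P\<close>. By \<open>unit_germ_iff\<close> the germs are units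
  iff \<open>a \<notin> \<phi>\<inverse>(P)\<close> and iff \<open>\<phi>(a) \<notin> P\<close>, respectively.\<close>

lemma local_Spec_map:
  "local_on_stalks (Spec G S v) (Spec G T u) (Spec_map G T u S v \<phi>)"
  unfolding local_on_stalks_def fst_Spec_map preim_Spec_map T.Spec_sel S.Spec_sel S.topspace_zariski
proof (intro ballI allI impI)
  fix P V s assume P: "P \<in> S.Sp" and V: "openin (zariski G T u) V \<and> pt P \<in> V"
    and s: "s \<in> carrier (T.Sec V)" and un: "unit_germ (Spec G S v) (pre V) (pull V s) P"
  obtain f where f: "f \<in> T.Prin V" "pt P \<in> T.D f" using V by (auto simp: T.openin_zariski_iff)
  have fc: "f \<in> carrier T" using f by (simp add: T.Prin_iff)
  have Pf: "P \<in> S.D (\<phi> f)" using f(2) pt_in_D_iff[OF P fc] by simp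
  note sf = T.sectionD(2)[OF s f(1)]
  obtain a and n :: nat where a: "a \<in> carrier T" "s f \<otimes>\<^bsub>T.Loc f\<^esub> T.canon f (f [^]\<^bsub>T\<^esub> n) = T.canon f a"
    using T.clear_denominator[OF fc sf] by metis
  have "\<phi> a \<notin> P"
    using S.unit_germ_iff[OF pull_closed[OF conjunct1[OF V] s] phi_Prin[OF f(1)] Pf h.hom_closed[OF a(1)]]
      lmap_value[OF fc sf a] pull_value[OF conjunct1[OF V] s f(1)] un by simp
  then have "a \<notin> pt P" using a(1) by (simp add: pt_eq[OF P])
  then show "unit_germ (Spec G T u) V s (pt P)" using T.unit_germ_iff[OF s f a] by simp
qed

text \<open>The pullback is a homomorphism, and \<open>pull_eta\<close> with \<open>\<phi>(u\<^sub>\<gamma>) = v\<^sub>\<gamma>\<close> says that it takes the global section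
  \<open>u\<^sub>\<gamma>\<close> to \<open>v\<^sub>\<gamma>\<close>.\<close>

lemma respects_tern_Spec_map:
  "respects_tern G (Spec G S v) (Spec G T u) (Spec_map G T u S v \<phi>)"
  unfolding respects_tern_def preim_Spec_map
proof (intro allI impI ballI)
  fix V U a b c \<gamma>
  assume "affine_open G (Spec G T u) V" and U: "openin (space_top (Spec G S v)) U \<and> U \<subseteq> pre V"
    and "a \<in> carrier (sections (Spec G T u) V)" "b \<in> carrier (sections (Spec G T u) V)"
      "c \<in> carrier (sections (Spec G T u) V)"
    and \<gamma>: "\<gamma> \<in> carrier G"
  then have V: "openin (zariski G T u) V"
    and abc: "a \<in> carrier (T.Sec V)" "b \<in> carrier (T.Sec V)" "c \<in> carrier (T.Sec V)"
    by (auto simp: affine_open_def)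
  have VS: "V \<subseteq> T.Sp" using V by (simp add: T.openin_zariski_iff)
  interpret \<rho>: csemiring_hom "S.Sec (pre V)" "S.Sec U" "\<lambda>s. restrict s (S.Prin U)"
    by (rule S.restrict_hom) (use U in simp)
  interpret p: csemiring_hom "T.Sec V" "S.Sec (pre V)" "pull V" by (rule pull_hom[OF V])
  define w where "w = restrict (eta G T u (u \<gamma>)) (T.Prin V)"
  have w: "w \<in> carrier (T.Sec V)"
    unfolding w_def by (rule T.section_restrict[OF T.eta_section[OF T.u_closed[OF \<gamma>]] VS])
  have "pull V w = restrict (eta G S v (v \<gamma>)) (S.Prin (pre V))"
    unfolding w_def using pull_restrict[OF T.openin_Sp V VS T.eta_section[OF T.u_closed[OF \<gamma>]]]
    by (simp add: pull_eta T.u_closed \<gamma> phi_u)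
  then have pw: "restrict (pull V w) (S.Prin U) = restrict (eta G S v (v \<gamma>)) (S.Prin U)"
    using S.Prin_mono[of U "pre V"] U by (simp add: Int_absorb1)
  have "restrict (pull V (a \<otimes>\<^bsub>T.Sec V\<^esub> b \<otimes>\<^bsub>T.Sec V\<^esub> c \<otimes>\<^bsub>T.Sec V\<^esub> w)) (S.Prin U) =
      restrict (pull V a) (S.Prin U) \<otimes>\<^bsub>S.Sec U\<^esub> restrict (pull V b) (S.Prin U) \<otimes>\<^bsub>S.Sec U\<^esub>
      restrict (pull V c) (S.Prin U) \<otimes>\<^bsub>S.Sec U\<^esub> restrict (pull V w) (S.Prin U)"
    using abc w by (simp only: p.hom_mult \<rho>.hom_mult p.hom_closed \<rho>.hom_closed p.R.m_closed \<rho>.R.m_closed)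
  then show "restr (Spec G S v) (pre V) U (pull V (tern_on (Spec G T u) V \<gamma> a b c)) =
       tern_on (Spec G S v) U \<gamma> (restr (Spec G S v) (pre V) U (pull V a))
        (restr (Spec G S v) (pre V) U (pull V b)) (restr (Spec G S v) (pre V) U (pull V c))"
    by (simp only: tern_on_def tern_def T.Spec_sel S.Spec_sel pw flip: w_def)
qed

end

lemma affine_hom_id:
  assumes "affine G T u"
  shows "affine_hom G T u T u (\<lambda>a\<in>carrier T. a)"
proof -
  interpret affine G T u by fact
  have "csemiring_hom T T (\<lambda>a\<in>carrier T. a)" by (rule csemiring_hom_cong[OF csemiring_hom_id]) simp
  then have "(\<lambda>a\<in>carrier T. a) \<in> tsr_hom G T u T u"
    by (simp add: tsr_hom_def semiring_hom_iff csemiring_axioms u_closed)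
  then show ?thesis by unfold_locales
qed

lemma Spec_map_id:
  assumes "affine G T u"
  shows "Spec_map G T u T u (\<lambda>a\<in>carrier T. a) = id_map (Spec G T u)"
proof -
  interpret affine_hom G T u T u "\<lambda>a\<in>carrier T. a" by (rule affine_hom_id[OF assms])
  have pt: "pt P = P" if "P \<in> T.Sp" for P
    using that T.prime_setD(3)[of P] by (auto simp: pt_eq T.Sp_eq)
  have pre: "pre U = U" if "U \<subseteq> T.Sp" for U
    using that pt by (auto simp: pre_def)
  have pull_section: "pull U s = s" if U: "openin (zariski G T u) U" and s: "s \<in> carrier (T.Sec U)" for U s
  proof (rule pull_eqI[OF U s])
    show "s \<in> carrier (T.Sec (pre U))" using s U by (simp add: pre T.openin_zariski_iff)
    fix f assume f: "f \<in> T.Prin U"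
    then have fc: "f \<in> carrier T" by (simp add: T.Prin_iff)
    note sf = T.sectionD(2)[OF s f]
    obtain a and n :: nat where a: "a \<in> carrier T" "s f \<otimes>\<^bsub>T.Loc f\<^esub> T.canon f (f [^]\<^bsub>T\<^esub> n) = T.canon f a"
      using T.clear_denominator[OF fc sf] by metis
    have "loc_map T f T f (\<lambda>a\<in>carrier T. a) (s f) = s f"
      by (rule h.loc_map_eqI[OF fc fc _ sf a sf]) (use fc a phi_unit[OF fc fc] in simp_all)
    then show "s (restrict (\<lambda>a. a) (carrier T) f) = lmap f (s f)" using fc by simp
  qed
  have pull: "pull U = (\<lambda>s\<in>carrier (T.Sec U). s)" if "openin (zariski G T u) U" for U
    by (rule extensionalityI[of _ "carrier (T.Sec U)"])
      (use that pull_section in \<open>simp_all, simp add: Spec_map_def\<close>)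
  show ?thesis
  proof (rule prod_eqI)
    show "fst (Spec_map G T u T u (\<lambda>a\<in>carrier T. a)) = fst (id_map (Spec G T u))"
      unfolding id_map_def fst_conv fst_Spec_map T.Spec_sel T.topspace_zariski
      by (rule extensionalityI[of _ T.Sp]) (simp_all add: pt, simp add: Spec_point_def)
    show "snd (Spec_map G T u T u (\<lambda>a\<in>carrier T. a)) = snd (id_map (Spec G T u))"
      unfolding id_map_def snd_conv T.Spec_sel
      by (rule extensionalityI[of _ "{V. openin (zariski G T u) V}"])
        (simp_all add: pull, simp add: Spec_map_def)
  qed
qed

lemma affine_hom_compose:
  assumes "affine_hom G T' u' T u \<alpha>" "affine_hom G T u S v \<phi>"
  shows "affine_hom G T' u' S v (compose (carrier T') \<phi> \<alpha>)"
proof -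
  interpret a: affine_hom G T' u' T u \<alpha> by fact
  interpret p: affine_hom G T u S v \<phi> by fact
  have "csemiring_hom T' S (compose (carrier T') \<phi> \<alpha>)"
    by (rule csemiring_hom_cong[OF csemiring_hom_comp[OF a.h.csemiring_hom_axioms p.h.csemiring_hom_axioms]])
      (simp add: compose_def)
  then have "compose (carrier T') \<phi> \<alpha> \<in> tsr_hom G T' u' S v"
    by (simp add: tsr_hom_def semiring_hom_iff a.T.csemiring_axioms p.S.csemiring_axioms compose_def
        a.T.u_closed a.phi_u p.phi_u)
  then show ?thesis by unfold_locales
qed

text \<open>On points this is the formula for preimages. On sections it suffices to compare values on the covering
  opens \<open>D(\<phi>(\<alpha>(f)))\<close>, where it is functoriality of the maps between localizations.\<close>

lemma Spec_map_compose:
  assumes "affine_hom G T' u' T u \<alpha>" "affine_hom G T u S v \<phi>"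
  shows "Spec_map G T' u' S v (compose (carrier T') \<phi> \<alpha>) =
    comp_map (Spec G S v) (Spec G T u) (Spec G T' u')
      (Spec_map G T' u' T u \<alpha>) (Spec_map G T u S v \<phi>)"
proof -
  interpret a: affine_hom G T' u' T u \<alpha> by fact
  interpret p: affine_hom G T u S v \<phi> by fact
  interpret c: affine_hom G T' u' S v "compose (carrier T') \<phi> \<alpha>"
    by (rule affine_hom_compose[OF assms])
  have val: "compose (carrier T') \<phi> \<alpha> a = \<phi> (\<alpha> a)" if "a \<in> carrier T'" for a
    using that by (simp add: compose_def)
  have pt: "c.pt P = a.pt (p.pt P)" if "P \<in> p.S.Sp" for P
    using that p.pt_in_Sp[OF that] by (auto simp: c.pt_eq a.pt_eq p.pt_eq val a.h.hom_closed)
  have pre: "c.pre U = p.pre (a.pre U)" for U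
    using pt p.pt_in_Sp by (auto simp: c.pre_def p.pre_def a.pre_def)
  have lmap: "c.lmap f x = p.lmap (\<alpha> f) (a.lmap f x)" if f: "f \<in> carrier T'" and x: "x \<in> carrier (a.T.Loc f)" for f x
  proof -
    obtain b and n :: nat where b: "b \<in> carrier T'"
        "x \<otimes>\<^bsub>a.T.Loc f\<^esub> a.T.canon f (f [^]\<^bsub>T'\<^esub> n) = a.T.canon f b"
      using a.T.clear_denominator[OF f x] by metis
    note af = a.h.hom_closed[OF f] and ax = a.lmap_closed[OF f x]
    show ?thesis
      by (rule c.h.loc_map_eqI[OF f _ c.phi_unit[OF f] x b])
        (use f b(1) p.lmap_value[OF af ax a.h.hom_closed[OF b(1)] a.lmap_value[OF f x b]] p.lmap_closed[OF af ax]
          in \<open>simp_all add: c.h.hom_closed val p.h.hom_closed a.h.hom_closed a.h.hom_pow p.h.hom_pow\<close>)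
  qed
  have pull: "c.pull U s = p.pull (a.pre U) (a.pull U s)"
    if U: "openin (zariski G T' u') U" and s: "s \<in> carrier (a.T.Sec U)" for U s
  proof (rule c.pull_eqI[OF U s])
    note aU = a.openin_pre[OF U] and as = a.pull_closed[OF U s]
    show "p.pull (a.pre U) (a.pull U s) \<in> carrier (p.S.Sec (c.pre U))"
      unfolding pre by (rule p.pull_closed[OF aU as])
    fix f assume f: "f \<in> a.T.Prin U"
    then have fc: "f \<in> carrier T'" by (simp add: a.T.Prin_iff)
    show "p.pull (a.pre U) (a.pull U s) (compose (carrier T') \<phi> \<alpha> f) = c.lmap f (s f)"
      using lmap[OF fc a.T.sectionD(2)[OF s f]] p.pull_value[OF aU as a.phi_Prin[OF f]]
        a.pull_value[OF U s f] by (simp add: val[OF fc])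
  qed
  show ?thesis
  proof (rule prod_eqI)
    show "fst (Spec_map G T' u' S v (compose (carrier T') \<phi> \<alpha>)) =
      fst (comp_map (Spec G S v) (Spec G T u) (Spec G T' u') (Spec_map G T' u' T u \<alpha>) (Spec_map G T u S v \<phi>))"
      unfolding comp_map_def fst_conv c.fst_Spec_map a.fst_Spec_map p.fst_Spec_map p.S.Spec_sel p.S.topspace_zariski
      by (rule extensionalityI[of _ p.S.Sp]) (simp_all add: pt, simp add: Spec_point_def)
    show "snd (Spec_map G T' u' S v (compose (carrier T') \<phi> \<alpha>)) =
      snd (comp_map (Spec G S v) (Spec G T u) (Spec G T' u') (Spec_map G T' u' T u \<alpha>) (Spec_map G T u S v \<phi>))"
      unfolding comp_map_def snd_conv a.preim_Spec_map a.T.Spec_sel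
    proof (rule extensionalityI[of _ "{W. openin (zariski G T' u') W}"])
      fix W assume W: "W \<in> {W. openin (zariski G T' u') W}"
      have "c.pull W = (\<lambda>s\<in>carrier (a.T.Sec W). p.pull (a.pre W) (a.pull W s))"
        by (rule extensionalityI[of _ "carrier (a.T.Sec W)"])
          (use W pull in \<open>simp_all, simp add: Spec_map_def\<close>)
      then show "c.pull W = (\<lambda>W\<in>{W. openin (zariski G T' u') W}.
          \<lambda>s\<in>carrier (a.T.Sec W). p.pull (a.pre W) (a.pull W s)) W" using W by simp
    qed (simp_all add: Spec_map_def)
  qed
qed

section \<open>Affine schemes are schemes\<close>

lemma csemiring_hom_inverse:
  assumes "csemiring_hom R S h" and bij: "bij_betw h (carrier R) (carrier S)"
  shows "csemiring_hom S R (inv_into (carrier R) h)"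
proof -
  interpret h: csemiring_hom R S h by fact
  let ?k = "inv_into (carrier R) h"
  have inj: "inj_on h (carrier R)" using bij by (simp add: bij_betw_def)
  have k: "?k y \<in> carrier R" "h (?k y) = y" if "y \<in> carrier S" for y
    using bij that by (auto simp: bij_betw_def inv_into_into f_inv_into_f)
  have eq: "?k y = x" if "x \<in> carrier R" "h x = y" for x y
    using that inj by auto
  show ?thesis
  proof
    show "?k \<in> ring_hom S R"
      by (rule ring_hom_memI) (auto simp: k h.hom_mult h.hom_add h.hom_one intro!: eq)
    show "?k \<zero>\<^bsub>S\<^esub> = \<zero>\<^bsub>R\<^esub>" by (rule eq) (simp_all add: h.hom_zero)
  qed
qed

context affine begin

definition eta_inv :: "('a \<Rightarrow> ('a \<times> 'a) set) \<Rightarrow> 'a" where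
  "eta_inv = (\<lambda>s\<in>carrier (Sec Sp). inv_into (carrier R) (eta G R u) s)"

lemma eta_inv_eta: "a \<in> carrier R \<Longrightarrow> eta_inv (eta G R u a) = a"
  using eta_inj eta_section by (simp add: eta_inv_def)

lemma eta_eta_inv: "s \<in> carrier (Sec Sp) \<Longrightarrow> eta G R u (eta_inv s) = s"
  using eta_bij by (simp add: eta_inv_def bij_betw_def f_inv_into_f)

lemma affine_global: "affine G (Sec Sp) (gunit (Spec G R u))"
  by (intro affine.intro affine_axioms.intro csemiring_Sec comm_group_G gamma_semiring_global)

lemma eta_tsr_hom: "eta G R u \<in> tsr_hom G R u (Sec Sp) (gunit (Spec G R u))"
  using eta_hom by (simp add: tsr_hom_def semiring_hom_iff csemiring_axioms csemiring_Sec)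
    (simp add: eta_def)

lemma eta_inv_tsr_hom: "eta_inv \<in> tsr_hom G (Sec Sp) (gunit (Spec G R u)) R u"
proof -
  have "csemiring_hom (Sec Sp) R eta_inv"
    by (rule csemiring_hom_cong[OF csemiring_hom_inverse[OF eta_hom eta_bij]]) (simp add: eta_inv_def)
  then have "eta_inv \<in> semiring_hom (Sec Sp) R"
    by (simp add: semiring_hom_iff csemiring_axioms csemiring_Sec) (simp add: eta_inv_def)
  then show ?thesis by (simp add: tsr_hom_def eta_inv_eta u_closed)
qed

lemma eta_iso: "eta G R u \<in> tsr_iso G R u (Sec Sp) (gunit (Spec G R u))"
  using eta_tsr_hom eta_inv_tsr_hom eta_inv_eta eta_eta_inv by (auto simp: tsr_iso_def)

lemma open_subspace_Spec_sel [simp]: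
  "space_top (open_subspace (Spec G R u) Sp) = zariski G R u"
  "sections (open_subspace (Spec G R u) Sp) = structure_sections G R u"
  "restr (open_subspace (Spec G R u) Sp) = restr (Spec G R u)"
  by (simp_all add: open_subspace_def flip: topspace_zariski)

text \<open>The chart must be the spectrum of a semiring on the type of sections, so it is the spectrum of the
  global sections \<open>R'\<close>; functoriality turns the isomorphism \<open>\<eta> : R \<rightarrow> R'\<close> into mutually inverse morphisms of
  spectra.\<close>

lemma affine_open_Sp: "affine_open G (Spec G R u) Sp"
proof -
  let ?X = "Spec G R u" and ?Y = "Spec G (Sec Sp) (gunit (Spec G R u))"
  let ?m = "Spec_map G (Sec Sp) (gunit ?X) R u eta_inv"
  let ?n = "Spec_map G R u (Sec Sp) (gunit ?X) (eta G R u)"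
  interpret Y: affine G "Sec Sp" "gunit ?X" by (rule affine_global)
  interpret n: affine_hom G R u "Sec Sp" "gunit ?X" "eta G R u"
    by unfold_locales (rule eta_tsr_hom)
  interpret m: affine_hom G "Sec Sp" "gunit ?X" R u eta_inv
    by unfold_locales (rule eta_inv_tsr_hom)
  have "compose (carrier R) eta_inv (eta G R u) = (\<lambda>a\<in>carrier R. a)"
    by (auto simp: compose_def eta_inv_eta)
  then have nm: "comp_map ?X ?Y ?X ?n ?m = id_map ?X"
    using Spec_map_compose[OF n.affine_hom_axioms m.affine_hom_axioms] Spec_map_id[OF affine_axioms]
    by simp
  have "compose (carrier (Sec Sp)) (eta G R u) eta_inv = (\<lambda>s\<in>carrier (Sec Sp). s)"
    by (auto simp: compose_def eta_eta_inv)
  then have mn: "comp_map ?Y ?X ?Y ?m ?n = id_map ?Y"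
    using Spec_map_compose[OF m.affine_hom_axioms n.affine_hom_axioms] Spec_map_id[OF affine_global]
    by simp
  have units: "snd ?m (topspace (space_top ?Y)) (gunit ?Y \<gamma>) = gunit (open_subspace ?X Sp) \<gamma>"
    if "\<gamma> \<in> carrier G" for \<gamma>
  proof -
    have "snd ?m Y.Sp (eta G (Sec Sp) (gunit ?X) (gunit ?X \<gamma>)) = eta G R u (u \<gamma>)"
      using m.pull_eta[OF eta_section[OF u_closed[OF that]]] eta_inv_eta[OF u_closed[OF that]] by simp
    then show ?thesis
      using sectionD(1)[OF eta_section[OF u_closed[OF that]]]
      by (simp add: Y.topspace_zariski open_subspace_def topspace_zariski extensional_restrict)
  qed
  have "ringed_morphism (open_subspace ?X Sp) ?Y ?m"
    using m.ringed_morphism_Spec_map unfolding ringed_morphism_def preim_def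
      open_subspace_Spec_sel Spec_sel .
  moreover have "ringed_morphism ?Y (open_subspace ?X Sp) ?n"
    using n.ringed_morphism_Spec_map unfolding ringed_morphism_def preim_def
      open_subspace_Spec_sel Spec_sel .
  moreover have "comp_map (open_subspace ?X Sp) ?Y (open_subspace ?X Sp) ?n ?m = id_map (open_subspace ?X Sp)"
    using nm unfolding comp_map_def id_map_def preim_def open_subspace_Spec_sel Spec_sel .
  moreover have "comp_map ?Y (open_subspace ?X Sp) ?Y ?m ?n = id_map ?Y"
    using mn unfolding comp_map_def id_map_def preim_def open_subspace_Spec_sel Spec_sel .
  ultimately have "gamma_isomorphic G (open_subspace ?X Sp) ?Y"
    unfolding gamma_isomorphic_def using units by blast
  then show ?thesis
    using gamma_semiring_global openin_Sp unfolding affine_open_def Spec_sel by blast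
qed

lemma gamma_scheme_Spec: "gamma_scheme G (Spec G R u)"
  using gamma_space_Spec affine_open_Sp by (auto simp: gamma_scheme_def topspace_zariski)

end

lemma (in affine_hom) Spec_map_in_gsch_hom:
  "Spec_map G T u S v \<phi> \<in> gsch_hom G (Spec G S v) (Spec G T u)"
  by (simp add: gsch_hom_def T.gamma_scheme_Spec S.gamma_scheme_Spec ringed_morphism_Spec_map
      respects_tern_Spec_map local_Spec_map)


section \<open>Every morphism of affine schemes is induced by a homomorphism\<close>

locale affine_morphism = T: affine G T u + S: affine G S v
  for G :: "('g, 'k) monoid_scheme" and T :: "('a, 'm) ring_scheme" and u :: "'g \<Rightarrow> 'a"
    and S :: "('b, 'n) ring_scheme" and v :: "'g \<Rightarrow> 'b"
    and m :: "('b set, 'b \<Rightarrow> ('b \<times> 'b) set, 'a set, 'a \<Rightarrow> ('a \<times> 'a) set) spacemap" +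
  assumes m: "m \<in> gsch_hom G (Spec G S v) (Spec G T u)"
begin

abbreviation mpre :: "'a set set \<Rightarrow> 'b set set" where
  "mpre U \<equiv> preim (Spec G S v) m U"

lemma m_ringed: "ringed_morphism (Spec G S v) (Spec G T u) m"
  and m_tern: "respects_tern G (Spec G S v) (Spec G T u) m"
  and m_local: "local_on_stalks (Spec G S v) (Spec G T u) m"
  using m by (auto simp: gsch_hom_def)

lemma mpre_eq: "mpre U = {P \<in> S.Sp. fst m P \<in> U}"
  by (simp add: preim_def S.topspace_zariski)

lemma m_continuous: "continuous_map (zariski G S v) (zariski G T u) (fst m)"
  using m_ringed by (simp add: ringed_morphism_def)

lemma m_point: "P \<in> S.Sp \<Longrightarrow> fst m P \<in> T.Sp"
  using m_continuous by (auto simp: continuous_map_def S.topspace_zariski T.topspace_zariski)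

lemma openin_mpre: "openin (zariski G T u) U \<Longrightarrow> openin (zariski G S v) (mpre U)"
  using m_continuous by (simp add: continuous_map_def mpre_eq S.topspace_zariski)

lemma mpre_Sp: "mpre T.Sp = S.Sp"
  using m_point by (auto simp: mpre_eq)

lemma m_hom: "openin (zariski G T u) U \<Longrightarrow> csemiring_hom (T.Sec U) (S.Sec (mpre U)) (snd m U)"
  using m_ringed by (simp add: ringed_morphism_def semiring_hom_iff T.csemiring_Sec S.csemiring_Sec)

lemma m_restrict:
  "openin (zariski G T u) V \<Longrightarrow> openin (zariski G T u) W \<Longrightarrow> W \<subseteq> V \<Longrightarrow> s \<in> carrier (T.Sec V) \<Longrightarrow>
    snd m W (restrict s (T.Prin W)) = restrict (snd m V s) (S.Prin (mpre W))"
  using m_ringed by (simp add: ringed_morphism_def)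

lemma m_global_hom: "csemiring_hom (T.Sec T.Sp) (S.Sec S.Sp) (snd m T.Sp)"
  using m_hom[OF T.openin_Sp] by (simp add: mpre_Sp)

text \<open>Apply the compatibility with ternary operations on the whole space to \<open>{1 1 1}\<^sub>\<gamma> = u\<^sub>\<gamma>\<close>.\<close>

lemma m_global_unit:
  assumes \<gamma>: "\<gamma> \<in> carrier G"
  shows "snd m T.Sp (eta G T u (u \<gamma>)) = eta G S v (v \<gamma>)"
proof -
  interpret h: csemiring_hom "T.Sec T.Sp" "S.Sec S.Sp" "snd m T.Sp" by (rule m_global_hom)
  note et = T.eta_section[OF T.u_closed[OF \<gamma>]] and es = S.eta_section[OF S.u_closed[OF \<gamma>]]
  have rT: "restrict s (T.Prin T.Sp) = s" if "s \<in> carrier (T.Sec T.Sp)" for s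
    using T.sectionD(1)[OF that] by (simp add: extensional_restrict)
  have rS: "restrict s (S.Prin S.Sp) = s" if "s \<in> carrier (S.Sec S.Sp)" for s
    using S.sectionD(1)[OF that] by (simp add: extensional_restrict)
  have "restr (Spec G S v) S.Sp S.Sp (snd m T.Sp (tern_on (Spec G T u) T.Sp \<gamma> \<one>\<^bsub>T.Sec T.Sp\<^esub> \<one>\<^bsub>T.Sec T.Sp\<^esub> \<one>\<^bsub>T.Sec T.Sp\<^esub>)) =
      tern_on (Spec G S v) S.Sp \<gamma> (restr (Spec G S v) S.Sp S.Sp (snd m T.Sp \<one>\<^bsub>T.Sec T.Sp\<^esub>))
        (restr (Spec G S v) S.Sp S.Sp (snd m T.Sp \<one>\<^bsub>T.Sec T.Sp\<^esub>))
        (restr (Spec G S v) S.Sp S.Sp (snd m T.Sp \<one>\<^bsub>T.Sec T.Sp\<^esub>))"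
    using m_tern T.affine_open_Sp S.openin_Sp h.R.one_closed \<gamma>
    unfolding respects_tern_def mpre_Sp[symmetric] T.Spec_sel S.Spec_sel by blast
  then show ?thesis
    using et es h.hom_closed[OF et]
    by (simp add: tern_on_def tern_def rT rS h.hom_one T.topspace_zariski S.topspace_zariski)
qed

text \<open>The homomorphism \<open>T \<rightarrow> S\<close> that \<open>m\<close> induces on global sections, transported along both \<open>\<eta>\<close>.\<close>

definition glob_hom :: "'a \<Rightarrow> 'b" where
  "glob_hom = (\<lambda>a\<in>carrier T. S.eta_inv (snd m T.Sp (eta G T u a)))"

lemma eta_phi: "a \<in> carrier T \<Longrightarrow> eta G S v (glob_hom a) = snd m T.Sp (eta G T u a)"
  using csemiring_hom.hom_closed[OF m_global_hom T.eta_section]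
  by (simp add: glob_hom_def S.eta_eta_inv)

lemma phi_tsr_hom: "glob_hom \<in> tsr_hom G T u S v"
proof -
  interpret k: affine_hom G "S.Sec S.Sp" "gunit (Spec G S v)" S v S.eta_inv
    by (intro affine_hom.intro affine_hom_axioms.intro S.affine_global S.affine_axioms S.eta_inv_tsr_hom)
  have "csemiring_hom T S glob_hom"
    by (rule csemiring_hom_cong[OF csemiring_hom_comp[OF csemiring_hom_comp[OF T.eta_hom m_global_hom]
      k.h.csemiring_hom_axioms]]) (simp add: glob_hom_def)
  then have "glob_hom \<in> semiring_hom T S"
    by (simp add: semiring_hom_iff T.csemiring_axioms S.csemiring_axioms) (simp add: glob_hom_def)
  then show ?thesis
    by (simp add: tsr_hom_def) (simp add: glob_hom_def T.u_closed m_global_unit S.eta_inv_eta S.u_closed)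
qed

sublocale ind: affine_hom G T u S v glob_hom
  by unfold_locales (rule phi_tsr_hom)

text \<open>The point \<open>m(P)\<close> is recovered from global sections: \<open>a\<close> lies outside \<open>m(P)\<close> iff the germ of \<open>a\<close> at
  \<open>m(P)\<close> is a unit. Homomorphisms preserve units and \<open>m\<close> is local, so this holds iff the germ at \<open>P\<close> of the
  global section of \<open>Spec(S)\<close> corresponding to \<open>glob_hom a\<close> is a unit.\<close>

lemma m_point_eq:
  assumes P: "P \<in> S.Sp"
  shows "fst m P = ind.pt P"
proof -
  note mP = m_point[OF P]
  have "a \<in> fst m P \<longleftrightarrow> glob_hom a \<in> P" if a: "a \<in> carrier T" for a
  proof -
    note et = T.eta_section[OF a]
    have "unit_germ (Spec G T u) T.Sp (eta G T u a) (fst m P) \<longleftrightarrow>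
        unit_germ (Spec G S v) S.Sp (eta G S v (glob_hom a)) P"
    proof
      assume "unit_germ (Spec G T u) T.Sp (eta G T u a) (fst m P)"
      then obtain W where W: "openin (zariski G T u) W" "fst m P \<in> W" "W \<subseteq> T.Sp"
          "restrict (eta G T u a) (T.Prin W) \<in> Units (T.Sec W)" by (auto simp: unit_germ_def)
      have "snd m W (restrict (eta G T u a) (T.Prin W)) \<in> Units (S.Sec (mpre W))"
        by (rule csemiring_hom.hom_Units[OF m_hom[OF W(1)] W(4)])
      then have "restrict (eta G S v (glob_hom a)) (S.Prin (mpre W)) \<in> Units (S.Sec (mpre W))"
        using m_restrict[OF T.openin_Sp W(1,3) et] by (simp add: eta_phi[OF a])
      moreover have "P \<in> mpre W" "mpre W \<subseteq> S.Sp" using P W(2) by (auto simp: mpre_eq)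
      ultimately show "unit_germ (Spec G S v) S.Sp (eta G S v (glob_hom a)) P"
        using openin_mpre[OF W(1)] by (auto simp: unit_germ_def)
    next
      assume "unit_germ (Spec G S v) S.Sp (eta G S v (glob_hom a)) P"
      then show "unit_germ (Spec G T u) T.Sp (eta G T u a) (fst m P)"
        using m_local P mP et T.openin_Sp
        by (simp add: local_on_stalks_def S.topspace_zariski mpre_Sp eta_phi[OF a])
    qed
    then show ?thesis
      using T.unit_germ_eta_iff[OF a mP] S.unit_germ_eta_iff[OF ind.h.hom_closed[OF a] P] by simp
  qed
  moreover have "fst m P \<subseteq> carrier T" using T.prime_setD(3) mP by (auto simp: T.Sp_eq)
  ultimately show ?thesis by (auto simp: ind.pt_eq[OF P])
qed

lemma mpre_eq_pre: "mpre U = ind.pre U"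
  using m_point_eq by (auto simp: mpre_eq ind.pre_def)

text \<open>By naturality \<open>m\<close> is known on restrictions of global sections. A section over \<open>D(f)\<close> satisfies
  \<open>s \<cdot> f\<^sup>n/1 = a/1\<close> with such restrictions as coefficients; applying \<open>m\<close> gives the equation that characterizes
  the image of \<open>s f\<close> in the localization of \<open>S\<close>.\<close>

lemma m_section_eq:
  assumes U: "openin (zariski G T u) U" and s: "s \<in> carrier (T.Sec U)"
  shows "snd m U s = ind.pull U s"
proof (rule ind.pull_eqI[OF U s, symmetric])
  show "snd m U s \<in> carrier (S.Sec (ind.pre U))"
    using csemiring_hom.hom_closed[OF m_hom[OF U] s] by (simp add: mpre_eq_pre)
  fix f assume f: "f \<in> T.Prin U"
  then have fc: "f \<in> carrier T" and fU: "T.D f \<subseteq> U" by (auto simp: T.Prin_iff)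
  note sf = T.sectionD(2)[OF s f] and Df = T.openin_D[OF fc]
  obtain a and n :: nat where a: "a \<in> carrier T" "s f \<otimes>\<^bsub>T.Loc f\<^esub> T.canon f (f [^]\<^bsub>T\<^esub> n) = T.canon f a"
    using T.clear_denominator[OF fc sf] by metis
  interpret mD: csemiring_hom "T.Sec (T.D f)" "S.Sec (S.D (glob_hom f))" "snd m (T.D f)"
    using m_hom[OF Df] by (simp add: mpre_eq_pre ind.pre_D[OF fc])
  define e where "e b = restrict (eta G T u b) (T.Prin (T.D f))" for b
  define r where "r = restrict s (T.Prin (T.D f))"
  have r: "r \<in> carrier (T.Sec (T.D f))" unfolding r_def by (rule T.section_restrict[OF s fU])
  have e: "e b \<in> carrier (T.Sec (T.D f))" if "b \<in> carrier T" for b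
    unfolding e_def by (rule T.section_restrict[OF T.eta_section[OF that] T.D_subset_Sp])
  have fn: "f [^]\<^bsub>T\<^esub> n \<in> carrier T" using fc by simp
  have re: "r \<otimes>\<^bsub>T.Sec (T.D f)\<^esub> e (f [^]\<^bsub>T\<^esub> n) = e a"
  proof (rule T.section_eqI[OF T.section_ops_extensional(1) T.sectionD(1)[OF e[OF a(1)]]])
    fix g assume g: "g \<in> T.Prin (T.D f)"
    then have gc: "g \<in> carrier T" "T.D g \<subseteq> T.D f" by (auto simp: T.Prin_iff)
    show "(r \<otimes>\<^bsub>T.Sec (T.D f)\<^esub> e (f [^]\<^bsub>T\<^esub> n)) g = e a g"
      using T.section_value[OF s f a gc] g gc(1) fn a(1)
      by (simp add: T.section_ops[OF g] r_def e_def T.eta_apply)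
  qed
  have pf: "glob_hom f \<in> S.Prin (S.D (glob_hom f))" using ind.h.hom_closed[OF fc] by (simp add: S.Prin_iff)
  have me: "snd m (T.D f) (e b) (glob_hom f) = S.canon (glob_hom f) (glob_hom b)" if "b \<in> carrier T" for b
    using m_restrict[OF T.openin_Sp Df T.D_subset_Sp T.eta_section[OF that]] pf that fc
    by (simp add: e_def mpre_eq_pre ind.pre_D[OF fc] eta_phi[symmetric] S.eta_apply ind.h.hom_closed)
  have mr: "snd m (T.D f) r (glob_hom f) = snd m U s (glob_hom f)"
    using m_restrict[OF U Df fU s] pf by (simp add: r_def mpre_eq_pre ind.pre_D[OF fc])
  have "snd m U s (glob_hom f) \<otimes>\<^bsub>S.Loc (glob_hom f)\<^esub> S.canon (glob_hom f) (glob_hom (f [^]\<^bsub>T\<^esub> n)) = S.canon (glob_hom f) (glob_hom a)"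
    using fun_cong[OF mD.hom_mult[OF r e[OF fn]], of "glob_hom f"] fn a(1)
    by (simp add: re S.section_ops[OF pf] me mr)
  moreover have "snd m U s (glob_hom f) \<in> carrier (S.Loc (glob_hom f))"
    using S.sectionD(2)[OF mD.hom_closed[OF r] pf] by (simp add: mr)
  ultimately show "snd m U s (glob_hom f) = ind.lmap f (s f)"
    using ind.h.loc_map_eqI[OF fc ind.h.hom_closed[OF fc] _ sf a] ind.phi_unit[OF fc ind.h.hom_closed[OF fc]]
    by simp
qed

lemma m_eq_Spec_map: "m = Spec_map G T u S v glob_hom"
proof (rule prod_eqI)
  show "fst m = fst (Spec_map G T u S v glob_hom)"
    unfolding ind.fst_Spec_map
  proof (rule extensionalityI[of _ S.Sp])
    show "fst m \<in> extensional S.Sp"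
      using m_ringed by (simp add: ringed_morphism_def S.topspace_zariski)
  qed (simp_all add: m_point_eq, simp add: Spec_point_def)
  show "snd m = ind.pull"
  proof (rule extensionalityI[of _ "{V. openin (zariski G T u) V}"])
    show "snd m \<in> extensional {V. openin (zariski G T u) V}"
      using m_ringed by (simp add: ringed_morphism_def)
    fix U assume "U \<in> {V. openin (zariski G T u) V}"
    then have U: "openin (zariski G T u) U" by simp
    show "snd m U = ind.pull U"
    proof (rule extensionalityI[of _ "carrier (T.Sec U)"])
      show "snd m U \<in> extensional (carrier (T.Sec U))"
        using m_ringed U by (simp add: ringed_morphism_def semiring_hom_def)
    qed (use U m_section_eq in \<open>simp_all, simp add: Spec_map_def\<close>)
  qed (simp add: Spec_map_def)
qed

end

lemma affineI: "comm_group G \<Longrightarrow> gamma_semiring G R u \<Longrightarrow> affine G R u"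
  by (simp add: affine_def affine_axioms_def gamma_semiring_def)

lemma affine_homI:
  "affine G T u \<Longrightarrow> affine G S v \<Longrightarrow> \<phi> \<in> tsr_hom G T u S v \<Longrightarrow> affine_hom G T u S v \<phi>"
  by (simp add: affine_hom_def affine_hom_axioms_def)

lemma affine_morphismI:
  "affine G T u \<Longrightarrow> affine G S v \<Longrightarrow> m \<in> gsch_hom G (Spec G S v) (Spec G T u) \<Longrightarrow>
    affine_morphism G T u S v m"
  by (simp add: affine_morphism_def affine_morphism_axioms_def)

lemma Spec_map_global_sections:
  assumes "affine_hom G T u S v \<phi>" "a \<in> carrier T"
  shows "global_map (Spec G T u) (Spec_map G T u S v \<phi>) (eta G T u a) = eta G S v (\<phi> a)"
proof -
  interpret affine_hom G T u S v \<phi> by fact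
  show ?thesis using pull_eta[OF assms(2)] by (simp add: global_map_def T.topspace_zariski)
qed

lemma Spec_map_inj:
  assumes "affine G T u" "affine G S v"
  shows "inj_on (Spec_map G T u S v) (tsr_hom G T u S v)"
proof (rule inj_onI)
  fix \<phi> \<psi> assume \<phi>: "\<phi> \<in> tsr_hom G T u S v" and \<psi>: "\<psi> \<in> tsr_hom G T u S v"
    and eq: "Spec_map G T u S v \<phi> = Spec_map G T u S v \<psi>"
  interpret p: affine_hom G T u S v \<phi> by (rule affine_homI[OF assms \<phi>])
  interpret q: affine_hom G T u S v \<psi> by (rule affine_homI[OF assms \<psi>])
  show "\<phi> = \<psi>"
  proof (rule extensionalityI[OF p.phi_extensional q.phi_extensional])
    fix a assume a: "a \<in> carrier T"
    have "eta G S v (\<phi> a) = eta G S v (\<psi> a)" using p.pull_eta[OF a] q.pull_eta[OF a] eq by simp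
    then show "\<phi> a = \<psi> a"
      using inj_onD[OF p.S.eta_inj] p.h.hom_closed[OF a] q.h.hom_closed[OF a] by blast
  qed
qed

lemma Spec_map_bij:
  assumes "affine G T u" "affine G S v"
  shows "bij_betw (Spec_map G T u S v) (tsr_hom G T u S v) (gsch_hom G (Spec G S v) (Spec G T u))"
proof -
  have "Spec_map G T u S v ` tsr_hom G T u S v = gsch_hom G (Spec G S v) (Spec G T u)"
    using affine_hom.Spec_map_in_gsch_hom[OF affine_homI[OF assms]]
      affine_morphism.m_eq_Spec_map[OF affine_morphismI[OF assms]]
      affine_morphism.phi_tsr_hom[OF affine_morphismI[OF assms]] by blast
  then show ?thesis using Spec_map_inj[OF assms] by (simp add: bij_betw_def)
qed

lemma inv_Spec_map:
  assumes "affine G T u" "affine G S v" and m: "m \<in> gsch_hom G (Spec G S v) (Spec G T u)"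
  shows "inv_into (tsr_hom G T u S v) (Spec_map G T u S v) m =
    (\<lambda>a\<in>carrier T. inv_into (carrier S) (eta G S v) (global_map (Spec G T u) m (eta G T u a)))"
proof -
  interpret affine_morphism G T u S v m by (rule affine_morphismI[OF assms])
  have "inv_into (tsr_hom G T u S v) (Spec_map G T u S v) m = glob_hom"
    using inv_into_f_f[OF Spec_map_inj[OF assms(1,2)] phi_tsr_hom] by (simp flip: m_eq_Spec_map)
  moreover have "glob_hom a = inv_into (carrier S) (eta G S v) (global_map (Spec G T u) m (eta G T u a))"
    if "a \<in> carrier T" for a
    using csemiring_hom.hom_closed[OF m_global_hom T.eta_section[OF that]] that
    by (simp add: glob_hom_def S.eta_inv_def global_map_def T.topspace_zariski)
  ultimately show ?thesis
    by (intro extensionalityI[of _ "carrier T"]) (simp_all add: glob_hom_def)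
qed

theorem theorem4:
  fixes G :: "('g, 'k) monoid_scheme"
    and T :: "('a, 'm) ring_scheme" and u :: "'g \<Rightarrow> 'a"
    and S :: "('b, 'n) ring_scheme" and v :: "'g \<Rightarrow> 'b"
    and T' :: "('c, 'o) ring_scheme" and u' :: "'g \<Rightarrow> 'c"
    and S' :: "('d, 'r) ring_scheme" and v' :: "'g \<Rightarrow> 'd"
  assumes "comm_group G"
    and "gamma_semiring G T u" and "gamma_semiring G S v"
    and "gamma_semiring G T' u'" and "gamma_semiring G S' v'"
  shows "(bij_betw (Spec_map G T u S v) (tsr_hom G T u S v)
           (gsch_hom G (Spec G S v) (Spec G T u))) \<and>
    (Spec_map G T u T u (\<lambda>a\<in>carrier T. a) = id_map (Spec G T u)) \<and>
    (\<forall>\<alpha>\<in>tsr_hom G T' u' T u. \<forall>\<phi>\<in>tsr_hom G T u S v.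
           Spec_map G T' u' S v (compose (carrier T') \<phi> \<alpha>) =
           comp_map (Spec G S v) (Spec G T u) (Spec G T' u')
             (Spec_map G T' u' T u \<alpha>) (Spec_map G T u S v \<phi>)) \<and>
    (\<forall>\<alpha>\<in>tsr_hom G T' u' T u. \<forall>\<phi>\<in>tsr_hom G T u S v. \<forall>\<beta>\<in>tsr_hom G S v S' v'.
           Spec_map G T' u' S' v' (compose (carrier T') \<beta> (compose (carrier T') \<phi> \<alpha>)) =
           comp_map (Spec G S' v') (Spec G S v) (Spec G T' u')
             (comp_map (Spec G S v) (Spec G T u) (Spec G T' u')
                (Spec_map G T' u' T u \<alpha>) (Spec_map G T u S v \<phi>))
             (Spec_map G S v S' v' \<beta>)) \<and>
    (gamma_semiring G (global_sections (Spec G T u)) (gunit (Spec G T u))) \<and>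
    (eta G T u \<in> tsr_iso G T u (global_sections (Spec G T u)) (gunit (Spec G T u))) \<and>
    (\<forall>a\<in>carrier T. \<forall>f\<in>carrier T.
           restr (Spec G T u) (topspace (space_top (Spec G T u))) (basic_open G T u f)
             (eta G T u a) f = fraction T f a \<one>\<^bsub>T\<^esub>) \<and>
    (\<forall>\<phi>\<in>tsr_hom G T u S v. \<forall>a\<in>carrier T.
           global_map (Spec G T u) (Spec_map G T u S v \<phi>) (eta G T u a) = eta G S v (\<phi> a)) \<and>
    (\<forall>m\<in>gsch_hom G (Spec G S v) (Spec G T u).
           inv_into (tsr_hom G T u S v) (Spec_map G T u S v) m =
           (\<lambda>a\<in>carrier T. inv_into (carrier S) (eta G S v)
              (global_map (Spec G T u) m (eta G T u a))))"
proof (intro conjI ballI)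
  note T = affineI[OF assms(1,2)] and S = affineI[OF assms(1,3)]
    and T' = affineI[OF assms(1,4)] and S' = affineI[OF assms(1,5)]
  interpret T: affine G T u by (rule T)
  show "bij_betw (Spec_map G T u S v) (tsr_hom G T u S v) (gsch_hom G (Spec G S v) (Spec G T u))"
    by (rule Spec_map_bij[OF T S])
  show "Spec_map G T u T u (\<lambda>a\<in>carrier T. a) = id_map (Spec G T u)"
    by (rule Spec_map_id[OF T])
  show functorial: "Spec_map G T' u' S v (compose (carrier T') \<phi> \<alpha>) =
      comp_map (Spec G S v) (Spec G T u) (Spec G T' u')
        (Spec_map G T' u' T u \<alpha>) (Spec_map G T u S v \<phi>)"
    if "\<alpha> \<in> tsr_hom G T' u' T u" "\<phi> \<in> tsr_hom G T u S v" for \<alpha> \<phi>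
    by (rule Spec_map_compose[OF affine_homI[OF T' T that(1)] affine_homI[OF T S that(2)]])
  show "Spec_map G T' u' S' v' (compose (carrier T') \<beta> (compose (carrier T') \<phi> \<alpha>)) =
      comp_map (Spec G S' v') (Spec G S v) (Spec G T' u')
        (comp_map (Spec G S v) (Spec G T u) (Spec G T' u')
          (Spec_map G T' u' T u \<alpha>) (Spec_map G T u S v \<phi>))
        (Spec_map G S v S' v' \<beta>)"
    if \<alpha>: "\<alpha> \<in> tsr_hom G T' u' T u" and \<phi>: "\<phi> \<in> tsr_hom G T u S v"
      and \<beta>: "\<beta> \<in> tsr_hom G S v S' v'" for \<alpha> \<phi> \<beta>
    unfolding functorial[OF \<alpha> \<phi>, symmetric]
    by (rule Spec_map_compose[OF affine_hom_compose[OF affine_homI[OF T' T \<alpha>] affine_homI[OF T S \<phi>]]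
        affine_homI[OF S S' \<beta>]])
  show "gamma_semiring G (global_sections (Spec G T u)) (gunit (Spec G T u))"
    using T.gamma_semiring_global by (simp add: T.topspace_zariski)
  show "eta G T u \<in> tsr_iso G T u (global_sections (Spec G T u)) (gunit (Spec G T u))"
    using T.eta_iso by (simp add: T.topspace_zariski)
  show "restr (Spec G T u) (topspace (space_top (Spec G T u))) (basic_open G T u f) (eta G T u a) f =
      fraction T f a \<one>\<^bsub>T\<^esub>" if "a \<in> carrier T" "f \<in> carrier T" for a f
    using that by (simp add: T.basic_open_eq T.Prin_iff T.eta_apply)
  show "global_map (Spec G T u) (Spec_map G T u S v \<phi>) (eta G T u a) = eta G S v (\<phi> a)"
    if "\<phi> \<in> tsr_hom G T u S v" "a \<in> carrier T" for \<phi> a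
    by (rule Spec_map_global_sections[OF affine_homI[OF T S that(1)] that(2)])
  show "inv_into (tsr_hom G T u S v) (Spec_map G T u S v) m =
      (\<lambda>a\<in>carrier T. inv_into (carrier S) (eta G S v) (global_map (Spec G T u) m (eta G T u a)))"
    if "m \<in> gsch_hom G (Spec G S v) (Spec G T u)" for m
    by (rule inv_Spec_map[OF T S that])
qed

end
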